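(* Let $K_X,K_Y\ge2$ be integers and let $X$ and $Y$ be regular $K_X$- and $K_Y$-ary rooted trees equipped with metrics $d_X$ and $d_Y$ given by $d_X(x,y)=\int_{[x,y]}e^{-\varepsilon_X|z|}\,d|z|$ and $d_Y(x,y)=\int_{[x,y]}e^{-\varepsilon_Y|z|}\,d|z|$ with $\varepsilon_X,\varepsilon_Y>0$. Let $f:\partial X\to\partial Y$ be an $\eta$-quasisymmetric map with $$\eta(t)=\begin{cases}At^{\alpha_1},& t\le1,\\ At^{\alpha_2},& t\ge1,\end{cases}\qquad\alpha_1,\alpha_2,A>0,$$ and let $Q_X=(\log K_X)/\varepsilon_X$ and $Q_Y=(\log K_Y)/\varepsilon_Y$ be the Hausdorff dimensions of $\partial X$ and $\partial Y$. Suppose that $1\le p<\infty$ and $\theta_X,\theta_Y\in(0,1)$ satisfy $$\theta_X\le\begin{cases}\dfrac{Q_X}{p}+\alpha_1\Bigl(\theta_Y-\dfrac{Q_Y}{p}\Bigr),&\text{if }\theta_Y\ge\dfrac{Q_Y}{p},\\[3mm]\dfrac{Q_X}{p}+\alpha_2\Bigl(\theta_Y-\dfrac{Q_Y}{p}\Bigr),&\text{if }\theta_Y\le\dfrac{Q_Y}{p}.\end{cases}$$ Then $f$ induces a canonical embedding, i.e. a bounded linear map, $f_\#:B^{\theta_Y}_{p,p}(\partial Y)\to B^{\theta_X}_{p,p}(\partial X)$ such that whenever $u\in B^{\theta_Y}_{p,p}(\partial Y)$ is continuous, we have $f_\#(u)=u\circ f$.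
   Context: A rooted tree $X$ is a connected graph without cycles with a distinguished vertex (the root); each edge is regarded as an isometric copy of the unit interval, $|z|$ is the unweighted distance to the root, $[x,y]$ the geodesic between $x,y$, and $d|z|$ gives each edge Lebesgue measure $1$. The neighbors of a vertex other than the one closer to the root are its children; a tree is regular $K$-ary if every vertex has exactly $K$ children. Boundary: $\partial X$ is the completion of $(X,d_X)$ minus $X$; its points are identified with the infinite geodesics starting at the root. For distinct $\zeta,\xi\in\partial X$ whose geodesics from the root share exactly their first $k$ edges, $d_X(\zeta,\xi)=\frac2{\varepsilon_X}e^{-\varepsilon_Xk}$. $\nu_X$ is the normalized $Q_X$-dimensional Hausdorff measure on $\partial X$; it is the probability measure assigning mass $K_X^{-n}$ to the set of boundary points whose geodesic passes through a given vertex at distance $n$ from the root. Similarly for $Y$. A homeomorphism $f:\partial X\to\partial Y$ is $\eta$-quasisymmetric, where $\eta:[0,\infty)\to[0,\infty)$ is a homeomorphism, if $\frac{d_Y(f(x),f(y))}{d_Y(f(x),f(z))}\le\eta\bigl(\frac{d_X(x,y)}{d_X(x,z)}\bigr)$ for all $x,y,z\in\partial X$ with $x\ne z$. Besov spaces: for a $\nu$-measurable function $u$ on $\partial X$ (with $\nu=\nu_X$) and $t>0$, $E_p(u,t)=\bigl(\int_{\partial X}\frac1{\nu(B(\zeta,t))}\int_{B(\zeta,t)}|u(\zeta)-u(\xi)|^p\,d\nu(\xi)\,d\nu(\zeta)\bigr)^{1/p}$, with $B(\zeta,t)$ the open ball in $\partial X$, and for $\theta>0$, $\|u\|_{B^\theta_{p,p}(\partial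 X)}=\bigl(\int_0^\infty(E_p(u,t)/t^\theta)^p\frac{dt}t\bigr)^{1/p}$. $B^\theta_{p,p}(\partial X)$ consists of all $u\in L^p(\partial X,\nu)$ with finite seminorm, with norm $\|u\|_{L^p(\partial X)}+\|u\|_{B^\theta_{p,p}(\partial X)}$. Similarly for $\partial Y$. *)

theory Defs
  imports "HOL-Analysis.Analysis"
begin

section \<open>Rooted trees\<close>

record 'v rooted_graph =
  verts :: "'v set"
  adj :: "'v \<Rightarrow> 'v \<Rightarrow> bool"
  root :: 'v

definition is_walk :: "'v rooted_graph \<Rightarrow> 'v \<Rightarrow> 'v list \<Rightarrow> 'v \<Rightarrow> bool" where
  "is_walk T x xs y \<longleftrightarrow>
     xs \<noteq> [] \<and> hd xs = x \<and> last xs = y \<and> set xs \<subseteq> verts T \<and> successively (adj T) xs"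

definition is_cycle :: "'v rooted_graph \<Rightarrow> 'v list \<Rightarrow> bool" where
  "is_cycle T xs \<longleftrightarrow>
     3 \<le> length xs \<and> distinct xs \<and> successively (adj T) xs \<and> adj T (last xs) (hd xs)"

definition rooted_tree :: "'v rooted_graph \<Rightarrow> bool" where
  "rooted_tree T \<longleftrightarrow>
     root T \<in> verts T \<and>
     (\<forall>x y. adj T x y \<longrightarrow> x \<in> verts T \<and> y \<in> verts T \<and> x \<noteq> y \<and> adj T y x) \<and>
     (\<forall>x\<in>verts T. \<forall>y\<in>verts T. \<exists>xs. is_walk T x xs y) \<and>
     (\<nexists>xs. is_cycle T xs)"

definition graph_dist :: "'v rooted_graph \<Rightarrow> 'v \<Rightarrow> 'v \<Rightarrow> nat" where
  "graph_dist T x y = (LEAST n. \<exists>xs. is_walk T x xs y \<and> length xs = Suc n)"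

definition children :: "'v rooted_graph \<Rightarrow> 'v \<Rightarrow> 'v set" where
  "children T v = {w. adj T v w \<and> \<not> graph_dist T (root T) w < graph_dist T (root T) v}"

definition regular_tree :: "nat \<Rightarrow> 'v rooted_graph \<Rightarrow> bool" where
  "regular_tree K T \<longleftrightarrow>
     rooted_tree T \<and> (\<forall>v\<in>verts T. finite (children T v) \<and> card (children T v) = K)"


section \<open>The boundary of a rooted tree\<close>

text \<open>
  The points of the completion of the metric tree that do not lie in the tree are identified
  with the infinite geodesics starting at the root.
\<close>

definition boundary :: "'v rooted_graph \<Rightarrow> (nat \<Rightarrow> 'v) set" where
  "boundary T = {\<zeta>. \<zeta> 0 = root T \<and> range \<zeta> \<subseteq> verts T \<and> (\<forall>n. adj T (\<zeta> n) (\<zeta> (Suc n))) \<and>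
                     (\<forall>m n. m \<le> n \<longrightarrow> graph_dist T (\<zeta> m) (\<zeta> n) = n - m)}"

definition shared_edges :: "(nat \<Rightarrow> 'v) \<Rightarrow> (nat \<Rightarrow> 'v) \<Rightarrow> nat" where
  "shared_edges \<zeta> \<xi> = (LEAST n. \<zeta> (Suc n) \<noteq> \<xi> (Suc n))"

definition boundary_dist :: "real \<Rightarrow> (nat \<Rightarrow> 'v) \<Rightarrow> (nat \<Rightarrow> 'v) \<Rightarrow> real" where
  "boundary_dist \<epsilon> \<zeta> \<xi> =
     (if \<zeta> = \<xi> then 0 else 2 / \<epsilon> * exp (- \<epsilon> * real (shared_edges \<zeta> \<xi>)))"

text \<open>
  The distance is the length of the bi-infinite geodesic joining two boundary points, for the
  density \<open>exp (- \<epsilon> * \<bar>z\<bar>)\<close> of the metric on the tree: this geodesic consists of two rays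
  starting at the last common vertex, which lies at height \<open>shared_edges \<zeta> \<xi>\<close>.
\<close>

lemma has_integral_boundary_dist:
  assumes "\<epsilon> > 0" "\<zeta> \<noteq> \<xi>"
  shows "((\<lambda>s. 2 * exp (- \<epsilon> * s)) has_integral boundary_dist \<epsilon> \<zeta> \<xi>) {real (shared_edges \<zeta> \<xi>)..}"
  using has_integral_mult_right[OF has_integral_exp_minus_to_infinity[OF assms(1)], of 2] assms
  by (simp add: boundary_dist_def)

lemma Metric_space_boundary:
  assumes "\<epsilon> > 0"
  shows "Metric_space (boundary T) (boundary_dist \<epsilon>)"
proof
  show "0 \<le> boundary_dist \<epsilon> x y" for x y :: "nat \<Rightarrow> 'a"
    using assms by (simp add: boundary_dist_def)
  have "shared_edges x y = shared_edges y x" for x y :: "nat \<Rightarrow> 'a"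
    unfolding shared_edges_def by metis
  then show "boundary_dist \<epsilon> x y = boundary_dist \<epsilon> y x" for x y :: "nat \<Rightarrow> 'a"
    by (auto simp: boundary_dist_def)
  show "boundary_dist \<epsilon> x y = 0 \<longleftrightarrow> x = y" for x y :: "nat \<Rightarrow> 'a"
    using assms by (simp add: boundary_dist_def)
  fix x y z assume x: "x \<in> boundary T" and y: "y \<in> boundary T" and z: "z \<in> boundary T"
  show "boundary_dist \<epsilon> x z \<le> boundary_dist \<epsilon> x y + boundary_dist \<epsilon> y z"
  proof (cases "x = y \<or> y = z \<or> x = z")
    case True
    then show ?thesis using assms by (auto simp: boundary_dist_def)
  next
    case False
    have ex: "\<exists>n. x (Suc n) \<noteq> z (Suc n)"
    proof (rule ccontr)
      assume "\<not> ?thesis"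
      then have "x n = z n" for n
        using x z by (cases n) (auto simp: boundary_def)
      then show False using False by auto
    qed
    then have "x (Suc (shared_edges x z)) \<noteq> z (Suc (shared_edges x z))"
      unfolding shared_edges_def by (rule LeastI_ex)
    then have "x (Suc (shared_edges x z)) \<noteq> y (Suc (shared_edges x z)) \<or>
               y (Suc (shared_edges x z)) \<noteq> z (Suc (shared_edges x z))" by auto
    then have "shared_edges x y \<le> shared_edges x z \<or> shared_edges y z \<le> shared_edges x z"
      unfolding shared_edges_def[of x y] shared_edges_def[of y z] by (meson Least_le)
    then have "boundary_dist \<epsilon> x z \<le> boundary_dist \<epsilon> x y \<or>
               boundary_dist \<epsilon> x z \<le> boundary_dist \<epsilon> y z"
      using False assms by (auto simp: boundary_dist_def divide_right_mono)
    moreover have "0 \<le> boundary_dist \<epsilon> x y" "0 \<le> boundary_dist \<epsilon> y z"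
      using assms by (auto simp: boundary_dist_def)
    ultimately show ?thesis by linarith
  qed
qed


section \<open>Normalized Hausdorff measure\<close>

text \<open>Real powers of extended nonnegative reals; only used for \<open>a > 0\<close>.\<close>

definition enn_powr :: "ennreal \<Rightarrow> real \<Rightarrow> ennreal" where
  "enn_powr x a = (if x = \<infinity> then \<infinity> else ennreal (enn2real x powr a))"

definition set_diam :: "('b \<Rightarrow> 'b \<Rightarrow> real) \<Rightarrow> 'b set \<Rightarrow> ennreal" where
  "set_diam d U = (SUP x\<in>U. SUP y\<in>U. ennreal (d x y))"

definition hausdorff_premeasure ::
    "'b set \<Rightarrow> ('b \<Rightarrow> 'b \<Rightarrow> real) \<Rightarrow> real \<Rightarrow> real \<Rightarrow> 'b set \<Rightarrow> ennreal" where
  "hausdorff_premeasure M d s \<delta> A =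
     (INF U\<in>{U :: nat \<Rightarrow> 'b set.
               (\<forall>i. U i \<subseteq> M \<and> set_diam d (U i) \<le> ennreal \<delta>) \<and> A \<subseteq> (\<Union>i. U i)}.
        \<Sum>i. enn_powr (set_diam d (U i)) s)"

definition hausdorff_outer_measure ::
    "'b set \<Rightarrow> ('b \<Rightarrow> 'b \<Rightarrow> real) \<Rightarrow> real \<Rightarrow> 'b set \<Rightarrow> ennreal" where
  "hausdorff_outer_measure M d s A = (SUP \<delta>\<in>{0<..}. hausdorff_premeasure M d s \<delta> A)"

text \<open>
  A Borel measure. On the boundary of a regular \<open>K\<close>-ary tree, with \<open>s = ln K / \<epsilon>\<close>, it is the
  probability measure giving mass \<open>1 / K ^ n\<close> to the set of rays through a vertex of height \<open>n\<close>.
\<close>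

definition normalized_hausdorff_measure ::
    "'b set \<Rightarrow> ('b \<Rightarrow> 'b \<Rightarrow> real) \<Rightarrow> real \<Rightarrow> 'b measure" where
  "normalized_hausdorff_measure M d s =
     measure_of M {U. openin (Metric_space.mtopology M d) U}
       (\<lambda>A. hausdorff_outer_measure M d s A / hausdorff_outer_measure M d s M)"


section \<open>Quasisymmetric maps\<close>

definition quasisymmetric ::
    "'a set \<Rightarrow> ('a \<Rightarrow> 'a \<Rightarrow> real) \<Rightarrow> 'b set \<Rightarrow> ('b \<Rightarrow> 'b \<Rightarrow> real) \<Rightarrow>
     (real \<Rightarrow> real) \<Rightarrow> ('a \<Rightarrow> 'b) \<Rightarrow> bool" where
  "quasisymmetric M d N e \<eta> f \<longleftrightarrow>
     (\<exists>\<eta>'. homeomorphism {0..} {0..} \<eta> \<eta>') \<and>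
     homeomorphic_map (Metric_space.mtopology M d) (Metric_space.mtopology N e) f \<and>
     (\<forall>x\<in>M. \<forall>y\<in>M. \<forall>z\<in>M. x \<noteq> z \<longrightarrow> e (f x) (f y) / e (f x) (f z) \<le> \<eta> (d x y / d x z))"


section \<open>Besov spaces\<close>

text \<open>
  Elements of \<open>L\<^sup>p\<close> and Besov spaces are represented by real-valued Borel functions; two
  functions represent the same element iff they agree almost everywhere.
  The values of the functions outside \<open>space \<nu>\<close> are irrelevant.
\<close>

definition lp_norm :: "'b measure \<Rightarrow> real \<Rightarrow> ('b \<Rightarrow> real) \<Rightarrow> ennreal" where
  "lp_norm \<nu> p u = enn_powr (\<integral>\<^sup>+\<zeta>. ennreal (\<bar>u \<zeta>\<bar> powr p) \<partial>\<nu>) (1 / p)"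

definition besov_E ::
    "('b \<Rightarrow> 'b \<Rightarrow> real) \<Rightarrow> 'b measure \<Rightarrow> real \<Rightarrow> ('b \<Rightarrow> real) \<Rightarrow> real \<Rightarrow> ennreal" where
  "besov_E d \<nu> p u t =
     (let B = (\<lambda>\<zeta>. Metric_space.mball (space \<nu>) d \<zeta> t) in
      enn_powr
        (\<integral>\<^sup>+\<zeta>. 1 / emeasure \<nu> (B \<zeta>) *
               (\<integral>\<^sup>+\<xi>\<in>B \<zeta>. ennreal (\<bar>u \<zeta> - u \<xi>\<bar> powr p) \<partial>\<nu>) \<partial>\<nu>)
        (1 / p))"

definition besov_seminorm ::
    "('b \<Rightarrow> 'b \<Rightarrow> real) \<Rightarrow> 'b measure \<Rightarrow> real \<Rightarrow> real \<Rightarrow> ('b \<Rightarrow> real) \<Rightarrow> ennreal" where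
  "besov_seminorm d \<nu> \<theta> p u =
     enn_powr
       (\<integral>\<^sup>+t\<in>{0<..}. enn_powr (besov_E d \<nu> p u t / ennreal (t powr \<theta>)) p * ennreal (1 / t) \<partial>lborel)
       (1 / p)"

definition besov_space ::
    "('b \<Rightarrow> 'b \<Rightarrow> real) \<Rightarrow> 'b measure \<Rightarrow> real \<Rightarrow> real \<Rightarrow> ('b \<Rightarrow> real) set" where
  "besov_space d \<nu> \<theta> p =
     {u \<in> borel_measurable \<nu>. lp_norm \<nu> p u < \<infinity> \<and> besov_seminorm d \<nu> \<theta> p u < \<infinity>}"

definition besov_norm ::
    "('b \<Rightarrow> 'b \<Rightarrow> real) \<Rightarrow> 'b measure \<Rightarrow> real \<Rightarrow> real \<Rightarrow> ('b \<Rightarrow> real) \<Rightarrow> ennreal" where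
  "besov_norm d \<nu> \<theta> p u = lp_norm \<nu> p u + besov_seminorm d \<nu> \<theta> p u"

text \<open>
  Bounded linear maps \<open>B\<^sup>\<theta>\<^sub>p\<^sub>,\<^sub>p(\<nu>) \<rightarrow> B\<^sup>\<tau>\<^sub>p\<^sub>,\<^sub>p(\<mu>)\<close>, acting on representatives: the first two
  conditions say that \<open>F\<close> induces a map between the spaces of almost-everywhere classes.
\<close>

definition bounded_linear_besov ::
    "('b \<Rightarrow> 'b \<Rightarrow> real) \<Rightarrow> 'b measure \<Rightarrow> real \<Rightarrow>
     ('a \<Rightarrow> 'a \<Rightarrow> real) \<Rightarrow> 'a measure \<Rightarrow> real \<Rightarrow> real \<Rightarrow>
     (('b \<Rightarrow> real) \<Rightarrow> ('a \<Rightarrow> real)) \<Rightarrow> bool" where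
  "bounded_linear_besov e \<nu> \<theta> d \<mu> \<tau> p F \<longleftrightarrow>
     (\<forall>u\<in>besov_space e \<nu> \<theta> p. F u \<in> besov_space d \<mu> \<tau> p) \<and>
     (\<forall>u\<in>besov_space e \<nu> \<theta> p. \<forall>v\<in>besov_space e \<nu> \<theta> p.
        (AE \<xi> in \<nu>. u \<xi> = v \<xi>) \<longrightarrow> (AE \<zeta> in \<mu>. F u \<zeta> = F v \<zeta>)) \<and>
     (\<forall>u\<in>besov_space e \<nu> \<theta> p. \<forall>v\<in>besov_space e \<nu> \<theta> p.
        AE \<zeta> in \<mu>. F (\<lambda>\<xi>. u \<xi> + v \<xi>) \<zeta> = F u \<zeta> + F v \<zeta>) \<and>
     (\<forall>u\<in>besov_space e \<nu> \<theta> p. \<forall>c::real.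
        AE \<zeta> in \<mu>. F (\<lambda>\<xi>. c * u \<xi>) \<zeta> = c * F u \<zeta>) \<and>
     (\<exists>C::real. \<forall>u\<in>besov_space e \<nu> \<theta> p.
        besov_norm d \<mu> \<tau> p (F u) \<le> ennreal C * besov_norm e \<nu> \<theta> p u)"

end

theory Submission
  imports Defs "HOL-Probability.Probability"
begin

text \<open>
  A boundary point is a ray, and the argument is phrased in terms of cells: the cell of level \<open>n\<close>
  around a ray consists of the rays that agree with it at level \<open>n\<close>. Balls in the boundary are
  cells, and the normalized Hausdorff measure gives each cell of level \<open>n\<close> the mass \<open>K\<^sup>-\<^sup>n\<close>
  (\<open>normalized_hausdorff_eq\<close>). Hence the \<open>p\<close>-th power of the Besov seminorm is comparable to
  \<open>\<Sum>n. exp (\<epsilon> * \<theta> * p * n) * D\<^sub>n\<close>, where \<open>D\<^sub>n\<close> is the mean oscillation \<open>scale_energy\<close> over the cells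
  of level \<open>n\<close>.

  A quasisymmetric map may transport \<open>\<nu>_X\<close> to a measure that is singular with respect to \<open>\<nu>_Y\<close>,
  so that \<open>u \<circ> f\<close> depends on the representative of \<open>u\<close>. The induced map is therefore
  \<open>pullback u x\<close>, the limit for \<open>m \<rightarrow> \<infinity>\<close> of the averages of \<open>u\<close> over the cells of level \<open>m\<close> around
  \<open>f x\<close>. For continuous \<open>u\<close> this is \<open>u (f x)\<close>. By Jensen's inequality the jump of the averages from
  level \<open>m\<close> to level \<open>m + 1\<close> is controlled in \<open>L\<^sup>p(\<nu>_Y)\<close> by \<open>D\<^sub>m\<close> (\<open>average_step_le\<close>).

  The two trees are compared through \<open>entry m x\<close>, the first level \<open>n\<close> such that \<open>f\<close> maps the cell of
  level \<open>n\<close> around \<open>x\<close> into the cell of level \<open>m\<close> around \<open>f x\<close>. Quasisymmetry has three consequences: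
  along each ray the entry levels grow at least linearly in \<open>m\<close> (\<open>entry_gap\<close>); they lie between two
  linear functions of \<open>m\<close> whose slopes come from \<open>\<alpha>\<^sub>1\<close> and \<open>\<alpha>\<^sub>2\<close> (\<open>entry_upper\<close>, \<open>entry_lower\<close>); and
  the preimage of a cell is contained in a cell whose level is the entry level up to a bounded
  error (\<open>preimage_near\<close>), so that its measure is at most a constant times \<open>K_X\<close> to the power minus
  that level. The hypothesis on \<open>\<theta>_X\<close> and \<open>\<theta>_Y\<close> is what converts the weight
  \<open>exp (\<epsilon>_X * \<theta>_X * p * entry (m + 1) x)\<close>, integrated over the preimage of a cell of level \<open>m + 1\<close>,
  into \<open>exp (\<epsilon>_Y * \<theta>_Y * p * m)\<close> times the measure of that cell (\<open>entry_weight_bound\<close>).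

  On the source side, \<open>pullback u\<close> differs from a function that is constant on cells of level \<open>n\<close>
  only by the jumps with entry level above \<open>n\<close>. Since entry levels grow linearly, a weighted form
  of Jensen's inequality (\<open>powr_sum_le_weighted\<close>) followed by a summation of Hardy type
  (\<open>geometric_levels_le\<close>) bounds the energy of \<open>pullback u\<close> by the integral of the sum of the \<open>p\<close>-th
  powers of all jumps, weighted as above. Transporting the weights to the target, where jumps are
  constant on cells, bounds this by the energy of \<open>u\<close>. Finiteness of the same integral gives the
  convergence of the averages almost everywhere, hence linearity.
\<close>

section \<open>Rays in a regular tree\<close>

text \<open>
  An initial segment of a geodesic from the root. A function on all of \<open>nat\<close> is used in place of a
  list so that rays and their initial segments are treated alike; its values above level \<open>n\<close> are
  arbitrary.
\<close>

definition level_path :: "'v rooted_graph \<Rightarrow> (nat \<Rightarrow> 'v) \<Rightarrow> nat \<Rightarrow> bool" where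
  "level_path T a n \<longleftrightarrow> a 0 = root T \<and> (\<forall>i<n. adj T (a i) (a (Suc i))) \<and>
     (\<forall>i\<le>n. graph_dist T (root T) (a i) = i)"

lemma graph_dist_le_walk: "is_walk T x xs y \<Longrightarrow> length xs = Suc n \<Longrightarrow> graph_dist T x y \<le> n"
  unfolding graph_dist_def by (rule Least_le) blast

lemma graph_dist_refl: "x \<in> verts T \<Longrightarrow> graph_dist T x x = 0"
  using graph_dist_le_walk[of T x "[x]" x 0] by (simp add: is_walk_def)

lemma obtain_shortest_walk:
  assumes "rooted_tree T" "x \<in> verts T" "y \<in> verts T"
  obtains xs where "is_walk T x xs y" "length xs = Suc (graph_dist T x y)"
proof -
  obtain xs where xs: "is_walk T x xs y"
    using assms unfolding rooted_tree_def by blast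
  then have "length xs = Suc (length xs - 1)"
    unfolding is_walk_def by (cases xs) auto
  with xs have "\<exists>n xs. is_walk T x xs y \<and> length xs = Suc n" by blast
  then have "\<exists>xs. is_walk T x xs y \<and> length xs = Suc (graph_dist T x y)"
    unfolding graph_dist_def by (rule LeastI_ex)
  then show thesis using that by blast
qed

lemma graph_dist_adj_le:
  assumes T: "rooted_tree T" and x: "x \<in> verts T" and yz: "adj T y z"
  shows "graph_dist T x z \<le> Suc (graph_dist T x y)"
proof -
  have yzv: "y \<in> verts T" "z \<in> verts T" using T yz unfolding rooted_tree_def by blast+
  obtain xs where xs: "is_walk T x xs y" "length xs = Suc (graph_dist T x y)"
    using obtain_shortest_walk[OF T x yzv(1)] .
  have "is_walk T x (xs @ [z]) z"
    using xs(1) yz yzv unfolding is_walk_def by (auto simp: successively_append_iff)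
  then show ?thesis by (rule graph_dist_le_walk) (use xs in simp)
qed

lemma graph_dist_walk_le:
  assumes T: "rooted_tree T" and x: "x \<in> verts T"
  shows "successively (adj T) (y # ys) \<Longrightarrow>
     graph_dist T x (last (y # ys)) \<le> graph_dist T x y + length ys"
proof (induction ys arbitrary: y)
  case (Cons z zs)
  then have "adj T y z" "successively (adj T) (z # zs)" by auto
  then show ?case
    using Cons.IH[of z] graph_dist_adj_le[OF T x, of y z] by simp
qed simp

lemma obtain_level_path:
  assumes T: "rooted_tree T"
  shows "v \<in> verts T \<Longrightarrow> graph_dist T (root T) v = n \<Longrightarrow> \<exists>a. level_path T a n \<and> a n = v"
proof (induction n arbitrary: v)
  have r: "root T \<in> verts T" using T unfolding rooted_tree_def by blast
  case 0
  obtain xs where xs: "is_walk T (root T) xs v" "length xs = Suc (graph_dist T (root T) v)"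
    using obtain_shortest_walk[OF T r 0(1)] .
  then have "v = root T" using 0 unfolding is_walk_def by (cases xs) auto
  then show ?case using 0 by (intro exI[of _ "\<lambda>_. v"]) (auto simp: level_path_def)
next
  case (Suc n)
  have r: "root T \<in> verts T" using T unfolding rooted_tree_def by blast
  obtain xs where xs: "is_walk T (root T) xs v" "length xs = Suc (Suc n)"
    using obtain_shortest_walk[OF T r Suc.prems(1)] Suc.prems by metis
  define ys where "ys = butlast xs"
  have ne: "xs \<noteq> []" and lys: "length ys = Suc n" using xs by (auto simp: ys_def)
  have "xs = ys @ [v]" using xs ne unfolding ys_def is_walk_def by auto
  then have w: "is_walk T (root T) ys (last ys)" and a: "adj T (last ys) v"
    using xs(1) lys unfolding is_walk_def by (auto simp: successively_append_iff hd_append split: if_splits)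
  have lv: "last ys \<in> verts T" using a T unfolding rooted_tree_def by blast
  have "graph_dist T (root T) (last ys) \<le> n" using graph_dist_le_walk[OF w lys] .
  moreover have "Suc n \<le> Suc (graph_dist T (root T) (last ys))"
    using graph_dist_adj_le[OF T r a] Suc.prems by simp
  ultimately have d: "graph_dist T (root T) (last ys) = n" by simp
  obtain b where b: "level_path T b n" "b n = last ys" using Suc.IH[OF lv d] by blast
  then have "level_path T (b(Suc n := v)) (Suc n)"
    using a Suc.prems unfolding level_path_def by (auto simp: less_Suc_eq le_Suc_eq)
  then show ?case by (metis fun_upd_same)
qed

lemma successively_map_upt:
  "(\<And>i. m \<le> i \<Longrightarrow> Suc i < n \<Longrightarrow> P (f i) (f (Suc i))) \<Longrightarrow> successively P (map f [m..<n])"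
proof (induction n)
  case (Suc n)
  show ?case
  proof (cases "m < n")
    case True
    then obtain k where k: "n = Suc k" "m \<le> k" by (cases n) auto
    then show ?thesis using Suc by (auto simp: successively_append_iff)
  next
    case False
    then show ?thesis by (cases "m = n") auto
  qed
qed simp

text \<open>
  Two level paths that have separated cannot be joined again from above: the two branches and
  the joining vertices would close up to a cycle.
\<close>

lemma level_paths_not_joined:
  assumes T: "rooted_tree T" and a: "level_path T a n" and b: "level_path T b n"
    and ne: "a n \<noteq> b n" and ms: "distinct ms" "\<And>x. x \<in> set ms \<Longrightarrow> graph_dist T (root T) x > n"
    and succ: "successively (adj T) (a n # ms @ [b n])"
  shows False
proof -
  have sym: "adj T x y \<Longrightarrow> adj T y x" for x y using T unfolding rooted_tree_def by blast
  \<comment> \<open>the level at which the two paths separate\<close>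
  define j where "j = Max {i. i \<le> n \<and> a i = b i}"
  have fin: "finite {i. i \<le> n \<and> a i = b i}" by simp
  have "0 \<in> {i. i \<le> n \<and> a i = b i}" using a b unfolding level_path_def by simp
  then have j: "j \<le> n" "a j = b j" using Max_in[OF fin] unfolding j_def by blast+
  then have jn: "j < n" using ne by (metis le_neq_implies_less)
  have sep: "a i \<noteq> b i" if "j < i" "i \<le> n" for i
    using Max_ge[OF fin, of i] that unfolding j_def by fastforce
  have da: "graph_dist T (root T) (a i) = i" and db: "graph_dist T (root T) (b i) = i" if "i \<le> n" for i
    using a b that unfolding level_path_def by auto
  have cross: "a i \<noteq> b k" if "j < k" "i \<le> n" "k \<le> n" for i k
    using sep that da[of i] db[of k] by metis
  let ?A = "map a [j..<Suc n]" and ?B = "map b [Suc j..<Suc n]"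
  let ?xs = "?A @ ms @ rev ?B"
  have "inj_on a {j..<Suc n}" by (rule inj_on_inverseI[where g = "graph_dist T (root T)"]) (simp add: da)
  moreover have "inj_on b {Suc j..<Suc n}"
    by (rule inj_on_inverseI[where g = "graph_dist T (root T)"]) (simp add: db)
  moreover have "set ?A \<inter> set ?B = {}" using cross by auto
  moreover have "set ms \<inter> set ?A = {}" "set ms \<inter> set ?B = {}"
    using ms(2) da db by fastforce+
  ultimately have dist: "distinct ?xs"
    using ms(1) by (auto simp: distinct_map simp del: upt_Suc)
  have hdA: "hd ?A = a j" "?A \<noteq> []" "last ?A = a n" using jn by (auto simp: hd_map last_map)
  have hdB: "hd (rev ?B) = b n" "?B \<noteq> []" "last (rev ?B) = b (Suc j)"
    using jn by (auto simp: hd_rev last_rev hd_map last_map simp del: upt_Suc) 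
  have sA: "successively (adj T) ?A"
    by (rule successively_map_upt) (use a in \<open>auto simp: level_path_def\<close>)
  have "successively (adj T) ?B"
    by (rule successively_map_upt) (use b in \<open>auto simp: level_path_def\<close>)
  then have sB: "successively (adj T) (rev ?B)"
    unfolding successively_rev by (rule successively_mono) (use sym in auto)
  have "successively (adj T) ?xs"
  proof (cases ms)
    case Nil
    then show ?thesis using sA sB hdA hdB succ
      by (simp add: successively_append_iff del: upt_Suc)
  next
    case (Cons m ms')
    then show ?thesis using sA sB hdA hdB succ
      by (auto simp: successively_append_iff successively_Cons hd_append simp del: upt_Suc)
  qed
  moreover have "3 \<le> length ?xs" using jn by simp
  moreover have "adj T (last ?xs) (hd ?xs)"
  proof -
    have "adj T (b j) (b (Suc j))" using b jn unfolding level_path_def by auto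
    moreover have "last ?xs = b (Suc j)" "hd ?xs = b j" using hdA hdB j by (auto simp del: upt_Suc)
    ultimately show ?thesis using sym by simp
  qed
  ultimately have "is_cycle T ?xs" using dist unfolding is_cycle_def by blast
  then show False using T unfolding rooted_tree_def by blast
qed

text \<open>
  Two different parents would be joined through their common child.
\<close>

lemma level_path_parent_unique:
  assumes T: "rooted_tree T" and a: "level_path T a (Suc n)" and b: "level_path T b (Suc n)"
    and eq: "a (Suc n) = b (Suc n)"
  shows "a n = b n"
proof (rule ccontr)
  assume "a n \<noteq> b n"
  moreover have "level_path T a n" "level_path T b n" using a b unfolding level_path_def by auto
  moreover have "adj T (a n) (a (Suc n))" "adj T (b (Suc n)) (b n)"
    using a b T unfolding level_path_def rooted_tree_def by blast+
  moreover have "graph_dist T (root T) (a (Suc n)) > n" using a unfolding level_path_def by auto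
  ultimately show False
    using level_paths_not_joined[OF T, of a n b "[a (Suc n)]"] eq by auto
qed

text \<open>
  A child could a priori lie on the same level as its parent, since it is only required not to
  be closer to the root; but then an edge would join two separated level paths.
\<close>

lemma level_path_extend:
  assumes T: "rooted_tree T" and a: "level_path T a n" and w: "w \<in> children T (a n)"
  shows "level_path T (a(Suc n := w)) (Suc n)"
proof -
  have r: "root T \<in> verts T" using T unfolding rooted_tree_def by blast
  have adj: "adj T (a n) w" and ge: "n \<le> graph_dist T (root T) w"
    using w a unfolding children_def level_path_def by auto
  then have wv: "w \<in> verts T" and "a n \<noteq> w" using T unfolding rooted_tree_def by blast+
  have "graph_dist T (root T) w \<le> Suc n"
    using graph_dist_adj_le[OF T r adj] a unfolding level_path_def by simp
  moreover have "graph_dist T (root T) w \<noteq> n"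
  proof
    assume "graph_dist T (root T) w = n"
    then obtain b where b: "level_path T b n" "b n = w" using obtain_level_path[OF T wv] by blast
    then show False using level_paths_not_joined[OF T a b(1), of "[]"] adj \<open>a n \<noteq> w\<close> by auto
  qed
  ultimately have "graph_dist T (root T) w = Suc n" using ge by simp
  then show ?thesis using a adj unfolding level_path_def by (auto simp: less_Suc_eq le_Suc_eq)
qed

lemma boundary_iff_level_paths:
  assumes T: "rooted_tree T"
  shows "\<zeta> \<in> boundary T \<longleftrightarrow> (\<forall>n. level_path T \<zeta> n)"
proof
  assume "\<zeta> \<in> boundary T"
  then have "\<zeta> 0 = root T" "\<And>n. adj T (\<zeta> n) (\<zeta> (Suc n))" "\<And>n. graph_dist T (\<zeta> 0) (\<zeta> n) = n - 0"
    unfolding boundary_def by blast+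
  then show "\<forall>n. level_path T \<zeta> n" unfolding level_path_def by auto
next
  have r: "root T \<in> verts T" using T unfolding rooted_tree_def by blast
  assume *: "\<forall>n. level_path T \<zeta> n"
  have z0: "\<zeta> 0 = root T" using * unfolding level_path_def by blast
  have adj: "adj T (\<zeta> n) (\<zeta> (Suc n))" for n using * unfolding level_path_def by blast
  have d: "graph_dist T (root T) (\<zeta> n) = n" for n using * unfolding level_path_def by blast
  have v: "\<zeta> n \<in> verts T" for n using adj[of n] T unfolding rooted_tree_def by blast
  have "graph_dist T (\<zeta> m) (\<zeta> n) = n - m" if "m \<le> n" for m n
  proof (rule antisym)
    have "is_walk T (\<zeta> m) (map \<zeta> [m..<Suc n]) (\<zeta> n)"
      unfolding is_walk_def using that v
      by (auto simp: hd_map last_map adj intro!: successively_map_upt simp del: upt_Suc)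
    then show "graph_dist T (\<zeta> m) (\<zeta> n) \<le> n - m"
      by (rule graph_dist_le_walk) (use that in simp)
    obtain xs where xs: "is_walk T (\<zeta> m) xs (\<zeta> n)" "length xs = Suc (graph_dist T (\<zeta> m) (\<zeta> n))"
      using obtain_shortest_walk[OF T v v] .
    then obtain ys where ys: "xs = \<zeta> m # ys" unfolding is_walk_def by (cases xs) auto
    then show "n - m \<le> graph_dist T (\<zeta> m) (\<zeta> n)"
      using graph_dist_walk_le[OF T r, of "\<zeta> m" ys] xs d unfolding is_walk_def by auto
  qed
  then show "\<zeta> \<in> boundary T" unfolding boundary_def using z0 adj v by auto
qed

text \<open>
  Every vertex has a child, so a path can be prolonged by choosing children forever. This is what
  makes each vertex visible from the boundary.
\<close>

lemma level_path_extends_to_ray: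
  assumes T: "rooted_tree T" and ch: "\<And>v. v \<in> verts T \<Longrightarrow> children T v \<noteq> {}"
    and a: "level_path T a n"
  shows "\<exists>\<zeta>\<in>boundary T. \<forall>i\<le>n. \<zeta> i = a i"
proof -
  define c where "c v = (SOME w. w \<in> children T v)" for v
  have c: "c v \<in> children T v" if "v \<in> verts T" for v
    using ch[OF that] unfolding c_def by (auto intro: someI)
  define \<zeta> where "\<zeta> i = (if i \<le> n then a i else (c ^^ (i - n)) (a n))" for i
  have below: "level_path T \<zeta> k" if "k \<le> n" for k
    using a that unfolding level_path_def \<zeta>_def by auto
  have step: "\<zeta> (Suc k) = c (\<zeta> k)" if "n \<le> k" for k
    using that unfolding \<zeta>_def by (auto simp: Suc_diff_le)
  have above: "level_path T \<zeta> (n + k)" for k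
  proof (induction k)
    case (Suc k)
    have "\<zeta> (n + k) \<in> verts T"
    proof (cases "n + k")
      case 0
      then show ?thesis using Suc T unfolding level_path_def rooted_tree_def by auto
    next
      case (Suc l)
      then have "adj T (\<zeta> l) (\<zeta> (n + k))" using \<open>level_path T \<zeta> (n + k)\<close> unfolding level_path_def by auto
      then show ?thesis using T unfolding rooted_tree_def by blast
    qed
    then have "level_path T (\<zeta>(Suc (n + k) := c (\<zeta> (n + k)))) (Suc (n + k))"
      using level_path_extend[OF T Suc c] by blast
    moreover have "\<zeta>(Suc (n + k) := c (\<zeta> (n + k))) = \<zeta>" using step[of "n + k"] by auto
    ultimately show ?case by simp
  qed (use below in auto)
  have "level_path T \<zeta> k" for k
    using below[of k] above[of "k - n"] by (cases "k \<le> n") auto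
  then have "\<zeta> \<in> boundary T" using boundary_iff_level_paths[OF T] by blast
  moreover have "\<forall>i\<le>n. \<zeta> i = a i" unfolding \<zeta>_def by simp
  ultimately show ?thesis by blast
qed

definition cell :: "(nat \<Rightarrow> 'v) set \<Rightarrow> nat \<Rightarrow> (nat \<Rightarrow> 'v) \<Rightarrow> (nat \<Rightarrow> 'v) set" where
  "cell M n x = {y \<in> M. y n = x n}"

text \<open>
  From here on the graph is forgotten and only the branching of its rays is used. The last axiom
  is the completeness of the boundary; it is what turns sequences of digits into rays below.
\<close>

locale regular_rays =
  fixes M :: "(nat \<Rightarrow> 'v) set" and K :: nat
  assumes two_le_K: "2 \<le> K"
    and nonempty: "M \<noteq> {}"
    and same_start: "x \<in> M \<Longrightarrow> y \<in> M \<Longrightarrow> x 0 = y 0"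
    and same_parent: "x \<in> M \<Longrightarrow> y \<in> M \<Longrightarrow> x (Suc n) = y (Suc n) \<Longrightarrow> x n = y n"
    and branching: "x \<in> M \<Longrightarrow> card ((\<lambda>y. y (Suc n)) ` cell M n x) = K"
    and complete: "(\<And>n. \<exists>x\<in>M. \<forall>k\<le>n. x k = z k) \<Longrightarrow> z \<in> M"

lemma regular_rays_boundary:
  assumes K: "2 \<le> K" and T: "regular_tree K T"
  shows "regular_rays (boundary T) K"
proof
  have tree: "rooted_tree T" and fin: "\<And>v. v \<in> verts T \<Longrightarrow> finite (children T v)"
    and card: "\<And>v. v \<in> verts T \<Longrightarrow> card (children T v) = K"
    using T unfolding regular_tree_def by auto
  note bd = boundary_iff_level_paths[OF tree]
  have ch: "children T v \<noteq> {}" if "v \<in> verts T" for v using card[OF that] K by auto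
  note ext = level_path_extends_to_ray[OF tree ch]
  show "2 \<le> K" by fact
  have r: "root T \<in> verts T" using tree unfolding rooted_tree_def by blast
  have "level_path T (\<lambda>_. root T) 0" using graph_dist_refl[OF r] by (simp add: level_path_def)
  from ext[OF _ this] show "boundary T \<noteq> {}" by blast
  show "x 0 = y 0" if "x \<in> boundary T" "y \<in> boundary T" for x y
    using that unfolding boundary_def by auto
  show "x n = y n" if "x \<in> boundary T" "y \<in> boundary T" "x (Suc n) = y (Suc n)" for x y n
    using level_path_parent_unique[OF tree] that bd by blast
  show "card ((\<lambda>y. y (Suc n)) ` cell (boundary T) n x) = K" if x: "x \<in> boundary T" for x n
  proof -
    have "(\<lambda>y. y (Suc n)) ` cell (boundary T) n x = children T (x n)"
    proof (intro equalityI subsetI)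
      fix w assume "w \<in> (\<lambda>y. y (Suc n)) ` cell (boundary T) n x"
      then obtain y where y: "y \<in> boundary T" "y n = x n" "w = y (Suc n)" by (auto simp: cell_def)
      then have "level_path T y (Suc n)" using bd by blast
      then show "w \<in> children T (x n)" using y(2,3) unfolding children_def level_path_def
        by (auto simp flip: y(2))
    next
      fix w assume w: "w \<in> children T (x n)"
      have "level_path T (x(Suc n := w)) (Suc n)" using level_path_extend[OF tree, of x n w] w x bd by blast
      from ext[OF _ this] obtain y where "y \<in> boundary T" "\<forall>i\<le>Suc n. y i = (x(Suc n := w)) i" by blast
      then have "y \<in> cell (boundary T) n x" "w = y (Suc n)" by (auto simp: cell_def)
      then show "w \<in> (\<lambda>y. y (Suc n)) ` cell (boundary T) n x" by blast
    qed
    moreover have "x n \<in> verts T" using x unfolding boundary_def by blast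
    ultimately show ?thesis using card by simp
  qed
  show "z \<in> boundary T" if *: "\<And>n. \<exists>x\<in>boundary T. \<forall>k\<le>n. x k = z k" for z
  proof -
    have "level_path T z n" for n
    proof -
      obtain x where x: "x \<in> boundary T" "\<forall>k\<le>n. x k = z k" using * by blast
      then have "level_path T x n" using bd by blast
      then show ?thesis using x(2) unfolding level_path_def by (auto simp: Suc_le_eq)
    qed
    then show ?thesis using bd by blast
  qed
qed

section \<open>The uniform measure on the rays\<close>

context regular_rays
begin

lemma prefix_eq: "x \<in> M \<Longrightarrow> y \<in> M \<Longrightarrow> x n = y n \<Longrightarrow> k \<le> n \<Longrightarrow> x k = y k"
proof (induction n)
  case (Suc n)
  then show ?case using same_parent[of x y n] by (cases "k = Suc n") auto
qed simp

lemma mem_cell_self: "x \<in> M \<Longrightarrow> x \<in> cell M n x"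
  by (simp add: cell_def)

lemma cell_subset: "cell M n x \<subseteq> M"
  by (auto simp: cell_def)

lemma cell_zero: "x \<in> M \<Longrightarrow> cell M 0 x = M"
  using same_start by (auto simp: cell_def)

lemma cell_eq: "y \<in> cell M n x \<Longrightarrow> cell M n y = cell M n x"
  by (auto simp: cell_def)

lemma cell_antimono: "x \<in> M \<Longrightarrow> m \<le> n \<Longrightarrow> cell M n x \<subseteq> cell M m x"
  using prefix_eq by (fastforce simp: cell_def)

lemma cell_sym: "x \<in> M \<Longrightarrow> y \<in> cell M n x \<Longrightarrow> x \<in> cell M n y"
  by (auto simp: cell_def)

lemma cells_nested_or_disjoint:
  assumes "x \<in> M" "y \<in> M" "m \<le> n" "cell M n x \<inter> cell M m y \<noteq> {}"
  shows "cell M n x \<subseteq> cell M m y"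
proof -
  obtain z where z: "z \<in> cell M n x" "z \<in> cell M m y" using assms(4) by blast
  then have "z \<in> M" by (auto simp: cell_def)
  have "cell M n x = cell M n z" using cell_eq[OF z(1)] by simp
  also have "\<dots> \<subseteq> cell M m z" using cell_antimono[OF \<open>z \<in> M\<close> assms(3)] .
  also have "\<dots> = cell M m y" using cell_eq[OF z(2)] .
  finally show ?thesis .
qed

lemma obtain_sibling:
  assumes x: "x \<in> M"
  obtains y where "y \<in> cell M n x" "y (Suc n) \<noteq> x (Suc n)"
proof -
  have "\<not> (\<lambda>y. y (Suc n)) ` cell M n x \<subseteq> {x (Suc n)}"
  proof
    assume "(\<lambda>y. y (Suc n)) ` cell M n x \<subseteq> {x (Suc n)}"
    then have "card ((\<lambda>y. y (Suc n)) ` cell M n x) \<le> card {x (Suc n)}" by (intro card_mono) auto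
    then show False using branching[OF x, of n] two_le_K by simp
  qed
  then show thesis using that by auto
qed

lemma finite_levels: "finite ((\<lambda>x. x n) ` M)"
proof (induction n)
  case 0
  obtain x where "x \<in> M" using nonempty by blast
  then have "(\<lambda>x. x 0) ` M \<subseteq> {x 0}" using same_start by blast
  then show ?case using finite_subset by blast
next
  case (Suc n)
  define B where "B v = (\<lambda>y. y (Suc n)) ` {y \<in> M. y n = v}" for v
  have "finite (B v)" if "v \<in> (\<lambda>x. x n) ` M" for v
  proof -
    obtain x where x: "x \<in> M" "v = x n" using \<open>v \<in> (\<lambda>x. x n) ` M\<close> by blast
    then have "card (B v) = K" using branching[OF x(1), of n] by (simp add: B_def cell_def)
    then show ?thesis by (intro card_ge_0_finite) (use two_le_K in simp)
  qed
  moreover have "(\<lambda>x. x (Suc n)) ` M \<subseteq> (\<Union>v\<in>(\<lambda>x. x n) ` M. B v)" by (auto simp: B_def)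
  ultimately show ?case using Suc finite_subset by blast
qed

lemma finite_cells: "finite (cell M n ` M)"
proof -
  have "cell M n ` M = (\<lambda>v. {y \<in> M. y n = v}) ` (\<lambda>x. x n) ` M" by (auto simp: cell_def)
  then show ?thesis using finite_levels by simp
qed

definition cells :: "(nat \<Rightarrow> 'v) set set" where
  "cells = (\<Union>n. cell M n ` M)"

lemma countable_cells: "countable cells"
  unfolding cells_def by (intro countable_UN countable_finite finite_cells countableI_type)

lemma cells_subset_Pow: "cells \<subseteq> Pow M"
  using cell_subset by (auto simp: cells_def)

lemma cell_in_cells: "x \<in> M \<Longrightarrow> cell M n x \<in> cells"
  by (auto simp: cells_def)

text \<open>
  The sets that depend only on the first \<open>n\<close> levels of a ray. For varying \<open>n\<close> they are the sets that
  are both open and closed, and they form an algebra that generates the Borel sets.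
\<close>

definition saturated :: "nat \<Rightarrow> (nat \<Rightarrow> 'v) set \<Rightarrow> bool" where
  "saturated n A \<longleftrightarrow> A \<subseteq> M \<and> (\<forall>x\<in>A. cell M n x \<subseteq> A)"

lemma saturated_mono: "saturated m A \<Longrightarrow> m \<le> n \<Longrightarrow> saturated n A"
  unfolding saturated_def using cell_antimono by (meson subset_iff)

lemma saturated_cell: "x \<in> M \<Longrightarrow> saturated n (cell M n x)"
  by (auto simp: saturated_def cell_def)

lemma saturated_eq_Union: "saturated n A \<Longrightarrow> A = \<Union>(cell M n ` A)"
  unfolding saturated_def using mem_cell_self by blast

lemma algebra_saturated: "algebra M {A. \<exists>n. saturated n A}"
  unfolding algebra_iff_Un
proof (intro conjI ballI)
  show "{A. \<exists>n. saturated n A} \<subseteq> Pow M" by (auto simp: saturated_def)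
  show "{} \<in> {A. \<exists>n. saturated n A}" by (auto simp: saturated_def)
  show "M - A \<in> {A. \<exists>n. saturated n A}" if "A \<in> {A. \<exists>n. saturated n A}" for A
  proof -
    obtain n where n: "saturated n A" using \<open>A \<in> {A. \<exists>n. saturated n A}\<close> by auto
    have "saturated n (M - A)"
      unfolding saturated_def
    proof (intro conjI ballI subsetI)
      fix x y assume x: "x \<in> M - A" and y: "y \<in> cell M n x"
      then have "y \<in> M" "x \<in> cell M n y" by (auto simp: cell_def)
      then show "y \<in> M - A" using n x unfolding saturated_def by auto
    qed simp
    then show ?thesis by auto
  qed
  show "A \<union> B \<in> {A. \<exists>n. saturated n A}"
    if A: "A \<in> {A. \<exists>n. saturated n A}" and B: "B \<in> {A. \<exists>n. saturated n A}" for A B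
  proof -
    obtain m where m: "saturated m A" using A by auto
    obtain n where n: "saturated n B" using B by auto
    have "saturated (max m n) A" "saturated (max m n) B"
      using saturated_mono[OF m, of "max m n"] saturated_mono[OF n, of "max m n"] by simp_all
    then have "saturated (max m n) (A \<union> B)" unfolding saturated_def by auto
    then show ?thesis by auto
  qed
qed

lemma saturated_in_sigma:
  assumes "saturated n A"
  shows "A \<in> sigma_sets M cells"
proof -
  have sub: "A \<subseteq> M" using assms by (simp add: saturated_def)
  interpret S: sigma_algebra M "sigma_sets M cells"
    by (rule sigma_algebra_sigma_sets[OF cells_subset_Pow])
  have "finite (cell M n ` A)" by (rule finite_subset[OF _ finite_cells[of n]]) (use sub in auto)
  then have "\<Union>(cell M n ` A) \<in> sigma_sets M cells"
  proof (rule S.finite_Union)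
    show "cell M n ` A \<subseteq> sigma_sets M cells"
    proof (rule image_subsetI)
      fix x assume "x \<in> A"
      then show "cell M n x \<in> sigma_sets M cells"
        using sub by (intro sigma_sets.Basic cell_in_cells) auto
    qed
  qed
  then show ?thesis using saturated_eq_Union[OF assms] by simp
qed

lemma sigma_saturated: "sigma_sets M {A. \<exists>n. saturated n A} = sigma_sets M cells"
proof (rule antisym)
  show "sigma_sets M {A. \<exists>n. saturated n A} \<subseteq> sigma_sets M cells"
    by (rule sigma_sets_mono) (use saturated_in_sigma in blast)
  show "sigma_sets M cells \<subseteq> sigma_sets M {A. \<exists>n. saturated n A}"
    by (rule sigma_sets_subseteq) (use saturated_cell in \<open>auto simp: cells_def\<close>)
qed


subsection \<open>Digits\<close>

text \<open>
  Numbering the vertices that follow a given one turns sequences of digits below \<open>K\<close> into rays, and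
  the uniform measure on the rays is the image of the product of uniform measures on the digits.
\<close>

definition digit_vertex :: "nat \<Rightarrow> 'v \<Rightarrow> nat \<Rightarrow> 'v" where
  "digit_vertex n v = (SOME g. bij_betw g {..<K} ((\<lambda>y. y (Suc n)) ` {y \<in> M. y n = v}))"

lemma digit_vertex:
  assumes "x \<in> M"
  shows "bij_betw (digit_vertex n (x n)) {..<K} ((\<lambda>y. y (Suc n)) ` cell M n x)"
proof -
  have fin: "finite ((\<lambda>y. y (Suc n)) ` cell M n x)"
    by (rule card_ge_0_finite) (use branching[OF assms, of n] two_le_K in simp)
  have "\<exists>g. bij_betw g {..<K} ((\<lambda>y. y (Suc n)) ` cell M n x)"
    using ex_bij_betw_nat_finite[OF fin] branching[OF assms, of n] by (simp add: atLeast0LessThan)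
  then show ?thesis unfolding digit_vertex_def cell_def by (rule someI_ex)
qed

primrec digit_ray :: "(nat \<Rightarrow> nat) \<Rightarrow> nat \<Rightarrow> 'v" where
  "digit_ray \<omega> 0 = (SOME v. \<exists>x\<in>M. v = x 0)"
| "digit_ray \<omega> (Suc n) = digit_vertex n (digit_ray \<omega> n) (\<omega> n)"

lemma digit_ray_prefix:
  assumes "\<And>i. \<omega> i < K"
  shows "\<exists>x\<in>M. \<forall>k\<le>n. x k = digit_ray \<omega> k"
proof (induction n)
  case 0
  have "\<exists>v. \<exists>x\<in>M. v = x 0" using nonempty by blast
  then have "\<exists>x\<in>M. digit_ray \<omega> 0 = x 0" unfolding digit_ray.simps by (rule someI_ex)
  then show ?case by auto
next
  case (Suc n)
  then obtain x where x: "x \<in> M" "\<forall>k\<le>n. x k = digit_ray \<omega> k" by blast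
  have "digit_ray \<omega> (Suc n) \<in> (\<lambda>y. y (Suc n)) ` cell M n x"
    using bij_betw_apply[OF digit_vertex[OF x(1), of n], of "\<omega> n"] assms x(2) by simp
  then obtain y where y: "y \<in> M" "y n = x n" "digit_ray \<omega> (Suc n) = y (Suc n)"
    by (auto simp: cell_def)
  have "y k = digit_ray \<omega> k" if "k \<le> Suc n" for k
    using that y(3) prefix_eq[OF y(1) x(1) y(2), of k] x(2) by (cases "k = Suc n") auto
  then show ?case using y(1) by blast
qed

lemma digit_ray_in: "(\<And>i. \<omega> i < K) \<Longrightarrow> digit_ray \<omega> \<in> M"
  by (rule complete) (rule digit_ray_prefix)

text \<open>
  Passing through the vertex of \<open>x\<close> at level \<open>n\<close> is a condition on the first \<open>n\<close> digits alone, so the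
  preimage of a cell is a cylinder set.
\<close>

lemma ex_digits:
  assumes x: "x \<in> M"
  shows "\<exists>d. (\<forall>i. d i < K) \<and>
    (\<forall>n \<omega>. (\<forall>i. \<omega> i < K) \<longrightarrow> (digit_ray \<omega> n = x n \<longleftrightarrow> (\<forall>i<n. \<omega> i = d i)))"
proof -
  have "\<exists>j<K. digit_vertex i (x i) j = x (Suc i)" for i
  proof -
    have "x (Suc i) \<in> (\<lambda>y. y (Suc i)) ` cell M i x" using mem_cell_self[OF x] by blast
    then have "x (Suc i) \<in> digit_vertex i (x i) ` {..<K}"
      using digit_vertex[OF x, of i] unfolding bij_betw_def by simp
    then show ?thesis by auto
  qed
  then obtain d where d: "\<And>i. d i < K" "\<And>i. digit_vertex i (x i) (d i) = x (Suc i)" by metis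
  have "digit_ray \<omega> n = x n \<longleftrightarrow> (\<forall>i<n. \<omega> i = d i)" if \<omega>: "\<forall>i. \<omega> i < K" for n \<omega>
  proof (induction n)
    case 0
    have "digit_ray \<omega> \<in> M" by (rule digit_ray_in) (use \<omega> in auto)
    then show ?case using same_start[OF _ x] by auto
  next
    case (Suc n)
    have "digit_ray \<omega> \<in> M" by (rule digit_ray_in) (use \<omega> in auto)
    then have parent: "digit_ray \<omega> (Suc n) = x (Suc n) \<Longrightarrow> digit_ray \<omega> n = x n"
      by (rule same_parent[OF _ x])
    have "inj_on (digit_vertex n (x n)) {..<K}" using digit_vertex[OF x] unfolding bij_betw_def by blast
    then have "digit_vertex n (x n) (\<omega> n) = x (Suc n) \<longleftrightarrow> \<omega> n = d n"
      using d \<omega> unfolding inj_on_def by (metis lessThan_iff)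
    then show ?case using parent Suc by (auto simp: less_Suc_eq)
  qed
  then show ?thesis using d(1) by blast
qed

lemma ex_uniform_measure:
  "\<exists>\<mu>. space \<mu> = M \<and> sets \<mu> = sigma_sets M cells \<and>
     (\<forall>n. \<forall>x\<in>M. emeasure \<mu> (cell M n x) = ennreal ((1 / real K) ^ n))"
proof -
  define D where "D = (\<lambda>_::nat. uniform_count_measure {..<K})"
  have pD: "prob_space (D i)" for i
    unfolding D_def using two_le_K by (intro prob_space_uniform_count_measure) (auto simp: lessThan_empty_iff)
  interpret product_prob_space D UNIV
    unfolding product_prob_space_def product_prob_space_axioms_def product_sigma_finite_def
    using pD prob_space_imp_sigma_finite by blast
  let ?P = "PiM UNIV D"
  have setsD: "sets (D i) = Pow {..<K}" "space (D i) = {..<K}" for i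
    by (auto simp: D_def sets_uniform_count_measure space_uniform_count_measure)
  have space: "\<omega> \<in> space ?P \<longleftrightarrow> (\<forall>i. \<omega> i < K)" for \<omega>
    by (auto simp: space_PiM setsD PiE_iff)
  have pre: "\<exists>d. (\<forall>i. d i < K) \<and>
      digit_ray -` cell M n x \<inter> space ?P = {\<omega> \<in> space ?P. \<forall>i\<in>{..<n}. \<omega> i \<in> {d i}}"
    if x: "x \<in> M" for n x
  proof -
    obtain d where d: "\<forall>i. d i < K"
      "\<forall>n \<omega>. (\<forall>i. \<omega> i < K) \<longrightarrow> (digit_ray \<omega> n = x n \<longleftrightarrow> (\<forall>i<n. \<omega> i = d i))"
      using ex_digits[OF x] by blast
    have "digit_ray -` cell M n x \<inter> space ?P = {\<omega> \<in> space ?P. \<forall>i\<in>{..<n}. \<omega> i \<in> {d i}}"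
      using d digit_ray_in by (auto simp: cell_def space)
    then show ?thesis using d by blast
  qed
  have meas: "digit_ray \<in> measurable ?P (sigma M cells)"
  proof (rule measurable_sigma_sets)
    show "sets (sigma M cells) = sigma_sets M cells" by (simp add: cells_subset_Pow)
    show "cells \<subseteq> Pow M" by (rule cells_subset_Pow)
    show "digit_ray \<in> space ?P \<rightarrow> M" using digit_ray_in space by auto
    fix C assume "C \<in> cells"
    then obtain n x where x: "x \<in> M" "C = cell M n x" by (auto simp: cells_def)
    obtain d where d: "\<forall>i. d i < K"
      "digit_ray -` C \<inter> space ?P = {\<omega> \<in> space ?P. \<forall>i\<in>{..<n}. \<omega> i \<in> {d i}}"
      using pre[OF x(1), of n] x(2) by auto
    show "digit_ray -` C \<inter> space ?P \<in> sets ?P"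
      unfolding d(2)
    proof (rule sets.sets_Collect_finite_All)
      show "{\<omega> \<in> space ?P. \<omega> i \<in> {d i}} \<in> sets ?P" if "i \<in> {..<n}" for i
        by (rule measurable_sets_Collect[OF measurable_component_singleton])
          (use d in \<open>auto simp: setsD\<close>)
    qed auto
  qed
  let ?\<mu> = "distr ?P (sigma M cells) digit_ray"
  have "emeasure ?\<mu> (cell M n x) = ennreal ((1 / real K) ^ n)" if x: "x \<in> M" for n x
  proof -
    obtain d where d: "\<forall>i. d i < K"
      "digit_ray -` cell M n x \<inter> space ?P = {\<omega> \<in> space ?P. \<forall>i\<in>{..<n}. \<omega> i \<in> {d i}}"
      using pre[OF x, of n] by auto
    have "emeasure ?\<mu> (cell M n x) = emeasure ?P (digit_ray -` cell M n x \<inter> space ?P)"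
      by (rule emeasure_distr[OF meas]) (use x in \<open>simp add: cells_subset_Pow cell_in_cells\<close>)
    also have "\<dots> = (\<Prod>i\<in>{..<n}. emeasure (D i) {d i})"
      unfolding d(2) by (rule emeasure_PiM_Collect) (use d in \<open>auto simp: setsD\<close>)
    also have "\<dots> = (\<Prod>i\<in>{..<n}. ennreal (1 / real K))"
      using d(1) by (intro prod.cong refl) (auto simp: D_def emeasure_uniform_count_measure)
    also have "\<dots> = ennreal ((1 / real K) ^ n)"
      by (simp add: ennreal_power)
    finally show ?thesis .
  qed
  moreover have "space ?\<mu> = M" "sets ?\<mu> = sigma_sets M cells" by (simp_all add: cells_subset_Pow)
  ultimately show ?thesis by blast
qed

end


section \<open>The Hausdorff measure\<close>

lemma enn_powr_mono:
  assumes "0 \<le> a" "x \<le> y"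
  shows "enn_powr x a \<le> enn_powr y a"
proof (cases "y = \<infinity>")
  case False
  then have "x \<noteq> \<infinity>" using assms(2) by (auto simp: top_unique)
  with False show ?thesis unfolding enn_powr_def using assms
    by (auto intro!: ennreal_leI powr_mono2 enn2real_mono simp: top.not_eq_extremum)
qed (simp add: enn_powr_def)

lemma enn_powr_ennreal: "0 \<le> r \<Longrightarrow> enn_powr (ennreal r) a = ennreal (r powr a)"
  by (simp add: enn_powr_def)

locale ray_metric = regular_rays M K for M :: "(nat \<Rightarrow> 'v) set" and K +
  fixes \<epsilon> :: real
  assumes \<epsilon>_pos: "0 < \<epsilon>"
begin

abbreviation d :: "(nat \<Rightarrow> 'v) \<Rightarrow> (nat \<Rightarrow> 'v) \<Rightarrow> real" where
  "d \<equiv> boundary_dist \<epsilon>"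

definition radius :: "nat \<Rightarrow> real" where
  "radius n = 2 / \<epsilon> * exp (- \<epsilon> * real n)"

abbreviation dimension :: real where
  "dimension \<equiv> ln (real K) / \<epsilon>"

definition \<nu> :: "(nat \<Rightarrow> 'v) measure" where
  "\<nu> = normalized_hausdorff_measure M d dimension"

lemma radius_pos: "0 < radius n"
  using \<epsilon>_pos by (simp add: radius_def)

lemma radius_le_iff: "radius m \<le> radius n \<longleftrightarrow> n \<le> m"
  using \<epsilon>_pos by (simp add: radius_def field_simps)

lemma radius_tendsto: "radius \<longlonglongrightarrow> 0"
proof -
  have "(\<lambda>n. 2 / \<epsilon> * exp (- \<epsilon>) ^ n) \<longlonglongrightarrow> 2 / \<epsilon> * 0"
    by (intro tendsto_intros LIMSEQ_power_zero) (use \<epsilon>_pos in simp)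
  moreover have "radius = (\<lambda>n. 2 / \<epsilon> * exp (- \<epsilon>) ^ n)"
    by (simp add: fun_eq_iff radius_def exp_of_nat_mult[symmetric] mult.commute)
  ultimately show ?thesis by simp
qed

lemma obtain_radius_less: "0 < r \<Longrightarrow> \<exists>n. radius n < r"
  using order_tendstoD(2)[OF radius_tendsto, of r] eventually_happens[of _ sequentially] by auto

lemma dist_le_radius:
  assumes "x \<in> M" "y \<in> M" "x n = y n"
  shows "d x y \<le> radius n"
proof (cases "x = y")
  case True
  then show ?thesis using radius_pos[of n] by (simp add: boundary_dist_def)
next
  case False
  then obtain k where k: "x k \<noteq> y k" by auto
  then have "x (Suc (k - 1)) \<noteq> y (Suc (k - 1))" using same_start assms by (cases k) auto
  then have sep: "x (Suc (shared_edges x y)) \<noteq> y (Suc (shared_edges x y))"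
    unfolding shared_edges_def by (rule LeastI)
  have "n \<le> shared_edges x y"
    using prefix_eq[OF assms, of "Suc (shared_edges x y)"] sep by linarith
  then show ?thesis using False radius_le_iff[of "shared_edges x y" n]
    by (simp add: boundary_dist_def radius_def)
qed

text \<open>
  Together with \<open>dist_le_radius\<close> this identifies the metric with the levels: nonzero distances only
  take the values \<open>radius k\<close>, and \<open>radius k\<close> is attained exactly by the pairs that separate after level \<open>k\<close>.
\<close>

lemma radius_le_dist:
  assumes "x (Suc n) \<noteq> y (Suc n)"
  shows "radius n \<le> d x y"
proof -
  have "shared_edges x y \<le> n" unfolding shared_edges_def by (rule Least_le) (rule assms)
  moreover have "x \<noteq> y" using assms by auto
  ultimately show ?thesis using radius_le_iff[of n "shared_edges x y"]
    by (simp add: boundary_dist_def radius_def)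
qed

lemma metric: "Metric_space M d"
proof -
  have "0 \<le> d x y" for x y :: "nat \<Rightarrow> 'v" using \<epsilon>_pos by (simp add: boundary_dist_def)
  moreover have "shared_edges x y = shared_edges y x" for x y :: "nat \<Rightarrow> 'v"
    unfolding shared_edges_def by metis
  then have "d x y = d y x" for x y :: "nat \<Rightarrow> 'v" by (auto simp: boundary_dist_def)
  moreover have "d x y = 0 \<longleftrightarrow> x = y" for x y :: "nat \<Rightarrow> 'v"
    using \<epsilon>_pos by (simp add: boundary_dist_def)
  moreover have "d x z \<le> d x y + d y z" if xyz: "x \<in> M" "y \<in> M" "z \<in> M" for x y z
  proof (cases "x = z")
    case True
    then show ?thesis using calculation(1)[of x y] calculation(1)[of y z] by (simp add: boundary_dist_def)
  next
    case False
    then obtain k where k: "x k \<noteq> z k" by auto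
    then have "x (Suc (k - 1)) \<noteq> z (Suc (k - 1))" using same_start xyz by (cases k) auto
    then have sep: "x (Suc (shared_edges x z)) \<noteq> z (Suc (shared_edges x z))"
      unfolding shared_edges_def by (rule LeastI)
    have eq: "d x z = radius (shared_edges x z)" using False by (simp add: boundary_dist_def radius_def)
    from sep have "x (Suc (shared_edges x z)) \<noteq> y (Suc (shared_edges x z)) \<or>
        y (Suc (shared_edges x z)) \<noteq> z (Suc (shared_edges x z))" by auto
    then have "d x z \<le> d x y \<or> d x z \<le> d y z" using radius_le_dist eq by metis
    then show ?thesis using calculation(1)[of x y] calculation(1)[of y z] by linarith
  qed
  ultimately show ?thesis unfolding Metric_space_def by blast
qed

sublocale Metric_space M d by (rule metric)

lemma openin_iff_cells: "openin mtopology U \<longleftrightarrow> U \<subseteq> M \<and> (\<forall>x\<in>U. \<exists>n. cell M n x \<subseteq> U)"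
proof -
  have 1: "\<exists>n. cell M n x \<subseteq> mball x r" if "x \<in> M" "0 < r" for x r
  proof -
    obtain n where n: "radius n < r" using obtain_radius_less[OF \<open>0 < r\<close>] by blast
    have "cell M n x \<subseteq> mball x r"
    proof
      fix y assume "y \<in> cell M n x"
      then have "y \<in> M" "x n = y n" by (auto simp: cell_def)
      then show "y \<in> mball x r" using dist_le_radius[OF \<open>x \<in> M\<close>, of y n] n \<open>x \<in> M\<close> by simp
    qed
    then show ?thesis by blast
  qed
  have 2: "mball x (radius n) \<subseteq> cell M n x" if "x \<in> M" for x n
  proof
    fix y assume y: "y \<in> mball x (radius n)"
    then have "y \<in> M" "d x y < radius n" by auto
    then have "x (Suc n) = y (Suc n)" using radius_le_dist[of x n y] by force
    then show "y \<in> cell M n x" using same_parent[OF that \<open>y \<in> M\<close>] \<open>y \<in> M\<close> by (simp add: cell_def)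
  qed
  show ?thesis unfolding openin_mtopology
  proof (intro iffI conjI ballI allI impI)
    fix x assume U: "U \<subseteq> M \<and> (\<forall>x. x \<in> U \<longrightarrow> (\<exists>r>0. mball x r \<subseteq> U))" "x \<in> U"
    then obtain r where r: "r > 0" "mball x r \<subseteq> U" by blast
    have "x \<in> M" using U by blast
    then obtain n where "cell M n x \<subseteq> mball x r" using 1[OF _ r(1)] by blast
    with r(2) show "\<exists>n. cell M n x \<subseteq> U" by (meson subset_trans)
  next
    fix x assume U: "U \<subseteq> M \<and> (\<forall>x\<in>U. \<exists>n. cell M n x \<subseteq> U)" "x \<in> U"
    then obtain n where n: "cell M n x \<subseteq> U" by blast
    have "x \<in> M" using U by blast
    with n have "mball x (radius n) \<subseteq> U" using 2[of x n] by (meson subset_trans)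
    then show "\<exists>r>0. mball x r \<subseteq> U" using radius_pos[of n] by blast
  qed auto
qed

lemma sigma_open: "sigma_sets M {U. openin mtopology U} = sigma_sets M cells"
proof (rule antisym)
  show "sigma_sets M cells \<subseteq> sigma_sets M {U. openin mtopology U}"
  proof (rule sigma_sets_subseteq, rule subsetI)
    fix C assume "C \<in> cells"
    then obtain n x where C: "x \<in> M" "C = cell M n x" by (auto simp: cells_def)
    have "openin mtopology C" unfolding openin_iff_cells C(2)
      using cell_eq cell_subset by blast
    then show "C \<in> {U. openin mtopology U}" by simp
  qed
  show "sigma_sets M {U. openin mtopology U} \<subseteq> sigma_sets M cells"
  proof (rule sigma_sets_mono, rule subsetI)
    fix U assume "U \<in> {U. openin mtopology U}"
    then have U: "U \<subseteq> M" "\<And>x. x \<in> U \<Longrightarrow> \<exists>n. cell M n x \<subseteq> U" unfolding mem_Collect_eq openin_iff_cells by blast+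
    interpret S: sigma_algebra M "sigma_sets M cells"
      by (rule sigma_algebra_sigma_sets[OF cells_subset_Pow])
    have "\<Union>{C \<in> cells. C \<subseteq> U} \<in> sigma_sets M cells"
      by (rule S.countable_Union) (auto intro: countable_subset[OF _ countable_cells])
    moreover have "U = \<Union>{C \<in> cells. C \<subseteq> U}"
    proof (intro equalityI subsetI)
      fix x assume x: "x \<in> U"
      then obtain n where "cell M n x \<subseteq> U" using U by blast
      moreover have "x \<in> M" using x U by blast
      ultimately show "x \<in> \<Union>{C \<in> cells. C \<subseteq> U}" using mem_cell_self cell_in_cells by blast
    qed blast
    ultimately show "U \<in> sigma_sets M cells" by simp
  qed
qed

abbreviation ball_constant :: real where
  "ball_constant \<equiv> (2 / \<epsilon>) powr dimension"

lemma radius_powr_dimension: "radius n powr dimension = ball_constant * (1 / real K) ^ n"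
proof -
  have "exp (- \<epsilon> * real n) powr dimension = exp (- (real n * ln (real K)))"
    using \<epsilon>_pos by (simp add: powr_def)
  also have "\<dots> = (1 / real K) ^ n"
    using two_le_K by (simp add: exp_minus exp_of_nat_mult power_divide inverse_eq_divide)
  finally have "exp (- \<epsilon> * real n) powr dimension = (1 / real K) ^ n" .
  moreover have "radius n powr dimension = ball_constant * exp (- \<epsilon> * real n) powr dimension"
    unfolding radius_def by (rule powr_mult)
  ultimately show ?thesis by simp
qed

lemma dimension_pos: "0 < dimension"
  using two_le_K \<epsilon>_pos by simp

lemma set_diam_cell_le:
  assumes "x \<in> M"
  shows "set_diam d (cell M n x) \<le> ennreal (radius n)"
  unfolding set_diam_def
  by (intro SUP_least ennreal_leI dist_le_radius) (auto simp: cell_def)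

end

text \<open>
  The measure is kept abstract until \<open>normalized_hausdorff_eq\<close> shows that it can only be the
  normalized Hausdorff measure.
\<close>

locale uniform_rays = ray_metric M K \<epsilon> for M :: "(nat \<Rightarrow> 'v) set" and K \<epsilon> +
  fixes \<mu> :: "(nat \<Rightarrow> 'v) measure"
  assumes space_\<mu>: "space \<mu> = M" and sets_\<mu>: "sets \<mu> = sigma_sets M cells"
    and emeasure_cell: "x \<in> M \<Longrightarrow> emeasure \<mu> (cell M n x) = ennreal ((1 / real K) ^ n)"
begin

lemma cell_sets: "x \<in> M \<Longrightarrow> cell M n x \<in> sets \<mu>"
  unfolding sets_\<mu> using cell_in_cells by blast

lemma saturated_sets: "saturated n A \<Longrightarrow> A \<in> sets \<mu>"
  unfolding sets_\<mu> by (rule saturated_in_sigma)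

lemma emeasure_space: "emeasure \<mu> M = 1"
proof -
  obtain x where "x \<in> M" using nonempty by blast
  then show ?thesis using emeasure_cell[of x 0] cell_zero by simp
qed

sublocale prob_space \<mu>
  by (rule prob_spaceI) (simp add: space_\<mu> emeasure_space)

text \<open>
  A set with at least two points and the smallest cell containing it have the same diameter,
  and the measure of a cell is a fixed multiple of the \<open>dimension\<close>-th power of its diameter.
\<close>

lemma cover_set_bound:
  assumes U: "U \<subseteq> M"
  shows "\<exists>V\<in>sets \<mu>. U \<subseteq> V \<and> ennreal ball_constant * emeasure \<mu> V \<le> enn_powr (set_diam d U) dimension"
proof (cases "U = {}")
  case True
  then show ?thesis by (intro bexI[of _ "{}"]) auto
next
  case False
  then obtain x where x: "x \<in> U" by blast
  then have xM: "x \<in> M" using U by blast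
  show ?thesis
  proof (cases "\<forall>n. U \<subseteq> cell M n x")
    case True
    \<comment> \<open>then \<open>U\<close> is a single point, which is a null set\<close>
    let ?V = "\<Inter>n. cell M n x"
    have V: "?V \<in> sets \<mu>" using cell_sets[OF xM] by auto
    have "emeasure \<mu> ?V \<le> 0"
    proof (rule LIMSEQ_le_const)
      have "(\<lambda>n. (1 / real K) ^ n) \<longlonglongrightarrow> 0" by (rule LIMSEQ_power_zero) (use two_le_K in simp)
      then show "(\<lambda>n. ennreal ((1 / real K) ^ n)) \<longlonglongrightarrow> 0" using tendsto_ennrealI ennreal_0 by metis
      show "\<exists>N. \<forall>n\<ge>N. emeasure \<mu> ?V \<le> ennreal ((1 / real K) ^ n)"
        using emeasure_mono[of ?V "cell M _ x" \<mu>] cell_sets[OF xM] emeasure_cell[OF xM] by (metis INF_lower UNIV_I)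
    qed
    then show ?thesis using V True by (intro bexI[of _ ?V]) auto
  next
    case False
    \<comment> \<open>the last level at which \<open>U\<close> is contained in one cell; two points of \<open>U\<close> separate there\<close>
    define n where "n = (LEAST n. \<not> U \<subseteq> cell M (Suc n) x)"
    obtain k where k: "\<not> U \<subseteq> cell M k x" using False by blast
    then have "\<not> U \<subseteq> cell M (Suc (k - 1)) x" using U cell_zero[OF xM] by (cases k) auto
    then have n: "\<not> U \<subseteq> cell M (Suc n) x" unfolding n_def by (rule LeastI)
    have sub: "U \<subseteq> cell M n x"
    proof (cases n)
      case 0
      then show ?thesis using U cell_zero[OF xM] by simp
    next
      case (Suc m)
      then show ?thesis using not_less_Least[of m "\<lambda>n. \<not> U \<subseteq> cell M (Suc n) x"] unfolding n_def by auto
    qed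
    obtain y where y: "y \<in> U" "y (Suc n) \<noteq> x (Suc n)" using n U by (auto simp: cell_def)
    have "ennreal (radius n) \<le> ennreal (d x y)" using radius_le_dist y(2) by (metis ennreal_leI)
    also have "\<dots> \<le> set_diam d U"
      unfolding set_diam_def using x y(1) by (meson SUP_upper2 order_refl)
    finally have "enn_powr (ennreal (radius n)) dimension \<le> enn_powr (set_diam d U) dimension"
      by (intro enn_powr_mono) (use dimension_pos in simp)
    moreover have "enn_powr (ennreal (radius n)) dimension = ennreal ball_constant * emeasure \<mu> (cell M n x)"
      using radius_pos[of n]
      by (simp add: enn_powr_ennreal radius_powr_dimension emeasure_cell[OF xM] ennreal_mult)
    ultimately show ?thesis using sub cell_sets[OF xM] by auto
  qed
qed

text \<open>
  The mass distribution principle: every covering has to pay at least the measure of what it covers.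
\<close>

lemma emeasure_le_hausdorff:
  assumes A: "A \<in> sets \<mu>"
  shows "ennreal ball_constant * emeasure \<mu> A \<le> hausdorff_outer_measure M d dimension A"
proof -
  have "ennreal ball_constant * emeasure \<mu> A \<le> hausdorff_premeasure M d dimension 1 A"
    unfolding hausdorff_premeasure_def
  proof (rule INF_greatest)
    fix U :: "nat \<Rightarrow> (nat \<Rightarrow> 'v) set"
    assume "U \<in> {U. (\<forall>i. U i \<subseteq> M \<and> set_diam d (U i) \<le> ennreal 1) \<and> A \<subseteq> (\<Union>i. U i)}"
    then have U: "\<And>i. U i \<subseteq> M" "A \<subseteq> (\<Union>i. U i)" by auto
    obtain V where V: "\<And>i. V i \<in> sets \<mu>" "\<And>i. U i \<subseteq> V i"
      "\<And>i. ennreal ball_constant * emeasure \<mu> (V i) \<le> enn_powr (set_diam d (U i)) dimension"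
      using cover_set_bound[OF U(1)] by metis
    have "emeasure \<mu> A \<le> emeasure \<mu> (\<Union>i. V i)"
      by (rule emeasure_mono) (use U(2) V(1,2) in blast)+
    also have "\<dots> \<le> (\<Sum>i. emeasure \<mu> (V i))"
      by (rule emeasure_subadditive_countably) (use V(1) in auto)
    finally have "ennreal ball_constant * emeasure \<mu> A \<le> ennreal ball_constant * (\<Sum>i. emeasure \<mu> (V i))"
      by (rule mult_left_mono) simp
    also have "\<dots> = (\<Sum>i. ennreal ball_constant * emeasure \<mu> (V i))" by simp
    also have "\<dots> \<le> (\<Sum>i. enn_powr (set_diam d (U i)) dimension)"
      by (rule suminf_le) (use V(3) in auto)
    finally show "ennreal ball_constant * emeasure \<mu> A \<le> (\<Sum>i. enn_powr (set_diam d (U i)) dimension)" .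
  qed
  also have "\<dots> \<le> hausdorff_outer_measure M d dimension A"
    unfolding hausdorff_outer_measure_def by (rule SUP_upper) simp
  finally show ?thesis .
qed

text \<open>
  Measurable sets are approximated from outside by open sets: the measure is recovered from its
  values on the saturated sets by Caratheodory's construction.
\<close>

lemma outer_regular_cells:
  assumes A: "A \<in> sets \<mu>" and e: "0 < (e::real)"
  shows "\<exists>G\<in>sets \<mu>. A \<subseteq> G \<and> (\<forall>x\<in>G. \<exists>n. cell M n x \<subseteq> G) \<and> emeasure \<mu> G < emeasure \<mu> A + ennreal e"
proof -
  let ?R = "{A. \<exists>n. saturated n A}" and ?f = "emeasure \<mu>"
  interpret R: algebra M ?R by (rule algebra_saturated)
  have Rsets: "?R \<subseteq> sets \<mu>" using saturated_sets by blast
  have pos: "positive ?R ?f" by (simp add: positive_def)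
  have ca: "countably_additive ?R ?f"
    unfolding countably_additive_def using Rsets suminf_emeasure by blast
  have inc: "increasing ?R ?f"
    by (metis R.additive_increasing ca R.countably_additive_additive pos)
  let ?O = "outer_measure ?R ?f"
  define ls where "ls = lambda_system M (Pow M) ?O"
  have mls: "measure_space M ls ?O"
    unfolding ls_def
    by (rule sigma_algebra.caratheodory_lemma[OF sigma_algebra_Pow R.outer_measure_space_outer_measure[OF pos inc]])
  then have sls: "sigma_algebra M ls" by (simp add: measure_space_def)
  have "?R \<subseteq> ls"
    unfolding ls_def by (rule R.algebra_subset_lambda_system[OF pos inc R.countably_additive_additive[OF pos ca]])
  then have sub: "sigma_sets M ?R \<subseteq> ls" by (rule sigma_algebra.sigma_sets_subset[OF sls])
  have ms: "measure_space M (sigma_sets M ?R) ?O"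
    by (rule measure_down[OF mls sigma_algebra_sigma_sets sub]) (rule R.space_closed)
  define N where "N = measure_of M (sigma_sets M ?R) ?O"
  have subPow: "sigma_sets M ?R \<subseteq> Pow M"
    using sigma_sets_into_sp[OF R.space_closed] by blast
  have setsN: "sets N = sigma_sets M ?R"
    unfolding N_def using subPow by (simp add: sigma_sets_sigma_sets_eq[OF R.space_closed])
  have emN: "emeasure N B = ?O B" if "B \<in> sigma_sets M ?R" for B
    unfolding N_def
    by (rule emeasure_measure_of_sigma) (use ms that in \<open>auto simp: measure_space_def\<close>)
  have "\<mu> = N"
  proof (rule measure_eqI_generator_eq[where E = ?R and A = "\<lambda>_. M" and \<Omega> = M])
    show "Int_stable ?R" by (rule R.Int_stable)
    show "?R \<subseteq> Pow M" by (rule R.space_closed)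
    show "emeasure \<mu> X = emeasure N X" if "X \<in> ?R" for X
      using emN[of X] R.outer_measure_agrees[OF pos ca that] that by auto
    show "sets \<mu> = sigma_sets M ?R" using sets_\<mu> sigma_saturated by simp
    show "sets N = sigma_sets M ?R" by fact
    show "range (\<lambda>_::nat. M) \<subseteq> ?R" using R.top by auto
    show "emeasure \<mu> M \<noteq> \<infinity>" using emeasure_space by simp
  qed simp
  then have "?O A = emeasure \<mu> A" using emN A setsN by metis
  moreover have "emeasure \<mu> A < emeasure \<mu> A + ennreal e"
    using e emeasure_finite[of A] by (cases "emeasure \<mu> A") (auto simp: ennreal_plus[symmetric] ennreal_less_iff simp del: ennreal_plus)
  ultimately have "\<exists>C. range C \<subseteq> ?R \<and> disjoint_family C \<and> A \<subseteq> (\<Union>i. C i) \<and> (\<Sum>i. ?f (C i)) < emeasure \<mu> A + ennreal e"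
    by (intro R.outer_measure_close) simp
  then obtain C where C: "range C \<subseteq> ?R" "disjoint_family C" "A \<subseteq> (\<Union>i. C i)"
    "(\<Sum>i. ?f (C i)) < emeasure \<mu> A + ennreal e" by blast
  have "(\<Union>i. C i) \<in> sets \<mu>" using C(1) Rsets by blast
  moreover have "emeasure \<mu> (\<Union>i. C i) = (\<Sum>i. ?f (C i))"
    using suminf_emeasure[of C \<mu>] C(1,2) Rsets by auto
  moreover have "\<exists>n. cell M n x \<subseteq> (\<Union>i. C i)" if "x \<in> (\<Union>i. C i)" for x
  proof -
    obtain i where i: "x \<in> C i" using \<open>x \<in> (\<Union>i. C i)\<close> by blast
    obtain n where "saturated n (C i)" using C(1) by blast
    then show ?thesis using i unfolding saturated_def by blast
  qed
  ultimately show ?thesis using C by (intro bexI[of _ "\<Union>i. C i"]) auto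
qed

text \<open>
  Two cells are nested or disjoint, so the maximal cells of level at least \<open>N\<close> that are contained in
  an open set form a partition of it.
\<close>

lemma open_partition:
  assumes G: "G \<subseteq> M" "\<forall>x\<in>G. \<exists>n. cell M n x \<subseteq> G"
  shows "\<exists>U :: nat \<Rightarrow> _. disjoint_family U \<and> (\<Union>i. U i) = G \<and>
    (\<forall>i. U i = {} \<or> (\<exists>n\<ge>N. \<exists>x\<in>M. U i = cell M n x))"
proof -
  define l where "l x = (LEAST n. N \<le> n \<and> cell M n x \<subseteq> G)" for x
  have l: "N \<le> l x" "cell M (l x) x \<subseteq> G" if "x \<in> G" for x
  proof -
    obtain n where "cell M n x \<subseteq> G" using bspec[OF G(2) \<open>x \<in> G\<close>] by (rule exE)
    then have "N \<le> max N n \<and> cell M (max N n) x \<subseteq> G"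
      using cell_antimono[of x n "max N n"] G(1) that by auto
    then have "N \<le> l x \<and> cell M (l x) x \<subseteq> G" unfolding l_def by (rule LeastI)
    then show "N \<le> l x" "cell M (l x) x \<subseteq> G" by auto
  qed
  define Q where "Q = (\<lambda>x. cell M (l x) x) ` G"
  have QC: "Q \<subseteq> cells" unfolding Q_def using G(1) by (auto intro: cell_in_cells)
  have le: "cell M (l x) x = cell M (l y) y"
    if x: "x \<in> G" and y: "y \<in> G" and ne: "cell M (l x) x \<inter> cell M (l y) y \<noteq> {}" and xy: "l x \<le> l y" for x y
  proof -
    have M: "x \<in> M" "y \<in> M" using x y G(1) by auto
    have sub: "cell M (l y) y \<subseteq> cell M (l x) x"
      using cells_nested_or_disjoint[OF M(2) M(1) xy] ne by blast
    then have "y \<in> cell M (l x) x" using mem_cell_self[OF M(2)] by blast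
    then have eq: "cell M (l x) y = cell M (l x) x" by (rule cell_eq)
    then have "N \<le> l x \<and> cell M (l x) y \<subseteq> G" using l[OF x] by simp
    then have "l y \<le> l x" unfolding l_def[of y] by (rule Least_le)
    then show ?thesis using xy eq by simp
  qed
  have disj: "C = D" if CD: "C \<in> Q" "D \<in> Q" "C \<inter> D \<noteq> {}" for C D
  proof -
    obtain x y where "x \<in> G" "C = cell M (l x) x" "y \<in> G" "D = cell M (l y) y"
      using CD(1,2) unfolding Q_def by blast
    then show ?thesis using le[of x y] le[of y x] CD(3) by (metis Int_commute nle_le)
  qed
  have cQ: "countable Q" using countable_subset[OF QC countable_cells] .
  define U where "U i = (if i \<in> to_nat_on Q ` Q then from_nat_into Q i else {})" for i
  have UQ: "U i \<in> Q" if "i \<in> to_nat_on Q ` Q" for i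
    using that cQ unfolding U_def by auto
  have "disjoint_family U"
    unfolding disjoint_family_on_def
  proof (intro ballI impI)
    fix i j :: nat assume "i \<noteq> j"
    show "U i \<inter> U j = {}"
    proof (cases "i \<in> to_nat_on Q ` Q \<and> j \<in> to_nat_on Q ` Q")
      case True
      then obtain C D where CD: "C \<in> Q" "D \<in> Q" "i = to_nat_on Q C" "j = to_nat_on Q D" by blast
      then have "U i = C" "U j = D" using cQ unfolding U_def by auto
      then show ?thesis using disj[of C D] CD \<open>i \<noteq> j\<close> by blast
    qed (auto simp: U_def)
  qed
  moreover have "(\<Union>i. U i) = G"
  proof (intro equalityI subsetI)
    fix x assume "x \<in> (\<Union>i. U i)"
    then obtain i where i: "x \<in> U i" by blast
    then have "i \<in> to_nat_on Q ` Q" unfolding U_def by (auto split: if_splits)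
    then obtain y where "y \<in> G" "U i = cell M (l y) y" using UQ[of i] unfolding Q_def by auto
    then show "x \<in> G" using i l(2)[of y] by auto
  next
    fix x assume x: "x \<in> G"
    then have C: "cell M (l x) x \<in> Q" unfolding Q_def by blast
    then have "U (to_nat_on Q (cell M (l x) x)) = cell M (l x) x" using cQ unfolding U_def by auto
    then show "x \<in> (\<Union>i. U i)" using mem_cell_self[of x "l x"] x G(1) by auto
  qed
  moreover have "U i = {} \<or> (\<exists>n\<ge>N. \<exists>x\<in>M. U i = cell M n x)" for i
  proof (cases "i \<in> to_nat_on Q ` Q")
    case True
    then obtain y where "y \<in> G" "U i = cell M (l y) y" using UQ[of i] unfolding Q_def by auto
    then show ?thesis using l(1)[of y] G(1) by auto
  qed (simp add: U_def)
  ultimately show ?thesis by blast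
qed

text \<open>
  Cells of high level are an efficient covering, since their contribution to the Hausdorff sum is
  proportional to their measure.
\<close>

lemma hausdorff_le_emeasure:
  assumes A: "A \<in> sets \<mu>"
  shows "hausdorff_outer_measure M d dimension A \<le> ennreal ball_constant * emeasure \<mu> A"
  unfolding hausdorff_outer_measure_def
proof (rule SUP_least)
  fix \<delta> :: real assume "\<delta> \<in> {0<..}"
  then obtain N where N: "radius N < \<delta>" using obtain_radius_less by auto
  show "hausdorff_premeasure M d dimension \<delta> A \<le> ennreal ball_constant * emeasure \<mu> A"
  proof (rule ennreal_le_epsilon)
    fix e :: real assume "0 < e"
    have cpos: "0 < ball_constant" using \<epsilon>_pos by simp
    define e' where "e' = e / ball_constant"
    have "0 < e'" using \<open>0 < e\<close> cpos by (simp add: e'_def)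
    obtain G where G: "G \<in> sets \<mu>" "A \<subseteq> G" "\<forall>x\<in>G. \<exists>n. cell M n x \<subseteq> G"
      "emeasure \<mu> G < emeasure \<mu> A + ennreal e'"
      using outer_regular_cells[OF A \<open>0 < e'\<close>] by (elim bexE conjE)
    have GM: "G \<subseteq> M" using sets.sets_into_space[OF G(1)] space_\<mu> by simp
    then obtain U :: "nat \<Rightarrow> _" where U: "disjoint_family U" "(\<Union>i. U i) = G"
      "\<forall>i. U i = {} \<or> (\<exists>n\<ge>N. \<exists>x\<in>M. U i = cell M n x)"
      using open_partition[OF GM G(3), of N] by (elim exE conjE)
    have Us: "U i \<in> sets \<mu>" for i using spec[OF U(3), of i] cell_sets by auto
    have small: "U i \<subseteq> M \<and> set_diam d (U i) \<le> ennreal \<delta> \<and>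
        enn_powr (set_diam d (U i)) dimension \<le> ennreal ball_constant * emeasure \<mu> (U i)" for i
      using spec[OF U(3), of i]
    proof
      assume "U i = {}"
      then show ?thesis by (simp add: set_diam_def bot_ennreal enn_powr_def)
    next
      assume "\<exists>n\<ge>N. \<exists>x\<in>M. U i = cell M n x"
      then obtain n x where nx: "N \<le> n" "x \<in> M" "U i = cell M n x" by blast
      have "radius n \<le> \<delta>" using radius_le_iff[of n N] nx(1) N by linarith
      then have "set_diam d (U i) \<le> ennreal \<delta>"
        using set_diam_cell_le[OF nx(2), of n] nx(3) by (metis ennreal_leI order_trans)
      moreover have "enn_powr (set_diam d (U i)) dimension \<le> enn_powr (ennreal (radius n)) dimension"
        unfolding nx(3) by (intro enn_powr_mono set_diam_cell_le nx) (use dimension_pos in simp)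
      moreover have "enn_powr (ennreal (radius n)) dimension = ennreal ball_constant * emeasure \<mu> (U i)"
        using radius_pos[of n]
        by (simp add: nx(3) enn_powr_ennreal radius_powr_dimension emeasure_cell[OF nx(2)] ennreal_mult)
      ultimately show ?thesis using nx(3) cell_subset by simp
    qed
    have "hausdorff_premeasure M d dimension \<delta> A \<le> (\<Sum>i. enn_powr (set_diam d (U i)) dimension)"
      unfolding hausdorff_premeasure_def
      by (rule INF_lower) (use small U(2) G(2) in auto)
    also have "\<dots> \<le> (\<Sum>i. ennreal ball_constant * emeasure \<mu> (U i))"
      by (rule suminf_le) (use small in auto)
    also have "\<dots> = ennreal ball_constant * emeasure \<mu> G"
      using suminf_emeasure[of U \<mu>] Us U(1,2) by (simp add: image_subset_iff)
    also have "\<dots> \<le> ennreal ball_constant * (emeasure \<mu> A + ennreal e')"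
      by (rule mult_left_mono) (use G(4) in auto)
    also have "\<dots> = ennreal ball_constant * emeasure \<mu> A + ennreal e"
      using cpos \<open>0 < e\<close> by (simp add: distrib_left e'_def ennreal_mult[symmetric])
    finally show "hausdorff_premeasure M d dimension \<delta> A \<le> ennreal ball_constant * emeasure \<mu> A + ennreal e" .
  qed
qed

lemma normalized_hausdorff_eq: "\<nu> = \<mu>"
proof -
  let ?H = "hausdorff_outer_measure M d dimension"
  have H: "?H A = ennreal ball_constant * emeasure \<mu> A" if "A \<in> sets \<mu>" for A
    using hausdorff_le_emeasure[OF that] emeasure_le_hausdorff[OF that] by (rule antisym)
  have cpos: "0 < ball_constant" using \<epsilon>_pos by simp
  have Ms: "M \<in> sets \<mu>" using sets.top[of \<mu>] space_\<mu> by simp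
  have ratio: "?H A / ?H M = emeasure \<mu> A" if "A \<in> sets \<mu>" for A
  proof -
    have "?H A / ?H M = (emeasure \<mu> A * ennreal ball_constant) / ennreal ball_constant"
      using H[OF that] H[OF Ms] emeasure_space by (simp add: mult.commute)
    also have "\<dots> = emeasure \<mu> A"
      using cpos by (simp add: ennreal_mult_divide_eq)
    finally show ?thesis .
  qed
  have \<nu>: "\<nu> = measure_of M {U. openin mtopology U} (\<lambda>A. ?H A / ?H M)"
    by (simp add: \<nu>_def normalized_hausdorff_measure_def)
  have sub: "{U. openin mtopology U} \<subseteq> Pow M" using openin_iff_cells by blast
  have sets: "sets \<nu> = sets \<mu>"
    unfolding \<nu> using sub by (simp add: sigma_open sets_\<mu>)
  show ?thesis
  proof (rule measure_eqI[OF sets])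
    fix A assume A: "A \<in> sets \<nu>"
    have pos: "positive (sets \<nu>) (\<lambda>A. ?H A / ?H M)"
      unfolding positive_def using ratio[of "{}"] by simp
    have ca: "countably_additive (sets \<nu>) (\<lambda>A. ?H A / ?H M)"
      unfolding countably_additive_def sets
    proof (intro allI impI)
      fix B :: "nat \<Rightarrow> _" assume B: "range B \<subseteq> sets \<mu>" "disjoint_family B" "\<Union>(range B) \<in> sets \<mu>"
      have "(\<Sum>i. ?H (B i) / ?H M) = (\<Sum>i. emeasure \<mu> (B i))"
        using B(1) ratio by (intro suminf_cong) auto
      also have "\<dots> = emeasure \<mu> (\<Union>(range B))" by (rule suminf_emeasure[OF B(1,2)])
      finally show "(\<Sum>i. ?H (B i) / ?H M) = ?H (\<Union>(range B)) / ?H M" using ratio[OF B(3)] by simp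
    qed
    show "emeasure \<nu> A = emeasure \<mu> A"
      using emeasure_measure_of[OF \<nu> sub pos ca A] ratio[of A] A sets by simp
  qed
qed

end

lemma (in ray_metric) uniform_rays_hausdorff: "uniform_rays M K \<epsilon> \<nu>"
proof -
  obtain \<mu> where \<mu>: "space \<mu> = M" "sets \<mu> = sigma_sets M cells"
    "\<And>n x. x \<in> M \<Longrightarrow> emeasure \<mu> (cell M n x) = ennreal ((1 / real K) ^ n)"
    using ex_uniform_measure by auto
  interpret uniform_rays M K \<epsilon> \<mu> by unfold_locales (use \<mu> in auto)
  show ?thesis unfolding normalized_hausdorff_eq by unfold_locales
qed

section \<open>Powers and Jensen's inequality\<close>

lemma enn_powr_enn_powr_inverse:
  assumes "0 < p"
  shows "enn_powr (enn_powr x (1 / p)) p = x"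
proof (cases x)
  case (real r)
  then show ?thesis using assms by (simp add: enn_powr_ennreal powr_powr)
qed (simp add: enn_powr_def)

lemma enn_powr_less_top: "enn_powr x a < \<infinity> \<longleftrightarrow> x < \<infinity>"
  by (auto simp: enn_powr_def top.not_eq_extremum)

text \<open>
  This passes from \<open>p\<close>-th powers back to norms; the factor \<open>2\<close> comes from bounding each of
  \<open>s\<^sup>p\<close> and \<open>t\<^sup>p\<close> by \<open>(s + t)\<^sup>p\<close>.
\<close>

lemma enn_powr_sum_bound:
  assumes p: "1 \<le> p" and a: "0 < a"
    and le: "enn_powr x p \<le> ennreal a * (enn_powr y p + enn_powr z p)"
  shows "x \<le> ennreal ((2 * a) powr (1 / p)) * (y + z)"
proof (cases "y = \<infinity> \<or> z = \<infinity>")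
  case True
  then show ?thesis using a by (auto simp: ennreal_mult_top)
next
  case False
  then obtain s t where st: "y = ennreal s" "0 \<le> s" "z = ennreal t" "0 \<le> t"
    by (cases y; cases z) auto
  have fin: "enn_powr x p \<le> ennreal (a * (s powr p + t powr p))"
    using le a st by (simp add: enn_powr_ennreal ennreal_mult ennreal_plus)
  then have "enn_powr x p < \<infinity>" by (rule le_less_trans) simp
  then have "x < \<infinity>" by (simp only: enn_powr_less_top)
  then obtain r where r: "x = ennreal r" "0 \<le> r" by (cases x) auto
  have "r powr p \<le> a * (s powr p + t powr p)"
    using fin r st a by (simp add: enn_powr_ennreal)
  also have "\<dots> \<le> a * ((s + t) powr p + (s + t) powr p)"
    using a p st by (intro mult_left_mono add_mono powr_mono2) auto
  finally have "r powr p \<le> (2 * a) * (s + t) powr p" by simp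
  then have "(r powr p) powr (1 / p) \<le> ((2 * a) * (s + t) powr p) powr (1 / p)"
    using p by (intro powr_mono2) auto
  also have "\<dots> = (2 * a) powr (1 / p) * ((s + t) powr p) powr (1 / p)" by (rule powr_mult)
  finally have "r \<le> (2 * a) powr (1 / p) * (s + t)"
    using p r st by (simp add: powr_powr)
  then show ?thesis using r st by (simp add: ennreal_leI flip: ennreal_mult ennreal_plus)
qed

text \<open>
  The tangent line inequality \<open>y\<^sup>p \<ge> a\<^sup>p + p * a\<^sup>p\<^sup>-\<^sup>1 * (y - a)\<close>, rearranged so that all terms are
  nonnegative and it can be integrated with values in \<open>ennreal\<close>.
\<close>

lemma powr_above_tangent:
  fixes a y p :: real
  assumes "1 \<le> p" "0 \<le> y" "0 < a"
  shows "a powr p + p * a powr (p - 1) * y \<le> y powr p + p * a powr p"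
proof (cases "y = 0")
  case True
  then show ?thesis using assms mult_right_mono[of 1 p "a powr p"] by simp
next
  case False
  have "((\<lambda>x. x powr p) has_real_derivative p * a powr (p - 1)) (at a within {0<..})"
    using assms by (auto intro!: derivative_eq_intros simp: powr_diff)
  then have "y powr p - a powr p \<ge> p * a powr (p - 1) * (y - a)"
    using False assms
    by (intro convex_on_imp_above_tangent[where A = "{0<..}" and f = "\<lambda>x. x powr p"])
      (auto simp: powr_convex interior_open)
  moreover have "a powr (p - 1) * a = a powr p" using assms by (simp add: powr_diff)
  moreover have "p * a powr (p - 1) * (y - a) = p * a powr (p - 1) * y - p * (a powr (p - 1) * a)"
    by (simp add: algebra_simps)
  ultimately show ?thesis by simp
qed

text \<open>
  Jensen's inequality for the values \<open>b i / w i\<close> with weights \<open>w i\<close>: the tangent line inequality at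
  their weighted mean is summed. It replaces Hoelder's inequality when a sum of geometrically
  weighted terms is raised to the power \<open>p\<close>.
\<close>

lemma powr_sum_le_weighted:
  fixes b w :: "'i \<Rightarrow> real"
  assumes p: "1 \<le> p" and b: "\<And>i. i \<in> S \<Longrightarrow> 0 \<le> b i" and w: "\<And>i. i \<in> S \<Longrightarrow> 0 < w i"
    and W: "sum w S \<le> W"
  shows "sum b S powr p \<le> W powr (p - 1) * (\<Sum>i\<in>S. w i powr (1 - p) * b i powr p)"
proof (cases "sum b S = 0")
  case True
  then show ?thesis by (auto intro!: mult_nonneg_nonneg sum_nonneg)
next
  case False
  then have fin: "finite S" "S \<noteq> {}" by (auto intro: ccontr)
  define B where "B = sum b S"
  define V where "V = sum w S"
  have B: "0 < B" unfolding B_def using False b sum_nonneg[of S b] by force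
  have V: "0 < V" unfolding V_def using fin w by (intro sum_pos) auto
  define a where "a = B / V"
  have a: "0 < a" using B V by (simp add: a_def)
  have tangent: "w i * a powr p + p * a powr (p - 1) * b i \<le> w i powr (1 - p) * b i powr p + p * a powr p * w i"
    if i: "i \<in> S" for i
  proof -
    have "w i * (a powr p + p * a powr (p - 1) * (b i / w i)) \<le> w i * ((b i / w i) powr p + p * a powr p)"
      using powr_above_tangent[OF p, of "b i / w i" a] a b[OF i] w[OF i]
      by (intro mult_left_mono) auto
    moreover have "w i * (b i / w i) powr p = w i powr (1 - p) * b i powr p"
      using w[OF i] b[OF i] by (simp add: powr_divide powr_diff)
    ultimately show ?thesis using w[OF i] by (simp add: algebra_simps)
  qed
  have "(\<Sum>i\<in>S. w i * a powr p + p * a powr (p - 1) * b i)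
      \<le> (\<Sum>i\<in>S. w i powr (1 - p) * b i powr p + p * a powr p * w i)"
    by (rule sum_mono) (rule tangent)
  then have "V * a powr p + p * a powr (p - 1) * B \<le> (\<Sum>i\<in>S. w i powr (1 - p) * b i powr p) + p * a powr p * V"
    by (simp add: sum.distrib sum_distrib_left sum_distrib_right B_def V_def)
  moreover have "a powr (p - 1) * B = a powr p * V"
  proof -
    have "B = a * V" using V by (simp add: a_def)
    moreover have "a powr (p - 1) * a = a powr p" using a by (simp add: powr_diff)
    ultimately show ?thesis by (simp add: mult.assoc[symmetric])
  qed
  moreover have "p * a powr (p - 1) * B = p * (a powr (p - 1) * B)" "p * a powr p * V = p * (a powr p * V)"
    by simp_all
  ultimately have main: "V * a powr p \<le> (\<Sum>i\<in>S. w i powr (1 - p) * b i powr p)"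
    by simp
  have "B powr p = V powr (p - 1) * (V * a powr p)"
    using B V by (simp add: a_def powr_divide powr_diff)
  also have "\<dots> \<le> W powr (p - 1) * (\<Sum>i\<in>S. w i powr (1 - p) * b i powr p)"
    using main V W p unfolding V_def[symmetric]
    by (intro mult_mono powr_mono2) auto
  finally show ?thesis unfolding B_def .
qed

text \<open>
  The same summation of tangent lines at the mean, for an integral over a set of finite measure.
\<close>

lemma powr_mean_le:
  fixes v :: "'a \<Rightarrow> real"
  assumes p: "1 \<le> p" and v: "integrable N v" and C: "C \<in> sets N"
    and m: "0 < m" "emeasure N C = ennreal m"
  shows "ennreal (\<bar>1 / m * (\<integral>x. indicator C x * v x \<partial>N)\<bar> powr p)
    \<le> ennreal (1 / m) * (\<integral>\<^sup>+x\<in>C. ennreal (\<bar>v x\<bar> powr p) \<partial>N)"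
proof -
  define J where "J = (\<integral>x. indicator C x * v x \<partial>N)"
  define a where "a = \<bar>1 / m * J\<bar>"
  show ?thesis
  proof (cases "a = 0")
    case True
    then show ?thesis unfolding J_def[symmetric] a_def[symmetric] by simp
  next
    case False
    then have a: "0 < a" by (simp add: a_def)
    have vm: "v \<in> borel_measurable N" using v by simp
    let ?I = "\<integral>\<^sup>+x\<in>C. ennreal (\<bar>v x\<bar> powr p) \<partial>N"
    let ?L = "\<integral>\<^sup>+x\<in>C. ennreal \<bar>v x\<bar> \<partial>N"
    have iv: "integrable N (\<lambda>x. indicator C x * v x)"
      using integrable_mult_indicator[OF C v] by simp
    have "ennreal (a * m) = ennreal \<bar>J\<bar>" using m(1) by (simp add: a_def abs_mult)
    also have "\<dots> \<le> (\<integral>\<^sup>+x. ennreal \<bar>indicator C x * v x\<bar> \<partial>N)"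
    proof -
      have "\<bar>J\<bar> \<le> (\<integral>x. \<bar>indicator C x * v x\<bar> \<partial>N)" unfolding J_def by (rule integral_abs_bound)
      then have "ennreal \<bar>J\<bar> \<le> ennreal (\<integral>x. \<bar>indicator C x * v x\<bar> \<partial>N)" by (rule ennreal_leI)
      also have "\<dots> = (\<integral>\<^sup>+x. ennreal \<bar>indicator C x * v x\<bar> \<partial>N)"
        using iv by (intro nn_integral_eq_integral[symmetric]) auto
      finally show ?thesis .
    qed
    also have "\<dots> = ?L" by (intro nn_integral_cong) (auto simp: indicator_def)
    finally have L: "ennreal (a * m) \<le> ?L" .
    \<comment> \<open>the tangent term is added on both sides and cancelled at the end, which is possible as it is finite\<close>
    have em: "ennreal r * ennreal m = (\<integral>\<^sup>+x\<in>C. ennreal r \<partial>N)" for r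
      using C m by (simp add: nn_integral_cmult_indicator)
    have c0: "0 \<le> p * a powr (p - 1)" using p by simp
    have "ennreal (a powr p * m) + ennreal (p * a powr p * m)
        = ennreal (a powr p) * ennreal m + ennreal (p * a powr (p - 1)) * ennreal (a * m)"
    proof -
      have "p * a powr p * m = p * a powr (p - 1) * (a * m)" using a by (simp add: powr_diff)
      then show ?thesis using a m p by (simp add: ennreal_mult mult.assoc)
    qed
    also have "\<dots> \<le> (\<integral>\<^sup>+x\<in>C. ennreal (a powr p) \<partial>N) + ennreal (p * a powr (p - 1)) * ?L"
      unfolding em by (intro add_left_mono mult_left_mono L) simp
    also have "\<dots> = (\<integral>\<^sup>+x. ennreal (a powr p) * indicator C x + ennreal (p * a powr (p - 1)) * (ennreal \<bar>v x\<bar> * indicator C x) \<partial>N)"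
      using vm C by (simp add: nn_integral_add nn_integral_cmult)
    also have "\<dots> \<le> (\<integral>\<^sup>+x. ennreal (\<bar>v x\<bar> powr p) * indicator C x + ennreal (p * a powr p) * indicator C x \<partial>N)"
    proof (rule nn_integral_mono)
      fix x
      have "ennreal (a powr p) + ennreal (p * a powr (p - 1)) * ennreal \<bar>v x\<bar>
          = ennreal (a powr p + p * a powr (p - 1) * \<bar>v x\<bar>)"
        using p by (simp add: ennreal_mult ennreal_plus)
      also have "\<dots> \<le> ennreal (\<bar>v x\<bar> powr p + p * a powr p)"
        using powr_above_tangent[OF p _ a, of "\<bar>v x\<bar>"] by (intro ennreal_leI) auto
      also have "\<dots> = ennreal (\<bar>v x\<bar> powr p) + ennreal (p * a powr p)"
        using p by (simp add: ennreal_plus)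
      finally show "ennreal (a powr p) * indicator C x + ennreal (p * a powr (p - 1)) * (ennreal \<bar>v x\<bar> * indicator C x)
        \<le> ennreal (\<bar>v x\<bar> powr p) * indicator C x + ennreal (p * a powr p) * indicator C x"
        by (auto simp: indicator_def)
    qed
    also have "\<dots> = ?I + ennreal (p * a powr p) * ennreal m"
      using vm C by (simp add: nn_integral_add em)
    also have "\<dots> = ?I + ennreal (p * a powr p * m)"
      using m p by (simp add: ennreal_mult)
    finally have "ennreal (a powr p * m) \<le> ?I"
      by (simp add: add.commute ennreal_add_left_cancel_le)
    then have "ennreal (1 / m) * ennreal (a powr p * m) \<le> ennreal (1 / m) * ?I"
      by (intro mult_left_mono) auto
    moreover have "ennreal (1 / m) * ennreal (a powr p * m) = ennreal (a powr p)"
      using m by (simp flip: ennreal_mult)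
    ultimately show ?thesis unfolding a_def J_def by simp
  qed
qed


section \<open>Besov energies on the rays\<close>

context uniform_rays
begin

text \<open>
  The \<open>p\<close>-th power of \<open>besov_E\<close> at the radii whose balls are the cells of level \<open>n\<close>.
\<close>

definition scale_energy :: "real \<Rightarrow> ((nat \<Rightarrow> 'v) \<Rightarrow> real) \<Rightarrow> nat \<Rightarrow> ennreal" where
  "scale_energy p u n =
     (\<integral>\<^sup>+x. ennreal (real K ^ n) * (\<integral>\<^sup>+y\<in>cell M n x. ennreal (\<bar>u x - u y\<bar> powr p) \<partial>\<mu>) \<partial>\<mu>)"

text \<open>
  The radii whose open balls are the cells of level \<open>n\<close>.
\<close>

definition scales :: "nat \<Rightarrow> real set" where
  "scales n = (case n of 0 \<Rightarrow> {radius 0<..} | Suc m \<Rightarrow> {radius n<..radius m})"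

lemma mball_eq_cell:
  assumes t: "t \<in> scales n" and x: "x \<in> M"
  shows "mball x t = cell M n x"
proof (intro equalityI subsetI)
  have tr: "radius n < t" using t by (auto simp: scales_def split: nat.splits)
  fix y assume "y \<in> cell M n x"
  then have "y \<in> M" "x n = y n" by (auto simp: cell_def)
  then show "y \<in> mball x t" using dist_le_radius[OF x, of y n] tr x by simp
next
  fix y assume "y \<in> mball x t"
  then have y: "y \<in> M" "d x y < t" by auto
  show "y \<in> cell M n x"
  proof (cases n)
    case 0
    then show ?thesis using y cell_zero[OF x] by simp
  next
    case (Suc m)
    then have "t \<le> radius m" using t by (auto simp: scales_def)
    then have "x (Suc m) = y (Suc m)" using radius_le_dist[of x m y] y(2) by force
    then show ?thesis using Suc y by (simp add: cell_def)
  qed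
qed

lemma scales_cover: "0 < t \<Longrightarrow> \<exists>n. t \<in> scales n"
proof -
  assume t: "0 < t"
  define n where "n = (LEAST n. radius n < t)"
  have n: "radius n < t" unfolding n_def by (rule LeastI_ex) (rule obtain_radius_less[OF t])
  show "\<exists>n. t \<in> scales n"
  proof (cases n)
    case 0
    then show ?thesis using n by (intro exI[of _ 0]) (simp add: scales_def)
  next
    case (Suc m)
    then have "\<not> radius m < t" using not_less_Least[of m "\<lambda>n. radius n < t"] by (simp add: n_def)
    then show ?thesis using n Suc by (intro exI[of _ n]) (simp add: scales_def)
  qed
qed

lemma scales_bounds: "t \<in> scales n \<Longrightarrow> radius n < t" "t \<in> scales (Suc n) \<Longrightarrow> t \<le> radius n"
  by (auto simp: scales_def split: nat.splits)

lemma scales_less_disjoint: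
  assumes "m < n"
  shows "scales m \<inter> scales n = {}"
proof -
  obtain k where k: "n = Suc k" "m \<le> k" using assms by (cases n) auto
  have "radius k \<le> radius m" using radius_le_iff k(2) by simp
  then show ?thesis using scales_bounds(1)[of _ m] scales_bounds(2)[of _ k] k(1) by fastforce
qed

lemma disjoint_scales: "disjoint_family scales"
  unfolding disjoint_family_on_def
  using scales_less_disjoint by (metis Int_commute linorder_neqE_nat)

lemma scales_sets: "scales n \<in> sets lborel"
  by (cases n) (auto simp: scales_def)

lemma scales_pos: "t \<in> scales n \<Longrightarrow> 0 < t"
  using scales_bounds(1)[of t n] radius_pos[of n] by simp

lemma besov_E_eq:
  assumes t: "t \<in> scales n"
  shows "besov_E d \<mu> p u t = enn_powr (scale_energy p u n) (1 / p)"
proof -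
  have inv: "1 / ennreal ((1 / real K) ^ n) = ennreal (real K ^ n)"
  proof -
    have pos: "0 < (1 / real K) ^ n" using two_le_K by simp
    have "1 / ennreal ((1 / real K) ^ n) = ennreal (1 / (1 / real K) ^ n)"
      using pos by (simp flip: ennreal_1 add: divide_ennreal)
    then show ?thesis by (simp add: power_divide)
  qed
  have "(\<integral>\<^sup>+\<zeta>. 1 / emeasure \<mu> (mball \<zeta> t) * (\<integral>\<^sup>+\<xi>\<in>mball \<zeta> t. ennreal (\<bar>u \<zeta> - u \<xi>\<bar> powr p) \<partial>\<mu>) \<partial>\<mu>)
      = scale_energy p u n"
    unfolding scale_energy_def
    by (intro nn_integral_cong) (simp add: space_\<mu> mball_eq_cell[OF t] emeasure_cell inv)
  then show ?thesis unfolding besov_E_def Let_def space_\<mu> by simp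
qed

lemma scaled_powr:
  assumes p: "0 < p" and t: "0 < t"
  shows "enn_powr (enn_powr D (1 / p) / ennreal (t powr \<theta>)) p * ennreal (1 / t)
    = D * ennreal (t powr (- \<theta> * p - 1))"
proof (cases D)
  case (real r)
  have "enn_powr (enn_powr D (1 / p) / ennreal (t powr \<theta>)) p = ennreal ((r powr (1 / p) / t powr \<theta>) powr p)"
    using real t by (simp add: enn_powr_ennreal divide_ennreal)
  also have "(r powr (1 / p) / t powr \<theta>) powr p = r * t powr (- \<theta> * p)"
    using real t p by (simp add: powr_divide powr_powr powr_minus_divide)
  finally have *: "enn_powr (enn_powr D (1 / p) / ennreal (t powr \<theta>)) p = ennreal (r * t powr (- \<theta> * p))" .
  have "enn_powr (enn_powr D (1 / p) / ennreal (t powr \<theta>)) p * ennreal (1 / t)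
      = ennreal (r * t powr (- \<theta> * p) * (1 / t))"
    unfolding * using real t by (intro ennreal_mult[symmetric]) auto
  also have "r * t powr (- \<theta> * p) * (1 / t) = r * t powr (- \<theta> * p - 1)"
    using t by (simp add: powr_diff)
  finally show ?thesis using real by (simp add: ennreal_mult)
next
  case top
  then show ?thesis using t by (simp add: enn_powr_def ennreal_top_divide ennreal_top_mult)
qed

definition scale_weight :: "real \<Rightarrow> nat \<Rightarrow> ennreal" where
  "scale_weight s n = (\<integral>\<^sup>+t\<in>scales n. ennreal (t powr (- s - 1)) \<partial>lborel)"

lemma besov_seminorm_eq:
  assumes p: "0 < p"
  shows "enn_powr (besov_seminorm d \<mu> \<theta> p u) p = (\<Sum>n. scale_energy p u n * scale_weight (\<theta> * p) n)"
proof -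
  let ?D = "scale_energy p u"
  have "enn_powr (besov_seminorm d \<mu> \<theta> p u) p
      = (\<integral>\<^sup>+t\<in>{0<..}. enn_powr (besov_E d \<mu> p u t / ennreal (t powr \<theta>)) p * ennreal (1 / t) \<partial>lborel)"
    unfolding besov_seminorm_def by (rule enn_powr_enn_powr_inverse[OF p])
  also have "\<dots> = (\<integral>\<^sup>+t. (\<Sum>n. ?D n * (ennreal (t powr (- (\<theta> * p) - 1)) * indicator (scales n) t)) \<partial>lborel)"
  proof (rule nn_integral_cong)
    fix t :: real
    show "enn_powr (besov_E d \<mu> p u t / ennreal (t powr \<theta>)) p * ennreal (1 / t) * indicator {0<..} t
        = (\<Sum>n. ?D n * (ennreal (t powr (- (\<theta> * p) - 1)) * indicator (scales n) t))"
    proof (cases "0 < t")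
      case True
      then obtain k where k: "t \<in> scales k" using scales_cover by blast
      have "(\<Sum>n. ?D n * (ennreal (t powr (- (\<theta> * p) - 1)) * indicator (scales n) t))
          = (\<Sum>n. (?D n * ennreal (t powr (- (\<theta> * p) - 1))) * indicator (scales n) t)"
        by (simp add: mult.assoc)
      also have "\<dots> = ?D k * ennreal (t powr (- (\<theta> * p) - 1))"
        by (rule suminf_cmult_indicator[OF disjoint_scales k])
      also have "\<dots> = enn_powr (besov_E d \<mu> p u t / ennreal (t powr \<theta>)) p * ennreal (1 / t)"
        unfolding besov_E_eq[OF k] using scaled_powr[OF p True] by simp
      finally show ?thesis using True by simp
    next
      case False
      then have "t \<notin> scales n" for n using scales_pos by blast
      then show ?thesis using False by simp
    qed
  qed
  also have "\<dots> = (\<Sum>n. ?D n * scale_weight (\<theta> * p) n)"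
    unfolding scale_weight_def using scales_sets
    by (simp add: nn_integral_suminf nn_integral_cmult)
  finally show ?thesis .
qed

text \<open>
  The whole half-line above \<open>radius n\<close> contributes no more, up to a constant, than the scale \<open>n\<close>
  itself; this treats the unbounded scale \<open>0\<close> like all others.
\<close>

lemma scale_weight_le:
  assumes s: "0 < s"
  shows "scale_weight s n \<le> ennreal ((2 / \<epsilon>) powr (- s) / s * exp (\<epsilon> * s * real n))"
proof -
  have r: "0 < radius n" by (rule radius_pos)
  have "scale_weight s n \<le> (\<integral>\<^sup>+t. ennreal (t powr (- s - 1)) * indicator {radius n..} t \<partial>lborel)"
    unfolding scale_weight_def using scales_bounds(1)[of _ n]
    by (intro nn_integral_mono) (auto simp: indicator_def less_imp_le)
  also have "\<dots> = ennreal (0 - (- (radius n powr (- s) / s)))"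
  proof (rule nn_integral_FTC_atLeast)
    show "((\<lambda>t. - (t powr (- s) / s)) has_real_derivative t powr (- s - 1)) (at t)" if "radius n \<le> t" for t
      using that r s by (auto intro!: derivative_eq_intros simp: field_simps powr_diff)
    have "((\<lambda>t. t powr (- s)) \<longlongrightarrow> 0) at_top"
      by (rule tendsto_neg_powr) (use s in \<open>auto intro: filterlim_ident\<close>)
    then have "((\<lambda>t. - (t powr (- s) / s)) \<longlongrightarrow> - (0 / s)) at_top"
      by (intro tendsto_minus tendsto_divide tendsto_const) (use s in simp_all)
    then show "((\<lambda>t. - (t powr (- s) / s)) \<longlongrightarrow> 0) at_top" by simp
  qed (use r in auto)
  also have "0 - (- (radius n powr (- s) / s)) = (2 / \<epsilon>) powr (- s) / s * exp (\<epsilon> * s * real n)"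
  proof -
    have "radius n powr (- s) = (2 / \<epsilon>) powr (- s) * exp (- \<epsilon> * real n) powr (- s)"
      unfolding radius_def by (rule powr_mult)
    also have "exp (- \<epsilon> * real n) powr (- s) = exp (\<epsilon> * s * real n)"
      by (simp add: powr_def mult_ac)
    finally show ?thesis by simp
  qed
  finally show ?thesis .
qed

lemma scale_weight_ge:
  assumes s: "0 < s"
  shows "\<exists>c>0. \<forall>n. ennreal (c * exp (\<epsilon> * s * real n)) \<le> scale_weight s n"
proof -
  define c where "c = (2 / \<epsilon>) powr (- s) * exp (\<epsilon> * (- s - 1)) * (exp \<epsilon> - 1)"
  have e1: "1 < exp \<epsilon>" using \<epsilon>_pos by simp
  have "0 < c" unfolding c_def using \<epsilon>_pos e1 by simp
  moreover have "ennreal (c * exp (\<epsilon> * s * real n)) \<le> scale_weight s n" for n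
  proof -
    have r: "0 < radius n" by (rule radius_pos)
    let ?b = "exp \<epsilon> * radius n"
    have rb: "radius n < ?b" using r e1 by simp
    \<comment> \<open>the part of the scale within a factor \<open>exp \<epsilon>\<close> of its lower end, which is all of it unless \<open>n = 0\<close>\<close>
    have sub: "{radius n<..?b} \<subseteq> scales n"
    proof (cases n)
      case 0
      then show ?thesis by (auto simp: scales_def)
    next
      case (Suc m)
      have "?b = radius m" unfolding Suc radius_def by (simp add: exp_add[symmetric] algebra_simps)
      then show ?thesis using Suc by (auto simp: scales_def)
    qed
    have "radius n powr (- s) = (2 / \<epsilon>) powr (- s) * exp (- \<epsilon> * real n) powr (- s)"
      unfolding radius_def by (rule powr_mult)
    also have "exp (- \<epsilon> * real n) powr (- s) = exp (\<epsilon> * s * real n)"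
      by (simp add: powr_def mult_ac)
    finally have rs: "radius n powr (- s) = (2 / \<epsilon>) powr (- s) * exp (\<epsilon> * s * real n)" .
    have "?b powr (- s - 1) * (?b - radius n)
        = exp \<epsilon> powr (- s - 1) * (exp \<epsilon> - 1) * (radius n powr (- s - 1) * radius n)"
      by (simp add: powr_mult algebra_simps)
    also have "radius n powr (- s - 1) * radius n = radius n powr (- s)"
      using r by (simp add: powr_diff)
    also have "exp \<epsilon> powr (- s - 1) = exp (\<epsilon> * (- s - 1))"
      by (simp add: powr_def mult_ac)
    finally have eq: "?b powr (- s - 1) * (?b - radius n) = c * exp (\<epsilon> * s * real n)"
      unfolding rs c_def by (simp add: mult_ac)
    have "ennreal (c * exp (\<epsilon> * s * real n)) = ennreal (?b powr (- s - 1)) * emeasure lborel {radius n<..?b}"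
      unfolding eq[symmetric] using rb by (simp add: ennreal_mult)
    also have "\<dots> = (\<integral>\<^sup>+t. ennreal (?b powr (- s - 1)) * indicator {radius n<..?b} t \<partial>lborel)"
      by (subst nn_integral_cmult_indicator) auto
    also have "\<dots> \<le> scale_weight s n"
      unfolding scale_weight_def
    proof (rule nn_integral_mono)
      fix t
      show "ennreal (?b powr (- s - 1)) * indicator {radius n<..?b} t \<le> ennreal (t powr (- s - 1)) * indicator (scales n) t"
      proof (cases "t \<in> {radius n<..?b}")
        case True
        then have "?b powr (- s - 1) \<le> t powr (- s - 1)"
          using r s by (intro powr_mono2') auto
        moreover have "t \<in> scales n" using True sub by blast
        ultimately show ?thesis using True by (simp add: ennreal_leI)
      qed simp
    qed
    finally show ?thesis .
  qed
  ultimately show ?thesis by blast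
qed

text \<open>
  The tree form of the Besov seminorm, to which all estimates below refer.
\<close>

definition discrete_energy :: "real \<Rightarrow> real \<Rightarrow> ((nat \<Rightarrow> 'v) \<Rightarrow> real) \<Rightarrow> ennreal" where
  "discrete_energy \<theta> p u = (\<Sum>n. ennreal (exp (\<epsilon> * (\<theta> * p) * real n)) * scale_energy p u n)"

lemma besov_seminorm_le_discrete:
  assumes p: "0 < p" and \<theta>: "0 < \<theta>"
  shows "\<exists>C\<ge>0. \<forall>u. enn_powr (besov_seminorm d \<mu> \<theta> p u) p \<le> ennreal C * discrete_energy \<theta> p u"
proof -
  define C where "C = (2 / \<epsilon>) powr (- (\<theta> * p)) / (\<theta> * p)"
  have C: "0 \<le> C" using p \<theta> by (simp add: C_def)
  have "enn_powr (besov_seminorm d \<mu> \<theta> p u) p \<le> ennreal C * discrete_energy \<theta> p u" for u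
  proof -
    have "enn_powr (besov_seminorm d \<mu> \<theta> p u) p
        \<le> (\<Sum>n. ennreal C * (ennreal (exp (\<epsilon> * (\<theta> * p) * real n)) * scale_energy p u n))"
      unfolding besov_seminorm_eq[OF p]
    proof (rule suminf_le)
      fix n
      have "scale_energy p u n * scale_weight (\<theta> * p) n
          \<le> scale_energy p u n * ennreal (C * exp (\<epsilon> * (\<theta> * p) * real n))"
        unfolding C_def by (intro mult_left_mono scale_weight_le) (use p \<theta> in auto)
      also have "\<dots> = ennreal C * (ennreal (exp (\<epsilon> * (\<theta> * p) * real n)) * scale_energy p u n)"
        using C by (simp add: ennreal_mult mult_ac)
      finally show "scale_energy p u n * scale_weight (\<theta> * p) n
          \<le> ennreal C * (ennreal (exp (\<epsilon> * (\<theta> * p) * real n)) * scale_energy p u n)" .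
    qed auto
    then show ?thesis by (simp add: discrete_energy_def)
  qed
  then show ?thesis using C by blast
qed

lemma discrete_le_besov_seminorm:
  assumes p: "0 < p" and \<theta>: "0 < \<theta>"
  shows "\<exists>C\<ge>0. \<forall>u. discrete_energy \<theta> p u \<le> ennreal C * enn_powr (besov_seminorm d \<mu> \<theta> p u) p"
proof -
  obtain c where c: "0 < c" "\<And>n. ennreal (c * exp (\<epsilon> * (\<theta> * p) * real n)) \<le> scale_weight (\<theta> * p) n"
    using scale_weight_ge[of "\<theta> * p"] p \<theta> by auto
  have "discrete_energy \<theta> p u \<le> ennreal (1 / c) * enn_powr (besov_seminorm d \<mu> \<theta> p u) p" for u
  proof -
    have "discrete_energy \<theta> p u \<le> (\<Sum>n. ennreal (1 / c) * (scale_energy p u n * scale_weight (\<theta> * p) n))"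
      unfolding discrete_energy_def
    proof (rule suminf_le)
      fix n
      have "ennreal (exp (\<epsilon> * (\<theta> * p) * real n)) * scale_energy p u n
          = ennreal (1 / c) * (scale_energy p u n * ennreal (c * exp (\<epsilon> * (\<theta> * p) * real n)))"
      proof -
        have "ennreal (exp (\<epsilon> * (\<theta> * p) * real n)) = ennreal (1 / c) * ennreal (c * exp (\<epsilon> * (\<theta> * p) * real n))"
          using c(1) by (simp flip: ennreal_mult)
        then show ?thesis by (simp add: mult_ac)
      qed
      also have "\<dots> \<le> ennreal (1 / c) * (scale_energy p u n * scale_weight (\<theta> * p) n)"
        by (intro mult_left_mono c(2)) auto
      finally show "ennreal (exp (\<epsilon> * (\<theta> * p) * real n)) * scale_energy p u n
          \<le> ennreal (1 / c) * (scale_energy p u n * scale_weight (\<theta> * p) n)" .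
    qed auto
    then show ?thesis unfolding besov_seminorm_eq[OF p] by simp
  qed
  then show ?thesis using c(1) by (intro exI[of _ "1 / c"]) auto
qed


subsection \<open>Averages over cells\<close>

definition average :: "((nat \<Rightarrow> 'v) \<Rightarrow> real) \<Rightarrow> nat \<Rightarrow> (nat \<Rightarrow> 'v) \<Rightarrow> real" where
  "average u n x = real K ^ n * (\<integral>y. indicator (cell M n x) y * u y \<partial>\<mu>)"

lemma average_cong_cell: "y \<in> cell M n x \<Longrightarrow> average u n y = average u n x"
  by (simp add: average_def cell_eq)

lemma integrable_cell:
  fixes u :: "(nat \<Rightarrow> 'v) \<Rightarrow> real"
  shows "x \<in> M \<Longrightarrow> integrable \<mu> u \<Longrightarrow> integrable \<mu> (\<lambda>y. indicator (cell M n x) y * u y)"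
  using integrable_mult_indicator[OF cell_sets, of x u] by simp

lemma average_add:
  assumes "x \<in> M" "integrable \<mu> u" "integrable \<mu> v"
  shows "average (\<lambda>y. u y + v y) n x = average u n x + average v n x"
  using integrable_cell[OF assms(1,2), of n] integrable_cell[OF assms(1,3), of n]
  by (simp add: average_def distrib_left)

lemma average_cmult: "average (\<lambda>y. c * u y) n x = c * average u n x"
  unfolding average_def by (simp add: mult.left_commute[of _ c])

lemma average_const:
  assumes x: "x \<in> M"
  shows "average (\<lambda>_. c) n x = c"
proof -
  have "measure \<mu> (cell M n x) = (1 / real K) ^ n"
    using emeasure_cell[OF x, of n] by (simp add: measure_def)
  then show ?thesis using two_le_K cell_sets[OF x, of n] by (simp add: average_def power_divide)
qed

lemma average_diff_const:
  assumes "x \<in> M" "integrable \<mu> u"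
  shows "average (\<lambda>y. u y - c) n x = average u n x - c"
  using average_add[OF assms(1,2), of "\<lambda>_. - c" n] average_const[OF assms(1), of "- c" n] by simp

lemma powr_average_le:
  assumes p: "1 \<le> p" and v: "integrable \<mu> v" and x: "x \<in> M"
  shows "ennreal (\<bar>average v n x\<bar> powr p)
    \<le> ennreal (real K ^ n) * (\<integral>\<^sup>+y\<in>cell M n x. ennreal (\<bar>v y\<bar> powr p) \<partial>\<mu>)"
proof -
  have "1 / (1 / real K) ^ n = real K ^ n" by (simp add: power_divide)
  then show ?thesis
    using powr_mean_le[OF p v cell_sets[OF x], of "(1 / real K) ^ n" n] emeasure_cell[OF x, of n] two_le_K
    by (simp add: average_def)
qed

lemma average_measurable: "average u n \<in> borel_measurable \<mu>"
proof (rule borel_measurableI)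
  fix S :: "real set"
  have "saturated n (average u n -` S \<inter> M)"
    unfolding saturated_def using average_cong_cell cell_subset by auto
  then show "average u n -` S \<inter> space \<mu> \<in> sets \<mu>" unfolding space_\<mu> by (rule saturated_sets)
qed

lemma pair_cell_sets: "{z \<in> space (\<mu> \<Otimes>\<^sub>M \<mu>). snd z \<in> cell M n (fst z)} \<in> sets (\<mu> \<Otimes>\<^sub>M \<mu>)"
proof -
  have "{z \<in> space (\<mu> \<Otimes>\<^sub>M \<mu>). snd z \<in> cell M n (fst z)} = (\<Union>C\<in>cell M n ` M. C \<times> C)"
    by (auto simp: space_pair_measure space_\<mu> cell_def)
  moreover have "(\<Union>C\<in>cell M n ` M. C \<times> C) \<in> sets (\<mu> \<Otimes>\<^sub>M \<mu>)"
    by (rule sets.finite_UN[OF finite_cells]) (auto intro: cell_sets)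
  ultimately show ?thesis by simp
qed

lemma pair_indicator_measurable:
  "(\<lambda>z. indicator (cell M n (fst z)) (snd z) :: ennreal) \<in> borel_measurable (\<mu> \<Otimes>\<^sub>M \<mu>)"
proof -
  have "(\<lambda>z. indicator {z \<in> space (\<mu> \<Otimes>\<^sub>M \<mu>). snd z \<in> cell M n (fst z)} z :: ennreal) \<in> borel_measurable (\<mu> \<Otimes>\<^sub>M \<mu>)"
    by (rule borel_measurable_indicator[OF pair_cell_sets])
  then show ?thesis
    by (rule measurable_cong[THEN iffD1, rotated]) (simp add: indicator_def)
qed

lemma cell_integral_measurable:
  assumes h: "(\<lambda>z. h (fst z) (snd z) :: ennreal) \<in> borel_measurable (\<mu> \<Otimes>\<^sub>M \<mu>)"
  shows "(\<lambda>x. \<integral>\<^sup>+y\<in>cell M n x. h x y \<partial>\<mu>) \<in> borel_measurable \<mu>"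
proof -
  have "(\<lambda>z. h (fst z) (snd z) * indicator (cell M n (fst z)) (snd z)) \<in> borel_measurable (\<mu> \<Otimes>\<^sub>M \<mu>)"
    by (intro borel_measurable_times_ennreal h pair_indicator_measurable)
  from borel_measurable_nn_integral_fst[OF this] show ?thesis by simp
qed

text \<open>
  After exchanging the integrals, the inner one is the measure of a cell, which cancels the
  normalization.
\<close>

lemma nn_integral_cell_average:
  assumes h: "h \<in> borel_measurable \<mu>"
  shows "(\<integral>\<^sup>+x. ennreal (real K ^ n) * (\<integral>\<^sup>+y\<in>cell M n x. h y \<partial>\<mu>) \<partial>\<mu>) = (\<integral>\<^sup>+y. h y \<partial>\<mu>)"
proof -
  interpret pair_sigma_finite \<mu> \<mu> ..
  have meas: "(\<lambda>(x, y). h y * indicator (cell M n x) y) \<in> borel_measurable (\<mu> \<Otimes>\<^sub>M \<mu>)"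
    unfolding case_prod_unfold
    by (intro borel_measurable_times_ennreal pair_indicator_measurable measurable_compose[OF measurable_snd h])
  have "(\<integral>\<^sup>+x. ennreal (real K ^ n) * (\<integral>\<^sup>+y\<in>cell M n x. h y \<partial>\<mu>) \<partial>\<mu>)
      = ennreal (real K ^ n) * (\<integral>\<^sup>+x. \<integral>\<^sup>+y. h y * indicator (cell M n x) y \<partial>\<mu> \<partial>\<mu>)"
    by (rule nn_integral_cmult, rule cell_integral_measurable, rule measurable_compose[OF measurable_snd h])
  also have "\<dots> = ennreal (real K ^ n) * (\<integral>\<^sup>+y. \<integral>\<^sup>+x. h y * indicator (cell M n x) y \<partial>\<mu> \<partial>\<mu>)"
    using Fubini'[OF meas] by simp
  also have "\<dots> = ennreal (real K ^ n) * (\<integral>\<^sup>+y. h y * ennreal ((1 / real K) ^ n) \<partial>\<mu>)"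
  proof (intro arg_cong2[where f = "(*)"] refl nn_integral_cong)
    fix y assume "y \<in> space \<mu>"
    then have y: "y \<in> M" by (simp add: space_\<mu>)
    have "(\<integral>\<^sup>+x. h y * indicator (cell M n x) y \<partial>\<mu>) = (\<integral>\<^sup>+x. h y * indicator (cell M n y) x \<partial>\<mu>)"
      by (intro nn_integral_cong) (use y in \<open>auto simp: indicator_def cell_def space_\<mu>\<close>)
    also have "\<dots> = h y * ennreal ((1 / real K) ^ n)"
      using cell_sets[OF y] emeasure_cell[OF y, of n] by (simp add: nn_integral_cmult_indicator)
    finally show "(\<integral>\<^sup>+x. h y * indicator (cell M n x) y \<partial>\<mu>) = h y * ennreal ((1 / real K) ^ n)" .
  qed
  also have "\<dots> = ennreal (real K ^ n) * ennreal ((1 / real K) ^ n) * (\<integral>\<^sup>+y. h y \<partial>\<mu>)"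
    using h by (simp add: nn_integral_multc mult_ac)
  also have "ennreal (real K ^ n) * ennreal ((1 / real K) ^ n) = 1"
    using two_le_K by (simp flip: ennreal_mult add: power_divide)
  finally show ?thesis by simp
qed

text \<open>
  Subtracting the average over the larger cell and applying Jensen's inequality twice bounds the
  jump by the double average of \<open>\<bar>u y - u z\<bar>\<^sup>p\<close> over \<open>y\<close> in the smaller and \<open>z\<close> in the larger cell.
  Integrated over all cells this is the energy of the scale.
\<close>

lemma average_step_le:
  assumes p: "1 \<le> p" and u: "integrable \<mu> u"
  shows "(\<integral>\<^sup>+x. ennreal (\<bar>average u (Suc n) x - average u n x\<bar> powr p) \<partial>\<mu>) \<le> scale_energy p u n"
proof -
  have um: "u \<in> borel_measurable \<mu>" using u by simp
  define h where "h y = ennreal (real K ^ n) * (\<integral>\<^sup>+z\<in>cell M n y. ennreal (\<bar>u y - u z\<bar> powr p) \<partial>\<mu>)" for y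
  have "(\<lambda>y. \<integral>\<^sup>+z\<in>cell M n y. ennreal (\<bar>u y - u z\<bar> powr p) \<partial>\<mu>) \<in> borel_measurable \<mu>"
    by (rule cell_integral_measurable) (use um in measurable)
  then have hm: "h \<in> borel_measurable \<mu>" unfolding h_def by measurable
  have "ennreal (\<bar>average u (Suc n) x - average u n x\<bar> powr p)
      \<le> ennreal (real K ^ Suc n) * (\<integral>\<^sup>+y\<in>cell M (Suc n) x. h y \<partial>\<mu>)" if "x \<in> space \<mu>" for x
  proof -
    have x: "x \<in> M" using that by (simp add: space_\<mu>)
    define c where "c = average u n x"
    have "ennreal (\<bar>average u (Suc n) x - c\<bar> powr p) = ennreal (\<bar>average (\<lambda>y. u y - c) (Suc n) x\<bar> powr p)"
      using average_diff_const[OF x u, of c "Suc n"] by simp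
    also have "\<dots> \<le> ennreal (real K ^ Suc n) * (\<integral>\<^sup>+y\<in>cell M (Suc n) x. ennreal (\<bar>u y - c\<bar> powr p) \<partial>\<mu>)"
      by (rule powr_average_le[OF p _ x]) (use u in simp)
    also have "\<dots> \<le> ennreal (real K ^ Suc n) * (\<integral>\<^sup>+y\<in>cell M (Suc n) x. h y \<partial>\<mu>)"
    proof (intro mult_left_mono nn_integral_mono)
      fix y
      show "ennreal (\<bar>u y - c\<bar> powr p) * indicator (cell M (Suc n) x) y \<le> h y * indicator (cell M (Suc n) x) y"
      proof (cases "y \<in> cell M (Suc n) x")
        case True
        then have yc: "y \<in> cell M n x" using cell_antimono[OF x, of n "Suc n"] by auto
        then have y: "y \<in> M" by (simp add: cell_def)
        have "c = average u n y" using average_cong_cell[OF yc] by (simp add: c_def)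
        then have "average (\<lambda>z. u z - u y) n y = c - u y"
          using average_diff_const[OF y u] by simp
        then have "ennreal (\<bar>u y - c\<bar> powr p) = ennreal (\<bar>average (\<lambda>z. u z - u y) n y\<bar> powr p)"
          by (simp add: abs_minus_commute)
        also have "\<dots> \<le> ennreal (real K ^ n) * (\<integral>\<^sup>+z\<in>cell M n y. ennreal (\<bar>u z - u y\<bar> powr p) \<partial>\<mu>)"
          by (rule powr_average_le[OF p _ y]) (use u in simp)
        also have "\<dots> = h y" by (simp add: h_def abs_minus_commute)
        finally show ?thesis using True by simp
      qed simp
    qed simp
    finally show ?thesis unfolding c_def .
  qed
  then have "(\<integral>\<^sup>+x. ennreal (\<bar>average u (Suc n) x - average u n x\<bar> powr p) \<partial>\<mu>)
      \<le> (\<integral>\<^sup>+x. ennreal (real K ^ Suc n) * (\<integral>\<^sup>+y\<in>cell M (Suc n) x. h y \<partial>\<mu>) \<partial>\<mu>)"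
    by (rule nn_integral_mono)
  also have "\<dots> = (\<integral>\<^sup>+y. h y \<partial>\<mu>)" by (rule nn_integral_cell_average[OF hm])
  finally show ?thesis by (simp add: h_def scale_energy_def)
qed

lemma average_tendsto_continuous:
  assumes u: "integrable \<mu> u" and cont: "continuous_map mtopology euclideanreal u" and x: "x \<in> M"
  shows "(\<lambda>n. average u n x) \<longlonglongrightarrow> u x"
proof (rule LIMSEQ_I)
  fix r :: real assume r: "0 < r"
  have "openin mtopology {y \<in> topspace mtopology. u y \<in> ball (u x) (r / 2)}"
    by (rule openin_continuous_map_preimage[OF cont]) simp
  then obtain N where N: "cell M N x \<subseteq> {y \<in> M. u y \<in> ball (u x) (r / 2)}"
    using x r unfolding openin_iff_cells by auto
  have "norm (average u n x - u x) < r" if "N \<le> n" for n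
  proof -
    have "ennreal (\<bar>average (\<lambda>y. u y - u x) n x\<bar> powr 1)
        \<le> ennreal (real K ^ n) * (\<integral>\<^sup>+y\<in>cell M n x. ennreal (\<bar>u y - u x\<bar> powr 1) \<partial>\<mu>)"
      by (rule powr_average_le[OF _ _ x]) (use u in simp_all)
    also have "\<dots> \<le> ennreal (real K ^ n) * (\<integral>\<^sup>+y. ennreal (r / 2) * indicator (cell M n x) y \<partial>\<mu>)"
    proof (intro mult_left_mono nn_integral_mono)
      fix y
      have "\<bar>u y - u x\<bar> \<le> r / 2" if "y \<in> cell M n x"
        using that N cell_antimono[OF x \<open>N \<le> n\<close>] by (auto simp: dist_real_def abs_minus_commute)
      then show "ennreal (\<bar>u y - u x\<bar> powr 1) * indicator (cell M n x) y \<le> ennreal (r / 2) * indicator (cell M n x) y"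
        by (auto simp: indicator_def intro!: ennreal_leI)
    qed simp
    also have "\<dots> = ennreal (real K ^ n) * (ennreal (r / 2) * ennreal ((1 / real K) ^ n))"
      using cell_sets[OF x, of n] emeasure_cell[OF x, of n] by (simp add: nn_integral_cmult_indicator)
    also have "\<dots> = ennreal (r / 2)"
      using two_le_K r by (simp flip: ennreal_mult add: power_divide)
    finally have "\<bar>average u n x - u x\<bar> \<le> r / 2"
      using r average_diff_const[OF x u] by (simp add: ennreal_le_iff)
    then show ?thesis using r by simp
  qed
  then show "\<exists>N. \<forall>n\<ge>N. norm (average u n x - u x) < r" by blast
qed

text \<open>
  The measure is finite and \<open>p \<ge> 1\<close>, so the averages of a Besov function are defined.
\<close>

lemma lp_integrable:
  assumes p: "1 \<le> p" and u: "u \<in> borel_measurable \<mu>" and fin: "lp_norm \<mu> p u < \<infinity>"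
  shows "integrable \<mu> u"
proof -
  have I: "(\<integral>\<^sup>+x. ennreal (\<bar>u x\<bar> powr p) \<partial>\<mu>) < \<infinity>"
    using fin enn_powr_less_top unfolding lp_norm_def by blast
  have "(\<integral>\<^sup>+x. ennreal (norm (u x)) \<partial>\<mu>) \<le> (\<integral>\<^sup>+x. 1 + ennreal (\<bar>u x\<bar> powr p) \<partial>\<mu>)"
  proof (rule nn_integral_mono)
    fix x
    have "\<bar>u x\<bar> \<le> 1 + \<bar>u x\<bar> powr p"
    proof (cases "\<bar>u x\<bar> \<le> 1")
      case False
      then have "\<bar>u x\<bar> powr 1 \<le> \<bar>u x\<bar> powr p" using p by (intro powr_mono) auto
      then show ?thesis using False by simp
    qed (use powr_ge_zero[of "\<bar>u x\<bar>" p] in linarith)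
    then have "ennreal (norm (u x)) \<le> ennreal (1 + \<bar>u x\<bar> powr p)" by (intro ennreal_leI) simp
    then show "ennreal (norm (u x)) \<le> 1 + ennreal (\<bar>u x\<bar> powr p)" by (simp add: ennreal_plus)
  qed
  also have "\<dots> = 1 + (\<integral>\<^sup>+x. ennreal (\<bar>u x\<bar> powr p) \<partial>\<mu>)"
    using u emeasure_space_1 by (simp add: nn_integral_add)
  also have "\<dots> < \<infinity>" using I by (simp add: less_top)
  finally show ?thesis using u by (simp add: integrable_iff_bounded)
qed

end

section \<open>Limits of sequences with controlled increments\<close>

lemma suminf_ennreal_swap:
  fixes g :: "nat \<Rightarrow> nat \<Rightarrow> ennreal"
  shows "(\<Sum>n. \<Sum>m. g n m) = (\<Sum>m. \<Sum>n. g n m)"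
  using nn_integral_suminf[of "\<lambda>m n. g n m" "count_space UNIV"]
  by (simp add: nn_integral_count_space_nat)

text \<open>
  The increments from index \<open>M\<close> on, with the weights that the weighted Jensen inequality produces.
  Values in \<open>ennreal\<close> let the deviation bound hold without a convergence hypothesis: if the sum
  is infinite there is nothing to prove, and otherwise the sequence converges.
\<close>

definition weighted_increments ::
    "(nat \<Rightarrow> real) \<Rightarrow> (nat \<Rightarrow> real) \<Rightarrow> real \<Rightarrow> nat \<Rightarrow> ennreal" where
  "weighted_increments a w p M =
     (\<Sum>m. ennreal (if M \<le> m then w m powr (1 - p) * \<bar>a (Suc m) - a m\<bar> powr p else 0))"

context
  fixes a w :: "nat \<Rightarrow> real" and p W :: real and M :: nat
  assumes p: "1 \<le> p" and w: "\<And>m. M \<le> m \<Longrightarrow> 0 < w m" and W: "\<And>N. sum w {M..<N} \<le> W"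
begin

lemma W_pos: "0 < W"
  using W[of "Suc M"] w[of M] by simp

lemma increments_powr_le:
  "ennreal ((\<Sum>m\<in>{M..<N}. \<bar>a (Suc m) - a m\<bar>) powr p) \<le> ennreal (W powr (p - 1)) * weighted_increments a w p M"
proof -
  let ?t = "\<lambda>m. if M \<le> m then w m powr (1 - p) * \<bar>a (Suc m) - a m\<bar> powr p else 0"
  have "(\<Sum>m\<in>{M..<N}. \<bar>a (Suc m) - a m\<bar>) powr p \<le> W powr (p - 1) * (\<Sum>m\<in>{M..<N}. w m powr (1 - p) * \<bar>a (Suc m) - a m\<bar> powr p)"
    by (rule powr_sum_le_weighted[OF p _ _ W]) (use w in auto)
  also have "(\<Sum>m\<in>{M..<N}. w m powr (1 - p) * \<bar>a (Suc m) - a m\<bar> powr p) = (\<Sum>m\<in>{M..<N}. ?t m)"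
    by (intro sum.cong) auto
  finally have "ennreal ((\<Sum>m\<in>{M..<N}. \<bar>a (Suc m) - a m\<bar>) powr p) \<le> ennreal (W powr (p - 1) * (\<Sum>m\<in>{M..<N}. ?t m))"
    by (rule ennreal_leI)
  also have "\<dots> = ennreal (W powr (p - 1)) * (\<Sum>m\<in>{M..<N}. ennreal (?t m))"
    by (subst ennreal_mult) (auto intro!: sum_nonneg simp: sum_ennreal)
  also have "\<dots> \<le> ennreal (W powr (p - 1)) * weighted_increments a w p M"
    unfolding weighted_increments_def by (intro mult_left_mono sum_le_suminf) auto
  finally show ?thesis .
qed

lemma convergent_if_weighted_increments:
  assumes fin: "weighted_increments a w p M < \<infinity>"
  shows "convergent a"
proof -
  obtain s where s: "0 \<le> s" "weighted_increments a w p M = ennreal s"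
    using fin by (cases "weighted_increments a w p M") auto
  define B where "B = (W powr (p - 1) * s) powr (1 / p)"
  let ?b = "\<lambda>m. \<bar>a (Suc m) - a m\<bar>"
  have bound: "(\<Sum>m\<in>{M..<N}. ?b m) \<le> B" for N
  proof -
    have S0: "0 \<le> (\<Sum>m\<in>{M..<N}. ?b m)" by (simp add: sum_nonneg)
    have "ennreal ((\<Sum>m\<in>{M..<N}. ?b m) powr p) \<le> ennreal (W powr (p - 1) * s)"
      using increments_powr_le[of N] s by (simp add: ennreal_mult)
    then have "(\<Sum>m\<in>{M..<N}. ?b m) powr p \<le> W powr (p - 1) * s"
      using s by (subst (asm) ennreal_le_iff) auto
    then have "((\<Sum>m\<in>{M..<N}. ?b m) powr p) powr (1 / p) \<le> B"
      unfolding B_def using p by (intro powr_mono2) auto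
    then show ?thesis using p S0 by (simp add: powr_powr)
  qed
  have "summable (\<lambda>m. ?b (m + M))"
  proof (rule summableI_nonneg_bounded)
    show "(\<Sum>m<n. ?b (m + M)) \<le> B" for n
      using bound[of "n + M"] sum.shift_bounds_nat_ivl[of ?b 0 M n]
      by (simp add: atLeast0LessThan)
  qed auto
  then have "summable ?b" using summable_iff_shift[of ?b M] by simp
  then have "summable (\<lambda>m. a (Suc m) - a m)" by (rule summable_rabs_cancel)
  then have "(\<lambda>n. \<Sum>m<n. a (Suc m) - a m) \<longlonglongrightarrow> (\<Sum>m. a (Suc m) - a m)" by (rule summable_LIMSEQ)
  then have "(\<lambda>n. a n - a 0) \<longlonglongrightarrow> (\<Sum>m. a (Suc m) - a m)" by (simp add: sum_lessThan_telescope)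
  then have "(\<lambda>n. a n - a 0 + a 0) \<longlonglongrightarrow> (\<Sum>m. a (Suc m) - a m) + a 0" by (intro tendsto_intros)
  then show ?thesis unfolding convergent_def by auto
qed

lemma limit_deviation:
  "ennreal (\<bar>lim a - a M\<bar> powr p) \<le> ennreal (W powr (p - 1)) * weighted_increments a w p M"
proof (cases "weighted_increments a w p M < \<infinity>")
  case False
  then have "weighted_increments a w p M = \<infinity>" by (metis infinity_ennreal_def top.not_eq_extremum)
  then show ?thesis using W_pos by (simp add: ennreal_mult_top)
next
  case True
  have "a \<longlonglongrightarrow> lim a" using convergent_if_weighted_increments[OF True] by (simp add: convergent_LIMSEQ_iff)
  then have "(\<lambda>N. ennreal (\<bar>a N - a M\<bar> powr p)) \<longlonglongrightarrow> ennreal (\<bar>lim a - a M\<bar> powr p)"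
    using p by (intro tendsto_ennrealI tendsto_powr' tendsto_intros) auto
  moreover have "ennreal (\<bar>a N - a M\<bar> powr p) \<le> ennreal (W powr (p - 1)) * weighted_increments a w p M"
    if "M \<le> N" for N
  proof -
    have "\<bar>a N - a M\<bar> = \<bar>\<Sum>m\<in>{M..<N}. a (Suc m) - a m\<bar>"
      using sum_Suc_diff'[OF that, of a] by simp
    also have "\<dots> \<le> (\<Sum>m\<in>{M..<N}. \<bar>a (Suc m) - a m\<bar>)" by (rule sum_abs)
    finally have "ennreal (\<bar>a N - a M\<bar> powr p) \<le> ennreal ((\<Sum>m\<in>{M..<N}. \<bar>a (Suc m) - a m\<bar>) powr p)"
      using p by (intro ennreal_leI powr_mono2) auto
    then show ?thesis using increments_powr_le order_trans by blast
  qed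
  ultimately show ?thesis using LIMSEQ_le_const2 by blast
qed

end

text \<open>
  The core of a Hardy inequality: an increment that is noticed by all levels \<open>n < c\<close> has weights that
  decay geometrically below \<open>c\<close>, so up to a constant only the level \<open>c\<close> counts. The exponent
  combines to \<open>\<beta> * p * c - \<beta> * (c - n)\<close>.
\<close>

lemma geometric_levels_le:
  fixes \<beta> p x :: real
  assumes \<beta>: "0 < \<beta>" and x: "0 \<le> x"
  shows "(\<Sum>n. ennreal (exp (\<beta> * p * real n)) *
      ennreal (if n < c then exp (\<beta> * (p - 1) * (real c - real n)) * x else 0))
    \<le> ennreal (1 / (1 - exp (- \<beta>))) * ennreal (exp (\<beta> * p * real c) * x)"
proof -
  let ?q = "exp (- \<beta>)"
  have q: "0 < ?q" "?q < 1" using \<beta> by auto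
  have "(\<Sum>n. ennreal (exp (\<beta> * p * real n)) *
      ennreal (if n < c then exp (\<beta> * (p - 1) * (real c - real n)) * x else 0))
    = (\<Sum>n<c. ennreal (exp (\<beta> * p * real n)) *
      ennreal (if n < c then exp (\<beta> * (p - 1) * (real c - real n)) * x else 0))"
    by (rule suminf_finite) auto
  also have "\<dots> = (\<Sum>n<c. ennreal (exp (\<beta> * p * real c) * x * ?q ^ (c - n)))"
  proof (rule sum.cong[OF refl])
    fix n assume n: "n \<in> {..<c}"
    have "exp (\<beta> * p * real n) * (exp (\<beta> * (p - 1) * (real c - real n)) * x)
        = x * exp (\<beta> * p * real n + \<beta> * (p - 1) * (real c - real n))"
      by (simp add: exp_add)
    also have "\<beta> * p * real n + \<beta> * (p - 1) * (real c - real n) = \<beta> * p * real c + real (c - n) * (- \<beta>)"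
      using n by (simp add: of_nat_diff algebra_simps)
    also have "x * exp (\<beta> * p * real c + real (c - n) * (- \<beta>)) = exp (\<beta> * p * real c) * x * ?q ^ (c - n)"
      by (simp only: exp_add exp_of_nat_mult) simp
    finally show "ennreal (exp (\<beta> * p * real n)) *
      ennreal (if n < c then exp (\<beta> * (p - 1) * (real c - real n)) * x else 0)
      = ennreal (exp (\<beta> * p * real c) * x * ?q ^ (c - n))"
      using n x by (simp flip: ennreal_mult)
  qed
  also have "\<dots> = ennreal (exp (\<beta> * p * real c) * x * (\<Sum>n<c. ?q ^ (c - n)))"
    using x by (simp add: sum_distrib_left)
  also have "\<dots> \<le> ennreal (exp (\<beta> * p * real c) * x * (1 / (1 - ?q)))"
  proof (intro ennreal_leI mult_left_mono)
    have "(\<Sum>n<c. ?q ^ (c - n)) = (\<Sum>n<c. ?q ^ Suc n)"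
      by (subst sum.nat_diff_reindex[symmetric]) (intro sum.cong refl arg_cong[where f = "\<lambda>k. ?q ^ k"], auto)
    also have "\<dots> \<le> (\<Sum>n<c. ?q ^ n)"
      using q by (intro sum_mono) (simp add: mult_left_le_one_le)
    also have "\<dots> \<le> (\<Sum>n. ?q ^ n)" using q by (intro sum_le_suminf summable_geometric) auto
    also have "\<dots> = 1 / (1 - ?q)" using q by (simp add: suminf_geometric)
    finally show "(\<Sum>n<c. ?q ^ (c - n)) \<le> 1 / (1 - ?q)" .
  qed (use x in simp)
  also have "\<dots> = ennreal (1 / (1 - ?q)) * ennreal (exp (\<beta> * p * real c) * x)"
    using x q by (simp flip: ennreal_mult add: mult_ac)
  finally show ?thesis .
qed

lemma powr_add_le:
  fixes a b p :: real
  assumes "0 \<le> a" "0 \<le> b" "0 \<le> p"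
  shows "(a + b) powr p \<le> 2 powr p * (a powr p + b powr p)"
proof -
  have "(a + b) powr p \<le> (2 * max a b) powr p" using assms by (intro powr_mono2) auto
  also have "\<dots> = 2 powr p * max a b powr p" by (rule powr_mult)
  also have "\<dots> \<le> 2 powr p * (a powr p + b powr p)"
    by (intro mult_left_mono) (auto simp: max_def)
  finally show ?thesis .
qed


section \<open>Quasisymmetric maps between rays\<close>

text \<open>
  Quasisymmetry in terms of levels: if \<open>x, y\<close> agree up to level \<open>n\<close> while \<open>x, z\<close> are separated after
  level \<open>k\<close>, then the ratio of the distances of \<open>x\<close> to \<open>y\<close> and to \<open>z\<close> is at most
  \<open>exp (\<epsilon>X * (k - n))\<close>, and the hypotheses on the images bound the image ratio from below by
  \<open>exp (\<epsilon>Y * (j - i))\<close>. The constant \<open>L\<close> is the logarithm of the constant of the distortion function.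
\<close>

locale quasisymmetric_rays =
  X: uniform_rays MX KX \<epsilon>X \<mu> + Y: uniform_rays MY KY \<epsilon>Y \<nu>
  for MX :: "(nat \<Rightarrow> 'v) set" and KX \<epsilon>X \<mu> and MY :: "(nat \<Rightarrow> 'w) set" and KY \<epsilon>Y \<nu> +
  fixes f :: "(nat \<Rightarrow> 'v) \<Rightarrow> (nat \<Rightarrow> 'w)" and L \<alpha>\<^sub>1 \<alpha>\<^sub>2 :: real
  assumes image: "f ` MX = MY" and inj: "inj_on f MX"
    and continuous: "x \<in> MX \<Longrightarrow> \<exists>n. f ` cell MX n x \<subseteq> cell MY m (f x)"
    and \<alpha>\<^sub>1_pos: "0 < \<alpha>\<^sub>1" and \<alpha>\<^sub>2_pos: "0 < \<alpha>\<^sub>2"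
    and distortion_near: "x \<in> MX \<Longrightarrow> y \<in> MX \<Longrightarrow> z \<in> MX \<Longrightarrow> x n = y n \<Longrightarrow> x (Suc k) \<noteq> z (Suc k) \<Longrightarrow>
      f x (Suc i) \<noteq> f y (Suc i) \<Longrightarrow> f x j = f z j \<Longrightarrow> k \<le> n \<Longrightarrow>
      \<epsilon>Y * (real j - real i) \<le> L + \<alpha>\<^sub>1 * \<epsilon>X * (real k - real n)"
    and distortion_far: "x \<in> MX \<Longrightarrow> y \<in> MX \<Longrightarrow> z \<in> MX \<Longrightarrow> x n = y n \<Longrightarrow> x (Suc k) \<noteq> z (Suc k) \<Longrightarrow>
      f x (Suc i) \<noteq> f y (Suc i) \<Longrightarrow> f x j = f z j \<Longrightarrow> n \<le> k \<Longrightarrow>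
      \<epsilon>Y * (real j - real i) \<le> L + \<alpha>\<^sub>2 * \<epsilon>X * (real k - real n)"
begin

lemma f_in: "x \<in> MX \<Longrightarrow> f x \<in> MY"
  using image by blast

text \<open>
  The level in the source that corresponds to level \<open>m\<close> in the target along the ray \<open>x\<close>. Taking the
  first such level makes it constant near \<open>x\<close>, hence measurable.
\<close>

definition entry :: "nat \<Rightarrow> (nat \<Rightarrow> 'v) \<Rightarrow> nat" where
  "entry m x = (LEAST n. f ` cell MX n x \<subseteq> cell MY m (f x))"

lemma entry_le_iff:
  assumes x: "x \<in> MX"
  shows "entry m x \<le> n \<longleftrightarrow> f ` cell MX n x \<subseteq> cell MY m (f x)"
proof
  assume "entry m x \<le> n"
  have "f ` cell MX (entry m x) x \<subseteq> cell MY m (f x)"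
    unfolding entry_def by (rule LeastI_ex) (rule continuous[OF x])
  then show "f ` cell MX n x \<subseteq> cell MY m (f x)"
    using X.cell_antimono[OF x \<open>entry m x \<le> n\<close>] by blast
next
  assume "f ` cell MX n x \<subseteq> cell MY m (f x)"
  then show "entry m x \<le> n" unfolding entry_def by (rule Least_le)
qed

lemma entry_le_cell:
  assumes x: "x \<in> MX" and y: "y \<in> cell MX n x" and le: "entry m x \<le> n"
  shows "f y \<in> cell MY m (f x)"
  using entry_le_iff[OF x] le y by blast

lemma entry_le_cong:
  assumes x: "x \<in> MX" and y: "y \<in> cell MX n x"
  shows "entry m y \<le> n \<longleftrightarrow> entry m x \<le> n"
proof -
  have *: "entry m b \<le> n" if a: "a \<in> MX" and b: "b \<in> cell MX n a" and le: "entry m a \<le> n" for a b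
  proof -
    have "cell MY m (f b) = cell MY m (f a)" by (rule Y.cell_eq[OF entry_le_cell[OF a b le]])
    then have "f ` cell MX n b \<subseteq> cell MY m (f b)"
      using entry_le_iff[OF a] le X.cell_eq[OF b] by simp
    then show ?thesis using entry_le_iff b X.cell_subset by blast
  qed
  have "y \<in> MX" using y X.cell_subset by blast
  then show ?thesis using *[OF x y] *[OF _ X.cell_sym[OF x y]] by blast
qed

lemma entry_eq_cell:
  assumes x: "x \<in> MX" and y: "y \<in> cell MX (entry m x) x"
  shows "entry m y = entry m x"
proof (rule antisym)
  show "entry m y \<le> entry m x" using entry_le_cong[OF x y] by blast
  have "y \<in> cell MX (entry m y) x"
    using X.cell_antimono[OF x \<open>entry m y \<le> entry m x\<close>] y by blast
  then show "entry m x \<le> entry m y" using entry_le_cong[OF x] by blast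
qed

lemma entry_mono:
  assumes x: "x \<in> MX" and "m \<le> m'"
  shows "entry m x \<le> entry m' x"
proof -
  have "f ` cell MX (entry m' x) x \<subseteq> cell MY m' (f x)" using entry_le_iff[OF x] by blast
  also have "\<dots> \<subseteq> cell MY m (f x)" by (rule Y.cell_antimono[OF f_in[OF x] \<open>m \<le> m'\<close>])
  finally show ?thesis using entry_le_iff[OF x] by blast
qed

lemma entry_pos:
  assumes x: "x \<in> MX"
  shows "0 < entry (Suc m) x"
proof (rule ccontr)
  assume "\<not> 0 < entry (Suc m) x"
  then have "MY \<subseteq> cell MY (Suc m) (f x)"
    using entry_le_iff[OF x, of "Suc m" 0] X.cell_zero[OF x] image by simp
  moreover obtain y where "y \<in> cell MY 0 (f x)" "y (Suc 0) \<noteq> f x (Suc 0)"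
    using Y.obtain_sibling[OF f_in[OF x]] .
  ultimately show False
    using Y.cell_antimono[OF f_in[OF x], of "Suc 0" "Suc m"] by (auto simp: cell_def)
qed

text \<open>
  Before the entry level some nearby ray is mapped out of the cell. Such a ray, and the one from
  \<open>obtain_entering\<close> that separates only just after the entry level, are the test points for the
  distortion bounds.
\<close>

lemma obtain_leaving:
  assumes x: "x \<in> MX" and n: "n < entry (Suc m) x"
  obtains y where "y \<in> MX" "x n = y n" "f x (Suc m) \<noteq> f y (Suc m)"
proof -
  obtain y where "y \<in> cell MX n x" "f y \<notin> cell MY (Suc m) (f x)"
    using entry_le_iff[OF x, of "Suc m" n] n by auto
  then show thesis using that f_in by (auto simp: cell_def)
qed

lemma obtain_entering:
  assumes x: "x \<in> MX"
  obtains z where "z \<in> MX" "x (Suc (entry m x)) \<noteq> z (Suc (entry m x))" "f x m = f z m"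
proof -
  obtain z where z: "z \<in> cell MX (entry m x) x" "z (Suc (entry m x)) \<noteq> x (Suc (entry m x))"
    using X.obtain_sibling[OF x] .
  then have "z \<in> MX" "f z \<in> cell MY m (f x)" using entry_le_cell[OF x z(1)] by (auto simp: cell_def)
  then show thesis using that z(2) by (auto simp: cell_def)
qed

text \<open>
  Compared with a ray that separates from \<open>x\<close> at the root, a ray leaving just before the entry
  level is close to \<open>x\<close>, hence its image is close to \<open>f x\<close>.
\<close>

lemma entry_upper:
  assumes x: "x \<in> MX"
  shows "\<alpha>\<^sub>1 * \<epsilon>X * real (entry (Suc m) x) \<le> L + \<epsilon>Y * real m + \<alpha>\<^sub>1 * \<epsilon>X"
proof -
  obtain n where n: "entry (Suc m) x = Suc n" using entry_pos[OF x] by (metis gr0_implies_Suc)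
  obtain y where y: "y \<in> MX" "x n = y n" "f x (Suc m) \<noteq> f y (Suc m)"
    using obtain_leaving[OF x, of n m] n by auto
  obtain z where z: "z \<in> cell MX 0 x" "z (Suc 0) \<noteq> x (Suc 0)" using X.obtain_sibling[OF x] .
  have zM: "z \<in> MX" using z by (simp add: cell_def)
  have "f x 0 = f z 0" using Y.same_start f_in x zM by blast
  then have "\<epsilon>Y * (real 0 - real m) \<le> L + \<alpha>\<^sub>1 * \<epsilon>X * (real 0 - real n)"
    using z(2) by (intro distortion_near[OF x y(1) zM y(2) _ y(3)]) auto
  then show ?thesis unfolding n by (simp add: algebra_simps)
qed

text \<open>
  Passing from level \<open>m\<close> to level \<open>m'\<close> in the target takes at least a proportional number of levels
  in the source, since a far image ratio needs a far ratio.
\<close>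

lemma entry_gap:
  assumes x: "x \<in> MX" and m: "m \<le> m'"
  shows "\<epsilon>Y * (real m' + 1 - real m) \<le> L + \<alpha>\<^sub>2 * \<epsilon>X * (real (entry (Suc m') x) - real (entry (Suc m) x) + 1)"
proof -
  obtain n where n: "entry (Suc m) x = Suc n" using entry_pos[OF x] by (metis gr0_implies_Suc)
  obtain y where y: "y \<in> MX" "x n = y n" "f x (Suc m) \<noteq> f y (Suc m)"
    using obtain_leaving[OF x, of n m] n by auto
  obtain z where z: "z \<in> MX" "x (Suc (entry (Suc m') x)) \<noteq> z (Suc (entry (Suc m') x))" "f x (Suc m') = f z (Suc m')"
    using obtain_entering[OF x] .
  have "n \<le> entry (Suc m') x" using entry_mono[OF x, of "Suc m" "Suc m'"] m n by simp
  then have "\<epsilon>Y * (real (Suc m') - real m) \<le> L + \<alpha>\<^sub>2 * \<epsilon>X * (real (entry (Suc m') x) - real n)"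
    by (rule distortion_far[OF x y(1) z(1) y(2) z(2) y(3) z(3)])
  then show ?thesis unfolding n by (simp add: algebra_simps)
qed

text \<open>
  Here the test point \<open>y\<close> is a ray whose image separates from \<open>f x\<close> at the root.
\<close>

lemma entry_lower:
  assumes x: "x \<in> MX"
  shows "\<epsilon>Y * (real m + 1) \<le> L + \<alpha>\<^sub>2 * \<epsilon>X * real (entry (Suc m) x)"
proof -
  obtain y where y: "y \<in> MX" "x 0 = y 0" "f x (Suc 0) \<noteq> f y (Suc 0)"
    using obtain_leaving[OF x entry_pos[OF x, of 0]] .
  obtain z where z: "z \<in> MX" "x (Suc (entry (Suc m) x)) \<noteq> z (Suc (entry (Suc m) x))" "f x (Suc m) = f z (Suc m)"
    using obtain_entering[OF x] .
  show ?thesis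
    using distortion_far[OF x y(1) z(1) y(2) z(2) y(3) z(3)] by (simp add: algebra_simps)
qed

text \<open>
  A ray mapped into the cell of \<open>f x\<close> cannot be much farther from \<open>x\<close> than a ray \<open>y\<close> that leaves the
  cell just before the entry level, for the image of \<open>y\<close> is the farther one.
\<close>

lemma preimage_near:
  assumes x: "x \<in> MX" and x': "x' \<in> MX" "f x' \<in> cell MY (Suc m) (f x)"
    and m0: "L < \<alpha>\<^sub>1 * \<epsilon>X * real m0"
  shows "x' \<in> cell MX (entry (Suc m) x - Suc m0) x"
proof (rule ccontr)
  assume no: "x' \<notin> cell MX (entry (Suc m) x - Suc m0) x"
  obtain n where n: "entry (Suc m) x = Suc n" using entry_pos[OF x] by (metis gr0_implies_Suc)
  obtain k where k: "n - m0 = Suc k"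
  proof (cases "n - m0")
    case 0
    then show ?thesis using no n x'(1) X.cell_zero[OF x] by simp
  qed
  then have sep: "x (Suc k) \<noteq> x' (Suc k)" using no n x'(1) by (auto simp: cell_def)
  obtain y where y: "y \<in> MX" "x n = y n" "f x (Suc m) \<noteq> f y (Suc m)"
    using obtain_leaving[OF x, of n m] n by auto
  have "f x (Suc m) = f x' (Suc m)" using x'(2) by (simp add: cell_def)
  then have "\<epsilon>Y * (real (Suc m) - real m) \<le> L + \<alpha>\<^sub>1 * \<epsilon>X * (real k - real n)"
    using k by (intro distortion_near[OF x y(1) x'(1) y(2) sep y(3)]) auto
  moreover have "\<alpha>\<^sub>1 * \<epsilon>X * (real k - real n) \<le> \<alpha>\<^sub>1 * \<epsilon>X * (- real m0)"
    using k \<alpha>\<^sub>1_pos X.\<epsilon>_pos by (intro mult_left_mono) auto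
  ultimately show False using m0 Y.\<epsilon>_pos by (simp add: algebra_simps)
qed


subsection \<open>Measurability\<close>

lemma f_measurable: "f \<in> measurable \<mu> \<nu>"
proof (rule measurable_sigma_sets[OF Y.sets_\<mu> Y.cells_subset_Pow])
  show "f \<in> space \<mu> \<rightarrow> MY" using f_in X.space_\<mu> by auto
  fix C assume "C \<in> Y.cells"
  then obtain m \<xi> where C: "C = cell MY m \<xi>" by (auto simp: Y.cells_def)
  have "openin X.mtopology (f -` C \<inter> MX)"
    unfolding X.openin_iff_cells
  proof (intro conjI ballI)
    fix x assume x: "x \<in> f -` C \<inter> MX"
    then have "cell MY m (f x) = C" unfolding C using Y.cell_eq by blast
    then have "cell MX (entry m x) x \<subseteq> f -` C \<inter> MX"
      using entry_le_cell[of x _ "entry m x" m] x X.cell_subset by blast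
    then show "\<exists>n. cell MX n x \<subseteq> f -` C \<inter> MX" by blast
  qed blast
  then have "f -` C \<inter> MX \<in> sigma_sets MX {U. openin X.mtopology U}" by (intro sigma_sets.Basic) simp
  then show "f -` C \<inter> space \<mu> \<in> sets \<mu>" unfolding X.sigma_open X.sets_\<mu> X.space_\<mu> .
qed

text \<open>
  Each level set of the entry level depends only on finitely many levels of the ray.
\<close>

lemma entry_measurable: "entry m \<in> measurable \<mu> (count_space UNIV)"
proof -
  have "entry m -` {n} \<inter> space \<mu> \<in> sets \<mu>" for n
  proof -
    have "X.saturated n (entry m -` {n} \<inter> MX)"
      unfolding X.saturated_def using entry_eq_cell X.cell_subset by blast
    then show ?thesis using X.saturated_sets X.space_\<mu> by simp
  qed
  then show ?thesis by (simp add: measurable_count_space_eq_countable)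
qed

lemma average_f_measurable: "(\<lambda>x. Y.average u m (f x)) \<in> borel_measurable \<mu>"
  by (rule measurable_compose[OF f_measurable Y.average_measurable])


subsection \<open>Transport of weights\<close>

text \<open>
  A function that is constant on the cells of level \<open>n\<close> does not see how the image measure is
  distributed inside them, so comparing the masses of whole preimages suffices.
\<close>

lemma transfer_cells:
  assumes k: "k \<in> borel_measurable \<mu>" and b: "b \<in> borel_measurable \<nu>"
    and const: "\<And>\<xi> \<xi>'. \<xi> \<in> MY \<Longrightarrow> \<xi>' \<in> cell MY n \<xi> \<Longrightarrow> b \<xi>' = b \<xi>"
    and C: "\<And>\<xi>. \<xi> \<in> MY \<Longrightarrow> (\<integral>\<^sup>+x\<in>f -` cell MY n \<xi> \<inter> MX. k x \<partial>\<mu>) \<le> C * emeasure \<nu> (cell MY n \<xi>)"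
  shows "(\<integral>\<^sup>+x. k x * b (f x) \<partial>\<mu>) \<le> C * (\<integral>\<^sup>+\<xi>. b \<xi> \<partial>\<nu>)"
proof -
  let ?P = "cell MY n ` MY"
  define r where "r D = (SOME \<xi>. \<xi> \<in> MY \<and> D = cell MY n \<xi>)" for D
  have r: "r D \<in> MY" "D = cell MY n (r D)" if "D \<in> ?P" for D
  proof -
    have "\<exists>\<xi>. \<xi> \<in> MY \<and> D = cell MY n \<xi>" using that by blast
    then have "r D \<in> MY \<and> D = cell MY n (r D)" unfolding r_def by (rule someI_ex)
    then show "r D \<in> MY" "D = cell MY n (r D)" by auto
  qed
  have fin: "finite ?P" by (rule Y.finite_cells)
  have split: "g \<xi> * b \<xi> = (\<Sum>D\<in>?P. b (r D) * (g \<xi> * indicator D \<xi>))" if \<xi>: "\<xi> \<in> MY" for \<xi> g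
  proof -
    let ?D = "cell MY n \<xi>"
    have D: "?D \<in> ?P" using \<xi> by blast
    have "b (r ?D) = b \<xi>" 
    proof (rule sym, rule const)
      show "r ?D \<in> MY" by (rule r(1)[OF D])
      show "\<xi> \<in> cell MY n (r ?D)" using r(2)[OF D] Y.mem_cell_self[OF \<xi>] by simp
    qed
    moreover have "indicator D' \<xi> = (0::ennreal)" if "D' \<in> ?P" "D' \<noteq> ?D" for D'
      using that Y.cell_eq[of \<xi> n] by (auto simp: indicator_def)
    ultimately show ?thesis
      using D fin Y.mem_cell_self[OF \<xi>, of n] by (subst sum.remove[OF fin D]) (auto simp: mult.commute)
  qed
  have Dsets: "f -` D \<inter> MX \<in> sets \<mu>" if "D \<in> ?P" for D
    using measurable_sets[OF f_measurable, of D] that Y.cell_sets X.space_\<mu> by auto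
  have "(\<integral>\<^sup>+x. k x * b (f x) \<partial>\<mu>) = (\<integral>\<^sup>+x. (\<Sum>D\<in>?P. b (r D) * (k x * indicator (f -` D \<inter> MX) x)) \<partial>\<mu>)"
  proof (rule nn_integral_cong)
    fix x assume "x \<in> space \<mu>"
    then have x: "x \<in> MX" by (simp add: X.space_\<mu>)
    have "indicator D (f x) = (indicator (f -` D \<inter> MX) x :: ennreal)" for D using x by (simp add: indicator_def)
    then show "k x * b (f x) = (\<Sum>D\<in>?P. b (r D) * (k x * indicator (f -` D \<inter> MX) x))"
      using split[OF f_in[OF x], of "\<lambda>_. k x"] by simp
  qed
  also have "\<dots> = (\<Sum>D\<in>?P. b (r D) * (\<integral>\<^sup>+x\<in>f -` D \<inter> MX. k x \<partial>\<mu>))"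
    using k Dsets by (subst nn_integral_sum) (auto intro!: sum.cong nn_integral_cmult)
  also have "\<dots> \<le> (\<Sum>D\<in>?P. b (r D) * (C * emeasure \<nu> D))"
    using C r by (intro sum_mono mult_left_mono) (metis, simp)
  also have "\<dots> = C * (\<Sum>D\<in>?P. b (r D) * (\<integral>\<^sup>+\<xi>. 1 * indicator D \<xi> \<partial>\<nu>))"
    using Y.cell_sets by (subst sum_distrib_left) (auto intro!: sum.cong simp: mult_ac)
  also have "(\<Sum>D\<in>?P. b (r D) * (\<integral>\<^sup>+\<xi>. 1 * indicator D \<xi> \<partial>\<nu>))
      = (\<integral>\<^sup>+\<xi>. (\<Sum>D\<in>?P. b (r D) * (1 * indicator D \<xi>)) \<partial>\<nu>)"
    using Y.cell_sets by (subst nn_integral_sum) (auto intro!: sum.cong nn_integral_cmult[symmetric])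
  also have "\<dots> = (\<integral>\<^sup>+\<xi>. b \<xi> \<partial>\<nu>)"
    by (intro nn_integral_cong) (use split[of _ "\<lambda>_. 1"] in \<open>simp add: Y.space_\<mu>\<close>)
  finally show ?thesis .
qed

end

context quasisymmetric_rays
begin

text \<open>
  For \<open>s = \<theta>X * p - QX\<close> and \<open>t = \<theta>Y * p - QY\<close> the case distinction of the embedding theorem appears:
  if \<open>t \<ge> 0\<close> the exponent is estimated by the upper bound on the entry level, which has slope given by
  \<open>\<alpha>\<^sub>1\<close>, and if \<open>t \<le> 0\<close> by the lower bound, which has slope given by \<open>\<alpha>\<^sub>2\<close>.
\<close>

lemma entry_exponent:
  fixes s t :: real
  assumes x: "x \<in> MX"
    and nonneg: "0 \<le> t \<Longrightarrow> s \<le> \<alpha>\<^sub>1 * t" and nonpos: "t \<le> 0 \<Longrightarrow> s \<le> \<alpha>\<^sub>2 * t"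
  shows "\<epsilon>X * s * real (entry (Suc m) x) \<le> \<epsilon>Y * t * real m + \<bar>t\<bar> * (\<bar>L\<bar> + \<epsilon>Y + \<alpha>\<^sub>1 * \<epsilon>X)"
proof (cases "0 \<le> t")
  case True
  have "\<epsilon>X * s * real (entry (Suc m) x) = s * (\<epsilon>X * real (entry (Suc m) x))" by simp
  also have "\<dots> \<le> \<alpha>\<^sub>1 * t * (\<epsilon>X * real (entry (Suc m) x))"
    using nonneg[OF True] X.\<epsilon>_pos by (intro mult_right_mono) auto
  also have "\<dots> = t * (\<alpha>\<^sub>1 * \<epsilon>X * real (entry (Suc m) x))" by simp
  also have "\<dots> \<le> t * (L + \<epsilon>Y * real m + \<alpha>\<^sub>1 * \<epsilon>X)"
    using True by (intro mult_left_mono entry_upper[OF x])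
  also have "\<dots> \<le> t * (\<epsilon>Y * real m + (\<bar>L\<bar> + \<epsilon>Y + \<alpha>\<^sub>1 * \<epsilon>X))"
    using True Y.\<epsilon>_pos by (intro mult_left_mono) auto
  finally show ?thesis using True by (simp add: algebra_simps)
next
  case False
  then have t: "t \<le> 0" by simp
  have "\<epsilon>X * s * real (entry (Suc m) x) = s * (\<epsilon>X * real (entry (Suc m) x))" by simp
  also have "\<dots> \<le> \<alpha>\<^sub>2 * t * (\<epsilon>X * real (entry (Suc m) x))"
    using nonpos[OF t] X.\<epsilon>_pos by (intro mult_right_mono) auto
  also have "\<dots> = t * (\<alpha>\<^sub>2 * \<epsilon>X * real (entry (Suc m) x))" by simp
  also have "\<dots> \<le> t * (\<epsilon>Y * (real m + 1) - L)"
    using entry_lower[OF x, of m] t by (intro mult_left_mono_neg) auto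
  also have "\<dots> = \<epsilon>Y * t * real m + (- t) * (L - \<epsilon>Y)" by (simp add: algebra_simps)
  also have "\<dots> \<le> \<epsilon>Y * t * real m + (- t) * (\<bar>L\<bar> + \<epsilon>Y + \<alpha>\<^sub>1 * \<epsilon>X)"
  proof (intro add_left_mono mult_left_mono)
    have "0 < \<alpha>\<^sub>1 * \<epsilon>X" using X.\<epsilon>_pos \<alpha>\<^sub>1_pos by simp
    then show "L - \<epsilon>Y \<le> \<bar>L\<bar> + \<epsilon>Y + \<alpha>\<^sub>1 * \<epsilon>X" using Y.\<epsilon>_pos by linarith
  qed (use t in simp)
  finally show ?thesis using t by simp
qed

text \<open>
  On the preimage of a cell the weight is largest where the entry level is, and around such a point
  \<open>preimage_near\<close> bounds the measure of the preimage.
\<close>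

lemma entry_weight_bound:
  fixes a b :: real
  assumes a: "0 \<le> a"
    and nonneg: "ln (real KY) / \<epsilon>Y \<le> b \<Longrightarrow> a \<le> ln (real KX) / \<epsilon>X + \<alpha>\<^sub>1 * (b - ln (real KY) / \<epsilon>Y)"
    and nonpos: "b \<le> ln (real KY) / \<epsilon>Y \<Longrightarrow> a \<le> ln (real KX) / \<epsilon>X + \<alpha>\<^sub>2 * (b - ln (real KY) / \<epsilon>Y)"
  shows "\<exists>C\<ge>0. \<forall>m. \<forall>\<xi>\<in>MY. (\<integral>\<^sup>+x\<in>f -` cell MY (Suc m) \<xi> \<inter> MX. ennreal (exp (\<epsilon>X * a * real (entry (Suc m) x))) \<partial>\<mu>)
    \<le> ennreal (C * exp (\<epsilon>Y * b * real m)) * emeasure \<nu> (cell MY (Suc m) \<xi>)"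
proof -
  define s where "s = a - ln (real KX) / \<epsilon>X"
  define t where "t = b - ln (real KY) / \<epsilon>Y"
  obtain m0 :: nat where m0: "L / (\<alpha>\<^sub>1 * \<epsilon>X) < real m0" using reals_Archimedean2 by blast
  then have m0: "L < \<alpha>\<^sub>1 * \<epsilon>X * real m0" using \<alpha>\<^sub>1_pos X.\<epsilon>_pos by (simp add: field_simps)
  \<comment> \<open>the powers of \<open>KX\<close> and \<open>KY\<close> absorb the level error \<open>Suc m0\<close> and the shift from \<open>m\<close> to \<open>Suc m\<close>\<close>
  define C where "C = real KX ^ Suc m0 * exp (\<bar>t\<bar> * (\<bar>L\<bar> + \<epsilon>Y + \<alpha>\<^sub>1 * \<epsilon>X)) * real KY"
  have KX: "0 < real KX" and KY: "0 < real KY" using X.two_le_K Y.two_le_K by auto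
  have "(\<integral>\<^sup>+x\<in>f -` cell MY (Suc m) \<xi> \<inter> MX. ennreal (exp (\<epsilon>X * a * real (entry (Suc m) x))) \<partial>\<mu>)
    \<le> ennreal (C * exp (\<epsilon>Y * b * real m)) * emeasure \<nu> (cell MY (Suc m) \<xi>)" if \<xi>: "\<xi> \<in> MY" for m \<xi>
  proof -
    let ?S = "f -` cell MY (Suc m) \<xi> \<inter> MX"
    let ?e = "entry (Suc m)"
    have "\<exists>x. x \<in> ?S" using \<xi> image Y.mem_cell_self[OF \<xi>, of "Suc m"] by auto
    moreover have "\<forall>x. x \<in> ?S \<longrightarrow> ?e x \<le> nat \<lceil>(L + \<epsilon>Y * real m + \<alpha>\<^sub>1 * \<epsilon>X) / (\<alpha>\<^sub>1 * \<epsilon>X)\<rceil>"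
    proof (intro allI impI)
      fix x assume "x \<in> ?S"
      then have "\<alpha>\<^sub>1 * \<epsilon>X * real (?e x) \<le> L + \<epsilon>Y * real m + \<alpha>\<^sub>1 * \<epsilon>X" using entry_upper by blast
      then have "real (?e x) \<le> (L + \<epsilon>Y * real m + \<alpha>\<^sub>1 * \<epsilon>X) / (\<alpha>\<^sub>1 * \<epsilon>X)"
        using \<alpha>\<^sub>1_pos X.\<epsilon>_pos by (simp add: field_simps)
      then show "?e x \<le> nat \<lceil>(L + \<epsilon>Y * real m + \<alpha>\<^sub>1 * \<epsilon>X) / (\<alpha>\<^sub>1 * \<epsilon>X)\<rceil>"
        by (meson of_nat_le_iff order_trans real_nat_ceiling_ge)
    qed
    ultimately obtain x where x: "x \<in> ?S" and max: "\<And>y. y \<in> ?S \<Longrightarrow> ?e y \<le> ?e x"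
      using ex_has_greatest_nat[of "\<lambda>x. x \<in> ?S" _ ?e] by (metis (lifting) less_Suc_eq_le)
    have xM: "x \<in> MX" and fx: "f x \<in> cell MY (Suc m) \<xi>" using x by auto
    let ?c = "?e x"
    \<comment> \<open>\<open>x\<close> has the largest entry level \<open>?c\<close> in the preimage\<close>
    have sub: "?S \<subseteq> cell MX (?c - Suc m0) x"
    proof
      fix y assume y: "y \<in> ?S"
      then have "f y \<in> cell MY (Suc m) (f x)" using Y.cell_eq[OF fx] by simp
      then show "y \<in> cell MX (?c - Suc m0) x" using preimage_near[OF xM _ _ m0] y by blast
    qed
    have Ssets: "?S \<in> sets \<mu>"
      using measurable_sets[OF f_measurable Y.cell_sets[OF \<xi>], of "Suc m"] X.space_\<mu> by simp
    have "(\<integral>\<^sup>+y\<in>?S. ennreal (exp (\<epsilon>X * a * real (?e y))) \<partial>\<mu>) \<le> (\<integral>\<^sup>+y\<in>?S. ennreal (exp (\<epsilon>X * a * real ?c)) \<partial>\<mu>)"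
    proof (rule nn_integral_mono)
      fix y
      show "ennreal (exp (\<epsilon>X * a * real (?e y))) * indicator ?S y \<le> ennreal (exp (\<epsilon>X * a * real ?c)) * indicator ?S y"
        using max[of y] a X.\<epsilon>_pos by (cases "y \<in> ?S") (auto intro!: ennreal_leI mult_left_mono)
    qed
    also have "\<dots> = ennreal (exp (\<epsilon>X * a * real ?c)) * emeasure \<mu> ?S"
      using Ssets by (rule nn_integral_cmult_indicator)
    also have "\<dots> \<le> ennreal (exp (\<epsilon>X * a * real ?c)) * ennreal ((1 / real KX) ^ (?c - Suc m0))"
      using emeasure_mono[OF sub X.cell_sets[OF xM]] X.emeasure_cell[OF xM] by (intro mult_left_mono) auto
    also have "\<dots> \<le> ennreal (exp (\<epsilon>X * a * real ?c)) * ennreal (real KX ^ Suc m0 * exp (- ln (real KX) * real ?c))"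
    proof (intro mult_left_mono ennreal_leI)
      have "exp (- ln (real KX) * real ?c) = (1 / real KX) ^ ?c"
        using KX by (simp add: exp_minus exp_of_nat2_mult power_divide inverse_eq_divide)
      moreover have "(1 / real KX) ^ (?c - Suc m0) \<le> real KX ^ Suc m0 * (1 / real KX) ^ ?c"
      proof (cases "Suc m0 \<le> ?c")
        case True
        then have "(1 / real KX) ^ ?c = (1 / real KX) ^ Suc m0 * (1 / real KX) ^ (?c - Suc m0)"
          by (simp only: power_add[symmetric]) simp
        then show ?thesis using KX by (simp add: power_divide)
      next
        case False
        then have "real KX ^ ?c \<le> real KX ^ Suc m0" using X.two_le_K by (intro power_increasing) auto
        then show ?thesis using False KX by (simp add: power_divide field_simps)
      qed
      ultimately show "(1 / real KX) ^ (?c - Suc m0) \<le> real KX ^ Suc m0 * exp (- ln (real KX) * real ?c)" by simp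
    qed simp
    also have "\<dots> = ennreal (real KX ^ Suc m0 * exp (\<epsilon>X * s * real ?c))"
    proof -
      have "exp (\<epsilon>X * a * real ?c) * exp (- ln (real KX) * real ?c) = exp (\<epsilon>X * s * real ?c)"
        using X.\<epsilon>_pos by (simp add: exp_add[symmetric] s_def algebra_simps)
      then have "exp (\<epsilon>X * a * real ?c) * (real KX ^ Suc m0 * exp (- ln (real KX) * real ?c))
          = real KX ^ Suc m0 * exp (\<epsilon>X * s * real ?c)" by (simp only: mult.left_commute)
      moreover have "ennreal (exp (\<epsilon>X * a * real ?c)) * ennreal (real KX ^ Suc m0 * exp (- ln (real KX) * real ?c))
          = ennreal (exp (\<epsilon>X * a * real ?c) * (real KX ^ Suc m0 * exp (- ln (real KX) * real ?c)))"
        by (rule ennreal_mult[symmetric]) auto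
      ultimately show ?thesis by simp
    qed
    also have "\<dots> \<le> ennreal (real KX ^ Suc m0 * exp (\<epsilon>Y * t * real m + \<bar>t\<bar> * (\<bar>L\<bar> + \<epsilon>Y + \<alpha>\<^sub>1 * \<epsilon>X)))"
    proof (intro ennreal_leI mult_left_mono)
      have "\<epsilon>X * s * real ?c \<le> \<epsilon>Y * t * real m + \<bar>t\<bar> * (\<bar>L\<bar> + \<epsilon>Y + \<alpha>\<^sub>1 * \<epsilon>X)"
        by (rule entry_exponent[OF xM]) (use nonneg nonpos in \<open>auto simp: s_def t_def\<close>)
      then show "exp (\<epsilon>X * s * real ?c) \<le> exp (\<epsilon>Y * t * real m + \<bar>t\<bar> * (\<bar>L\<bar> + \<epsilon>Y + \<alpha>\<^sub>1 * \<epsilon>X))" by simp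
    qed simp
    also have "real KX ^ Suc m0 * exp (\<epsilon>Y * t * real m + \<bar>t\<bar> * (\<bar>L\<bar> + \<epsilon>Y + \<alpha>\<^sub>1 * \<epsilon>X))
        = C * exp (\<epsilon>Y * b * real m) * (1 / real KY) ^ Suc m"
    proof -
      have "exp (\<epsilon>Y * t * real m) = exp (\<epsilon>Y * b * real m) * exp (- ln (real KY) * real m)"
        using Y.\<epsilon>_pos by (simp add: exp_add[symmetric] t_def algebra_simps)
      also have "exp (- ln (real KY) * real m) = real KY * (1 / real KY) ^ Suc m"
        using KY by (simp add: exp_minus exp_of_nat2_mult power_divide inverse_eq_divide)
      finally have e: "exp (\<epsilon>Y * t * real m) = exp (\<epsilon>Y * b * real m) * (real KY * (1 / real KY) ^ Suc m)" .
      show ?thesis unfolding exp_add e C_def by (simp only: mult_ac)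
    qed
    also have "ennreal (C * exp (\<epsilon>Y * b * real m) * (1 / real KY) ^ Suc m)
        = ennreal (C * exp (\<epsilon>Y * b * real m)) * emeasure \<nu> (cell MY (Suc m) \<xi>)"
      unfolding Y.emeasure_cell[OF \<xi>] by (rule ennreal_mult) (auto simp: C_def)
    finally show ?thesis .
  qed
  moreover have "0 \<le> C" by (simp add: C_def)
  ultimately show ?thesis by blast
qed


section \<open>The induced map\<close>

definition pullback :: "((nat \<Rightarrow> 'w) \<Rightarrow> real) \<Rightarrow> (nat \<Rightarrow> 'v) \<Rightarrow> real" where
  "pullback u x = lim (\<lambda>m. Y.average u m (f x))"

definition jump :: "real \<Rightarrow> ((nat \<Rightarrow> 'w) \<Rightarrow> real) \<Rightarrow> nat \<Rightarrow> (nat \<Rightarrow> 'w) \<Rightarrow> real" where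
  "jump p u m \<xi> = \<bar>Y.average u (Suc m) \<xi> - Y.average u m \<xi>\<bar> powr p"

text \<open>
  The jumps around \<open>f x\<close> that are not yet determined by the first \<open>n\<close> levels of \<open>x\<close>, with the weights
  of \<open>weighted_increments\<close> for the choice \<open>w m = exp (- \<beta> * (entry (Suc m) x - n))\<close>.
\<close>

definition tail :: "real \<Rightarrow> real \<Rightarrow> ((nat \<Rightarrow> 'w) \<Rightarrow> real) \<Rightarrow> nat \<Rightarrow> (nat \<Rightarrow> 'v) \<Rightarrow> ennreal" where
  "tail \<beta> p u n x = (\<Sum>m. ennreal (if n < entry (Suc m) x
     then exp (\<beta> * (p - 1) * (real (entry (Suc m) x) - real n)) * jump p u m (f x) else 0))"

definition total :: "real \<Rightarrow> real \<Rightarrow> ((nat \<Rightarrow> 'w) \<Rightarrow> real) \<Rightarrow> (nat \<Rightarrow> 'v) \<Rightarrow> ennreal" where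
  "total \<beta> p u x = (\<Sum>m. ennreal (exp (\<beta> * p * real (entry (Suc m) x)) * jump p u m (f x)))"

lemma jump_nonneg: "0 \<le> jump p u m \<xi>"
  by (simp add: jump_def)

lemma jump_measurable: "jump p u m \<in> borel_measurable \<nu>"
  unfolding jump_def using Y.average_measurable[of u m] Y.average_measurable[of u "Suc m"] by measurable

lemma jump_f_measurable: "(\<lambda>x. jump p u m (f x)) \<in> borel_measurable \<mu>"
  by (rule measurable_compose[OF f_measurable jump_measurable])

lemma jump_cong_cell:
  assumes "\<xi> \<in> MY" "\<xi>' \<in> cell MY (Suc m) \<xi>"
  shows "jump p u m \<xi>' = jump p u m \<xi>"
proof -
  have "\<xi>' \<in> cell MY m \<xi>" using Y.cell_antimono[OF assms(1), of m "Suc m"] assms(2) by auto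
  then show ?thesis unfolding jump_def using Y.average_cong_cell assms(2) by metis
qed

lemma tail_measurable: "tail \<beta> p u n \<in> borel_measurable \<mu>"
  unfolding tail_def using jump_f_measurable entry_measurable by measurable

lemma total_measurable: "total \<beta> p u \<in> borel_measurable \<mu>"
  unfolding total_def using jump_f_measurable entry_measurable by measurable

lemma pullback_measurable: "pullback u \<in> borel_measurable \<mu>"
  unfolding pullback_def using average_f_measurable by (intro borel_measurable_lim_metric)

lemma tail_zero_le_total:
  assumes "0 < \<beta>"
  shows "tail \<beta> p u 0 x \<le> total \<beta> p u x"
  unfolding tail_def total_def
proof (intro suminf_le ennreal_leI)
  fix m
  have "\<beta> * (p - 1) * (real (entry (Suc m) x) - real 0) \<le> \<beta> * p * real (entry (Suc m) x)"
    using assms by (simp add: algebra_simps)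
  then show "(if 0 < entry (Suc m) x
     then exp (\<beta> * (p - 1) * (real (entry (Suc m) x) - real 0)) * jump p u m (f x) else 0)
     \<le> exp (\<beta> * p * real (entry (Suc m) x)) * jump p u m (f x)"
    using jump_nonneg by (auto intro!: mult_right_mono)
qed auto

lemma sum_tails_le_total:
  assumes "0 < \<beta>"
  shows "(\<Sum>n. ennreal (exp (\<beta> * p * real n)) * tail \<beta> p u n x)
    \<le> ennreal (1 / (1 - exp (- \<beta>))) * total \<beta> p u x"
proof -
  have "(\<Sum>n. ennreal (exp (\<beta> * p * real n)) * tail \<beta> p u n x)
    = (\<Sum>n. \<Sum>m. ennreal (exp (\<beta> * p * real n)) * ennreal (if n < entry (Suc m) x
     then exp (\<beta> * (p - 1) * (real (entry (Suc m) x) - real n)) * jump p u m (f x) else 0))"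
    unfolding tail_def by simp
  also have "\<dots> = (\<Sum>m. \<Sum>n. ennreal (exp (\<beta> * p * real n)) * ennreal (if n < entry (Suc m) x
     then exp (\<beta> * (p - 1) * (real (entry (Suc m) x) - real n)) * jump p u m (f x) else 0))"
    by (rule suminf_ennreal_swap)
  also have "\<dots> \<le> (\<Sum>m. ennreal (1 / (1 - exp (- \<beta>))) * ennreal (exp (\<beta> * p * real (entry (Suc m) x)) * jump p u m (f x)))"
    by (intro suminf_le geometric_levels_le[OF assms] jump_nonneg) auto
  finally show ?thesis unfolding total_def by simp
qed

text \<open>
  The finest level \<open>M\<close> such that \<open>f\<close> maps the cell of level \<open>n\<close> around \<open>x\<close> into a single cell of
  level \<open>M\<close>; the average at this level is constant on the cell around \<open>x\<close>.
\<close>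

definition first_exit :: "nat \<Rightarrow> (nat \<Rightarrow> 'v) \<Rightarrow> nat" where
  "first_exit n x = (LEAST m. n < entry (Suc m) x)"

lemma first_exit_le_iff:
  assumes x: "x \<in> MX"
  shows "first_exit n x \<le> m \<longleftrightarrow> n < entry (Suc m) x"
proof
  obtain m' :: nat where "(L + \<alpha>\<^sub>2 * \<epsilon>X * real n) / \<epsilon>Y < real m'" using reals_Archimedean2 by blast
  then have "L + \<alpha>\<^sub>2 * \<epsilon>X * real n < \<epsilon>Y * (real m' + 1)" using Y.\<epsilon>_pos by (simp add: field_simps)
  also have "\<dots> \<le> L + \<alpha>\<^sub>2 * \<epsilon>X * real (entry (Suc m') x)" by (rule entry_lower[OF x])
  finally have "n < entry (Suc m') x" using \<alpha>\<^sub>2_pos X.\<epsilon>_pos by simp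
  then have "n < entry (Suc (first_exit n x)) x" unfolding first_exit_def by (rule LeastI)
  moreover assume "first_exit n x \<le> m"
  ultimately show "n < entry (Suc m) x" using entry_mono[OF x, of "Suc (first_exit n x)" "Suc m"] by simp
next
  assume "n < entry (Suc m) x"
  then show "first_exit n x \<le> m" unfolding first_exit_def by (rule Least_le)
qed

lemma first_exit_zero: "x \<in> MX \<Longrightarrow> first_exit 0 x = 0"
  using first_exit_le_iff[of x 0 0] entry_pos[of x 0] by simp

lemma first_exit_cong:
  assumes x: "x \<in> MX" and y: "y \<in> cell MX n x"
  shows "first_exit n y = first_exit n x"
  unfolding first_exit_def using entry_le_cong[OF x y] by (simp add: not_le[symmetric])

lemma average_first_exit_cong:
  assumes x: "x \<in> MX" and y: "y \<in> cell MX n x"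
  shows "Y.average u (first_exit n x) (f y) = Y.average u (first_exit n x) (f x)"
proof (rule Y.average_cong_cell)
  have "f y \<in> MY" using y f_in by (auto simp: cell_def)
  show "f y \<in> cell MY (first_exit n x) (f x)"
  proof (cases "first_exit n x")
    case 0
    then show ?thesis using \<open>f y \<in> MY\<close> Y.cell_zero[OF f_in[OF x]] by simp
  next
    case (Suc m)
    then have "\<not> n < entry (Suc m) x" using first_exit_le_iff[OF x, of n m] by simp
    then show ?thesis using entry_le_cell[OF x y, of "Suc m"] Suc by simp
  qed
qed

text \<open>
  By \<open>entry_gap\<close> the weights \<open>w m\<close> decay geometrically in \<open>m\<close>, with a rate and a constant independent of
  \<open>x\<close>, \<open>n\<close> and \<open>u\<close>. Their sum is bounded, as \<open>limit_deviation\<close> requires.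
\<close>

lemma pullback_deviation:
  assumes \<beta>: "0 < \<beta>" and p: "1 \<le> p"
  shows "\<exists>W\<ge>0. \<forall>u n. \<forall>x\<in>MX.
    ennreal (\<bar>pullback u x - Y.average u (first_exit n x) (f x)\<bar> powr p) \<le> ennreal W * tail \<beta> p u n x \<and>
    (tail \<beta> p u n x < \<infinity> \<longrightarrow> convergent (\<lambda>m. Y.average u m (f x)))"
proof -
  define \<kappa> where "\<kappa> = \<epsilon>Y / (\<alpha>\<^sub>2 * \<epsilon>X)"
  define E where "E = exp (\<beta> * (L / (\<alpha>\<^sub>2 * \<epsilon>X)))"
  define q where "q = exp (- \<beta> * \<kappa>)"
  have "0 < \<kappa>" unfolding \<kappa>_def using \<alpha>\<^sub>2_pos X.\<epsilon>_pos Y.\<epsilon>_pos by simp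
  then have q: "0 < q" "q < 1" unfolding q_def using \<beta> by auto
  define W where "W = E / (1 - q)"
  have "ennreal (\<bar>pullback u x - Y.average u (first_exit n x) (f x)\<bar> powr p) \<le> ennreal (W powr (p - 1)) * tail \<beta> p u n x \<and>
      (tail \<beta> p u n x < \<infinity> \<longrightarrow> convergent (\<lambda>m. Y.average u m (f x)))"
    if x: "x \<in> MX" for u n x
  proof -
    let ?M = "first_exit n x"
    let ?c = "\<lambda>m. entry (Suc m) x"
    define w where "w m = exp (- \<beta> * (real (?c m) - real n))" for m
    have w_le: "w m \<le> E * q ^ (m - ?M)" if m: "?M \<le> m" for m
    proof -
      have "n < ?c ?M" using first_exit_le_iff[OF x, of n ?M] by simp
      then have "\<alpha>\<^sub>2 * \<epsilon>X * (real (?c m) - real (?c ?M) + 1) \<le> \<alpha>\<^sub>2 * \<epsilon>X * (real (?c m) - real n)"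
        using \<alpha>\<^sub>2_pos X.\<epsilon>_pos by (intro mult_left_mono) auto
      moreover have "\<epsilon>Y * real (m - ?M) \<le> \<epsilon>Y * (real m + 1 - real ?M)"
        using m Y.\<epsilon>_pos by (intro mult_left_mono) auto
      ultimately have "\<epsilon>Y * real (m - ?M) \<le> L + \<alpha>\<^sub>2 * \<epsilon>X * (real (?c m) - real n)"
        using entry_gap[OF x m] by linarith
      then have "\<kappa> * real (m - ?M) \<le> L / (\<alpha>\<^sub>2 * \<epsilon>X) + (real (?c m) - real n)"
        using \<alpha>\<^sub>2_pos X.\<epsilon>_pos unfolding \<kappa>_def by (simp add: field_simps)
      then have "\<beta> * (\<kappa> * real (m - ?M)) \<le> \<beta> * (L / (\<alpha>\<^sub>2 * \<epsilon>X) + (real (?c m) - real n))"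
        using \<beta> by (intro mult_left_mono) auto
      then have "- \<beta> * (real (?c m) - real n) \<le> \<beta> * (L / (\<alpha>\<^sub>2 * \<epsilon>X)) + real (m - ?M) * (- \<beta> * \<kappa>)"
        by (simp add: algebra_simps)
      then have "w m \<le> exp (\<beta> * (L / (\<alpha>\<^sub>2 * \<epsilon>X)) + real (m - ?M) * (- \<beta> * \<kappa>))" unfolding w_def by simp
      also have "\<dots> = E * q ^ (m - ?M)" unfolding E_def q_def exp_add exp_of_nat_mult ..
      finally show ?thesis .
    qed
    have w_pos: "0 < w m" for m by (simp add: w_def)
    have sum_w: "sum w {?M..<N} \<le> W" for N
    proof -
      have "sum w {?M..<N} \<le> (\<Sum>m\<in>{?M..<N}. E * q ^ (m - ?M))" by (intro sum_mono w_le) auto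
      also have "\<dots> = E * (\<Sum>k<N - ?M. q ^ k)"
        unfolding sum_distrib_left[symmetric]
        by (intro arg_cong2[where f = "(*)"] refl sum.reindex_bij_witness[of _ "\<lambda>k. k + ?M" "\<lambda>m. m - ?M"]) auto
      also have "\<dots> \<le> E * (\<Sum>k. q ^ k)"
        using q by (intro mult_left_mono sum_le_suminf summable_geometric) (auto simp: E_def)
      also have "\<dots> = W" using q by (simp add: suminf_geometric W_def)
      finally show ?thesis .
    qed
    have "weighted_increments (\<lambda>m. Y.average u m (f x)) w p ?M = tail \<beta> p u n x"
      unfolding weighted_increments_def tail_def
    proof (intro suminf_cong arg_cong[where f = ennreal] if_cong)
      fix m
      show "?M \<le> m \<longleftrightarrow> n < ?c m" by (rule first_exit_le_iff[OF x])
      have "w m powr (1 - p) = exp (\<beta> * (p - 1) * (real (?c m) - real n))"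
        unfolding w_def by (simp add: powr_def algebra_simps)
      then show "w m powr (1 - p) * \<bar>Y.average u (Suc m) (f x) - Y.average u m (f x)\<bar> powr p
          = exp (\<beta> * (p - 1) * (real (?c m) - real n)) * jump p u m (f x)"
        by (simp add: jump_def)
    qed simp
    then show ?thesis
      using limit_deviation[OF p w_pos sum_w, of "\<lambda>m. Y.average u m (f x)"]
        convergent_if_weighted_increments[OF p w_pos sum_w, of "\<lambda>m. Y.average u m (f x)"]
      unfolding pullback_def by simp
  qed
  then show ?thesis by (intro exI[of _ "W powr (p - 1)"]) auto
qed

text \<open>
  Inside a cell of level \<open>n\<close> both values are compared with the common average at the level
  \<open>first_exit\<close>.
\<close>

lemma pullback_scale_energy:
  assumes p: "1 \<le> p" and W: "0 \<le> W"
    and dev: "\<And>x. x \<in> MX \<Longrightarrow>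
      ennreal (\<bar>pullback u x - Y.average u (first_exit n x) (f x)\<bar> powr p) \<le> ennreal W * tail \<beta> p u n x"
  shows "X.scale_energy p (pullback u) n \<le> ennreal (2 * 2 powr p * W) * (\<integral>\<^sup>+x. tail \<beta> p u n x \<partial>\<mu>)"
proof -
  let ?T = "tail \<beta> p u n"
  let ?c = "ennreal (2 powr p * W)"
  have KX: "0 < real KX" using X.two_le_K by simp
  note [measurable] = tail_measurable
  have pair: "ennreal (\<bar>pullback u x - pullback u y\<bar> powr p) \<le> ?c * (?T x + ?T y)"
    if x: "x \<in> MX" and y: "y \<in> cell MX n x" for x y
  proof -
    have yM: "y \<in> MX" using y by (simp add: cell_def)
    \<comment> \<open>the same number for \<open>x\<close> and \<open>y\<close>\<close>
    define a where "a = Y.average u (first_exit n x) (f x)"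
    have ay: "a = Y.average u (first_exit n y) (f y)"
      unfolding a_def first_exit_cong[OF x y] by (rule average_first_exit_cong[OF x y, symmetric])
    have "\<bar>pullback u x - pullback u y\<bar> powr p \<le> (\<bar>pullback u x - a\<bar> + \<bar>pullback u y - a\<bar>) powr p"
      using p by (intro powr_mono2) auto
    also have "\<dots> \<le> 2 powr p * (\<bar>pullback u x - a\<bar> powr p + \<bar>pullback u y - a\<bar> powr p)"
      using p by (intro powr_add_le) auto
    finally have "ennreal (\<bar>pullback u x - pullback u y\<bar> powr p)
        \<le> ennreal (2 powr p * (\<bar>pullback u x - a\<bar> powr p + \<bar>pullback u y - a\<bar> powr p))"
      by (rule ennreal_leI)
    also have "\<dots> = ennreal (2 powr p) * (ennreal (\<bar>pullback u x - a\<bar> powr p) + ennreal (\<bar>pullback u y - a\<bar> powr p))"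
      by (simp add: ennreal_mult ennreal_plus)
    also have "\<dots> \<le> ennreal (2 powr p) * (ennreal W * ?T x + ennreal W * ?T y)"
      using dev[OF x] dev[OF yM] unfolding a_def[symmetric] ay[symmetric]
      by (intro mult_left_mono add_mono) auto
    also have "\<dots> = ?c * (?T x + ?T y)"
      using W by (simp add: ennreal_mult distrib_left mult.assoc)
    finally show ?thesis .
  qed
  have "X.scale_energy p (pullback u) n
      \<le> (\<integral>\<^sup>+x. ?c * ?T x + ?c * (ennreal (real KX ^ n) * (\<integral>\<^sup>+y\<in>cell MX n x. ?T y \<partial>\<mu>)) \<partial>\<mu>)"
    unfolding X.scale_energy_def
  proof (rule nn_integral_mono)
    fix x assume "x \<in> space \<mu>"
    then have x: "x \<in> MX" by (simp add: X.space_\<mu>)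
    have [measurable]: "cell MX n x \<in> sets \<mu>" by (rule X.cell_sets[OF x])
    have "(\<integral>\<^sup>+y\<in>cell MX n x. ennreal (\<bar>pullback u x - pullback u y\<bar> powr p) \<partial>\<mu>)
        \<le> (\<integral>\<^sup>+y. ?c * ?T x * indicator (cell MX n x) y + ?c * (?T y * indicator (cell MX n x) y) \<partial>\<mu>)"
    proof (rule nn_integral_mono)
      fix y
      show "ennreal (\<bar>pullback u x - pullback u y\<bar> powr p) * indicator (cell MX n x) y
          \<le> ?c * ?T x * indicator (cell MX n x) y + ?c * (?T y * indicator (cell MX n x) y)"
        using pair[OF x, of y] by (auto simp: indicator_def distrib_left)
    qed
    also have "\<dots> = ?c * ?T x * ennreal ((1 / real KX) ^ n) + ?c * (\<integral>\<^sup>+y\<in>cell MX n x. ?T y \<partial>\<mu>)"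
      using X.emeasure_cell[OF x, of n]
      by (simp add: nn_integral_add nn_integral_cmult nn_integral_cmult_indicator)
    finally have "ennreal (real KX ^ n) * (\<integral>\<^sup>+y\<in>cell MX n x. ennreal (\<bar>pullback u x - pullback u y\<bar> powr p) \<partial>\<mu>)
        \<le> ennreal (real KX ^ n) * (?c * ?T x * ennreal ((1 / real KX) ^ n) + ?c * (\<integral>\<^sup>+y\<in>cell MX n x. ?T y \<partial>\<mu>))"
      by (rule mult_left_mono) simp
    also have "\<dots> = ?c * ?T x * (ennreal (real KX ^ n) * ennreal ((1 / real KX) ^ n))
        + ?c * (ennreal (real KX ^ n) * (\<integral>\<^sup>+y\<in>cell MX n x. ?T y \<partial>\<mu>))"
      by (simp only: distrib_left mult_ac)
    also have "ennreal (real KX ^ n) * ennreal ((1 / real KX) ^ n) = 1"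
      using KX by (simp flip: ennreal_mult add: power_divide)
    finally show "ennreal (real KX ^ n) * (\<integral>\<^sup>+y\<in>cell MX n x. ennreal (\<bar>pullback u x - pullback u y\<bar> powr p) \<partial>\<mu>)
        \<le> ?c * ?T x + ?c * (ennreal (real KX ^ n) * (\<integral>\<^sup>+y\<in>cell MX n x. ?T y \<partial>\<mu>))"
      by simp
  qed
  also have "\<dots> = ?c * (\<integral>\<^sup>+x. ?T x \<partial>\<mu>) + ?c * (\<integral>\<^sup>+x. ennreal (real KX ^ n) * (\<integral>\<^sup>+y\<in>cell MX n x. ?T y \<partial>\<mu>) \<partial>\<mu>)"
  proof -
    have [measurable]: "(\<lambda>x. \<integral>\<^sup>+y\<in>cell MX n x. ?T y \<partial>\<mu>) \<in> borel_measurable \<mu>"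
      by (rule X.cell_integral_measurable) measurable
    show ?thesis by (simp add: nn_integral_add nn_integral_cmult)
  qed
  also have "\<dots> = ?c * (\<integral>\<^sup>+x. ?T x \<partial>\<mu>) + ?c * (\<integral>\<^sup>+x. ?T x \<partial>\<mu>)"
    using X.nn_integral_cell_average[OF tail_measurable] by simp
  also have "\<dots> = ennreal (2 * 2 powr p * W) * (\<integral>\<^sup>+x. ?T x \<partial>\<mu>)"
  proof -
    have "2 * 2 powr p * W = 2 powr p * W + 2 powr p * W" by simp
    then show ?thesis using W by (simp only: ennreal_plus mult_nonneg_nonneg powr_ge_zero distrib_right)
  qed
  finally show ?thesis .
qed

lemma pullback_discrete_energy:
  assumes p: "1 \<le> p" and \<theta>: "0 < \<theta>" and W: "0 \<le> W"
    and dev: "\<And>n x. x \<in> MX \<Longrightarrow> ennreal (\<bar>pullback u x - Y.average u (first_exit n x) (f x)\<bar> powr p)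
      \<le> ennreal W * tail (\<epsilon>X * \<theta>) p u n x"
  shows "X.discrete_energy \<theta> p (pullback u)
    \<le> ennreal (2 * 2 powr p * W * (1 / (1 - exp (- (\<epsilon>X * \<theta>))))) * (\<integral>\<^sup>+x. total (\<epsilon>X * \<theta>) p u x \<partial>\<mu>)"
proof -
  let ?\<beta> = "\<epsilon>X * \<theta>"
  let ?c = "2 * 2 powr p * W" and ?z = "1 / (1 - exp (- (\<epsilon>X * \<theta>)))"
  have \<beta>: "0 < ?\<beta>" using X.\<epsilon>_pos \<theta> by simp
  have z: "0 \<le> ?z" using \<beta> by simp
  note [measurable] = tail_measurable total_measurable
  have "X.discrete_energy \<theta> p (pullback u)
      \<le> (\<Sum>n. ennreal (exp (?\<beta> * p * real n)) * (ennreal ?c * (\<integral>\<^sup>+x. tail ?\<beta> p u n x \<partial>\<mu>)))"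
    unfolding X.discrete_energy_def mult.assoc[of \<epsilon>X \<theta> p, symmetric]
    by (intro suminf_le mult_left_mono pullback_scale_energy[OF p W dev]) auto
  also have "\<dots> = ennreal ?c * (\<Sum>n. ennreal (exp (?\<beta> * p * real n)) * (\<integral>\<^sup>+x. tail ?\<beta> p u n x \<partial>\<mu>))"
    by (simp add: mult.left_commute[of _ "ennreal ?c"])
  also have "\<dots> = ennreal ?c * (\<integral>\<^sup>+x. (\<Sum>n. ennreal (exp (?\<beta> * p * real n)) * tail ?\<beta> p u n x) \<partial>\<mu>)"
    by (simp add: nn_integral_suminf nn_integral_cmult)
  also have "\<dots> \<le> ennreal ?c * (\<integral>\<^sup>+x. ennreal ?z * total ?\<beta> p u x \<partial>\<mu>)"
    by (intro mult_left_mono nn_integral_mono sum_tails_le_total[OF \<beta>]) auto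
  also have "\<dots> = ennreal (?c * ?z) * (\<integral>\<^sup>+x. total ?\<beta> p u x \<partial>\<mu>)"
  proof -
    have "ennreal (?c * ?z) = ennreal ?c * ennreal ?z" using W z by (intro ennreal_mult) auto
    then show ?thesis by (simp only: nn_integral_cmult[OF total_measurable] mult.assoc)
  qed
  finally show ?thesis .
qed

text \<open>
  Jumps are constant on cells, so \<open>transfer_cells\<close> moves each term to the target, where the weight
  bound applies.
\<close>

lemma integral_total_le:
  assumes p: "1 \<le> p" and u: "integrable \<nu> u" and C: "0 \<le> C"
    and weight: "\<And>m \<xi>. \<xi> \<in> MY \<Longrightarrow>
      (\<integral>\<^sup>+x\<in>f -` cell MY (Suc m) \<xi> \<inter> MX. ennreal (exp (\<epsilon>X * (\<theta>X * p) * real (entry (Suc m) x))) \<partial>\<mu>)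
      \<le> ennreal (C * exp (\<epsilon>Y * (\<theta>Y * p) * real m)) * emeasure \<nu> (cell MY (Suc m) \<xi>)"
  shows "(\<integral>\<^sup>+x. total (\<epsilon>X * \<theta>X) p u x \<partial>\<mu>) \<le> ennreal C * Y.discrete_energy \<theta>Y p u"
proof -
  have em: "(\<lambda>x. ennreal (exp (\<epsilon>X * (\<theta>X * p) * real (entry (Suc m) x)))) \<in> borel_measurable \<mu>" for m
    using entry_measurable by measurable
  have jm: "(\<lambda>x. ennreal (jump p u m (f x))) \<in> borel_measurable \<mu>" for m
    using jump_f_measurable by measurable
  have jm': "(\<lambda>\<xi>. ennreal (jump p u m \<xi>)) \<in> borel_measurable \<nu>" for m
    using jump_measurable by measurable
  have "(\<integral>\<^sup>+x. total (\<epsilon>X * \<theta>X) p u x \<partial>\<mu>)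
      = (\<integral>\<^sup>+x. (\<Sum>m. ennreal (exp (\<epsilon>X * (\<theta>X * p) * real (entry (Suc m) x))) * ennreal (jump p u m (f x))) \<partial>\<mu>)"
    unfolding total_def mult.assoc[of \<epsilon>X \<theta>X p] by (simp add: ennreal_mult jump_nonneg)
  also have "\<dots> = (\<Sum>m. \<integral>\<^sup>+x. ennreal (exp (\<epsilon>X * (\<theta>X * p) * real (entry (Suc m) x))) * ennreal (jump p u m (f x)) \<partial>\<mu>)"
    by (intro nn_integral_suminf borel_measurable_times_ennreal em jm)
  also have "\<dots> \<le> (\<Sum>m. ennreal C * (ennreal (exp (\<epsilon>Y * (\<theta>Y * p) * real m)) * Y.scale_energy p u m))"
  proof (rule suminf_le)
    fix m
    have "(\<integral>\<^sup>+x. ennreal (exp (\<epsilon>X * (\<theta>X * p) * real (entry (Suc m) x))) * ennreal (jump p u m (f x)) \<partial>\<mu>)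
        \<le> ennreal (C * exp (\<epsilon>Y * (\<theta>Y * p) * real m)) * (\<integral>\<^sup>+\<xi>. ennreal (jump p u m \<xi>) \<partial>\<nu>)"
      by (rule transfer_cells[where b = "\<lambda>\<xi>. ennreal (jump p u m \<xi>)" and n = "Suc m", OF em jm' _ weight])
        (simp_all add: jump_cong_cell)
    also have "\<dots> \<le> ennreal (C * exp (\<epsilon>Y * (\<theta>Y * p) * real m)) * Y.scale_energy p u m"
      unfolding jump_def by (intro mult_left_mono Y.average_step_le[OF p u]) simp
    also have "\<dots> = ennreal C * (ennreal (exp (\<epsilon>Y * (\<theta>Y * p) * real m)) * Y.scale_energy p u m)"
      using C by (simp add: ennreal_mult mult.assoc)
    finally show "(\<integral>\<^sup>+x. ennreal (exp (\<epsilon>X * (\<theta>X * p) * real (entry (Suc m) x))) * ennreal (jump p u m (f x)) \<partial>\<mu>)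
        \<le> ennreal C * (ennreal (exp (\<epsilon>Y * (\<theta>Y * p) * real m)) * Y.scale_energy p u m)" .
  qed auto
  finally show ?thesis unfolding Y.discrete_energy_def by simp
qed

text \<open>
  The pullback is compared with the average of \<open>u\<close> over the whole boundary, which is the case \<open>n = 0\<close>
  of the deviation bound.
\<close>

lemma integral_pullback_powr_le:
  assumes p: "1 \<le> p" and u: "integrable \<nu> u" and \<beta>: "0 < \<beta>" and W: "0 \<le> W"
    and dev: "\<And>n x. x \<in> MX \<Longrightarrow> ennreal (\<bar>pullback u x - Y.average u (first_exit n x) (f x)\<bar> powr p)
      \<le> ennreal W * tail \<beta> p u n x"
  shows "(\<integral>\<^sup>+x. ennreal (\<bar>pullback u x\<bar> powr p) \<partial>\<mu>)
    \<le> ennreal (2 powr p) * ((\<integral>\<^sup>+\<xi>. ennreal (\<bar>u \<xi>\<bar> powr p) \<partial>\<nu>) + ennreal W * (\<integral>\<^sup>+x. total \<beta> p u x \<partial>\<mu>))"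
proof -
  let ?I = "\<integral>\<^sup>+\<xi>. ennreal (\<bar>u \<xi>\<bar> powr p) \<partial>\<nu>"
  have "(\<integral>\<^sup>+x. ennreal (\<bar>pullback u x\<bar> powr p) \<partial>\<mu>) \<le> (\<integral>\<^sup>+x. ennreal (2 powr p) * (?I + ennreal W * total \<beta> p u x) \<partial>\<mu>)"
  proof (rule nn_integral_mono)
    fix x assume "x \<in> space \<mu>"
    then have x: "x \<in> MX" by (simp add: X.space_\<mu>)
    define a where "a = Y.average u 0 (f x)"
    have "ennreal (\<bar>a\<bar> powr p) \<le> (\<integral>\<^sup>+\<xi>\<in>cell MY 0 (f x). ennreal (\<bar>u \<xi>\<bar> powr p) \<partial>\<nu>)"
      using Y.powr_average_le[OF p u f_in[OF x], of 0] by (simp add: a_def)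
    also have "\<dots> \<le> ?I" by (intro nn_integral_mono) (simp add: indicator_def)
    finally have a: "ennreal (\<bar>a\<bar> powr p) \<le> ?I" .
    have "ennreal (\<bar>pullback u x - a\<bar> powr p) \<le> ennreal W * tail \<beta> p u 0 x"
      using dev[OF x, of 0] first_exit_zero[OF x] by (simp add: a_def)
    also have "\<dots> \<le> ennreal W * total \<beta> p u x" by (intro mult_left_mono tail_zero_le_total[OF \<beta>]) simp
    finally have b: "ennreal (\<bar>pullback u x - a\<bar> powr p) \<le> ennreal W * total \<beta> p u x" .
    have "\<bar>pullback u x\<bar> powr p \<le> (\<bar>a\<bar> + \<bar>pullback u x - a\<bar>) powr p" using p by (intro powr_mono2) auto
    also have "\<dots> \<le> 2 powr p * (\<bar>a\<bar> powr p + \<bar>pullback u x - a\<bar> powr p)" using p by (intro powr_add_le) auto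
    finally have "ennreal (\<bar>pullback u x\<bar> powr p) \<le> ennreal (2 powr p * (\<bar>a\<bar> powr p + \<bar>pullback u x - a\<bar> powr p))"
      by (rule ennreal_leI)
    also have "\<dots> = ennreal (2 powr p) * (ennreal (\<bar>a\<bar> powr p) + ennreal (\<bar>pullback u x - a\<bar> powr p))"
      by (simp add: ennreal_mult ennreal_plus)
    also have "\<dots> \<le> ennreal (2 powr p) * (?I + ennreal W * total \<beta> p u x)"
      using a b by (intro mult_left_mono add_mono) auto
    finally show "ennreal (\<bar>pullback u x\<bar> powr p) \<le> ennreal (2 powr p) * (?I + ennreal W * total \<beta> p u x)" .
  qed
  also have "\<dots> = ennreal (2 powr p) * (?I + ennreal W * (\<integral>\<^sup>+x. total \<beta> p u x \<partial>\<mu>))"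
    using total_measurable[of \<beta> p u] X.emeasure_space_1 by (simp add: nn_integral_add nn_integral_cmult)
  finally show ?thesis .
qed

lemma pullback_cong_AE:
  assumes "AE \<xi> in \<nu>. u \<xi> = v \<xi>" and u: "u \<in> borel_measurable \<nu>" and v: "v \<in> borel_measurable \<nu>"
    and x: "x \<in> MX"
  shows "pullback u x = pullback v x"
proof -
  have "Y.average u m (f x) = Y.average v m (f x)" for m
  proof -
    have "(\<integral>\<xi>. indicator (cell MY m (f x)) \<xi> * u \<xi> \<partial>\<nu>) = (\<integral>\<xi>. indicator (cell MY m (f x)) \<xi> * v \<xi> \<partial>\<nu>)"
      using u v Y.cell_sets[OF f_in[OF x], of m] assms(1) by (intro integral_cong_AE) auto
    then show ?thesis by (simp add: Y.average_def)
  qed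
  then show ?thesis by (simp add: pullback_def)
qed

text \<open>
  The integral of \<open>total\<close> controls everything: seminorm, \<open>L\<^sup>p\<close> norm and, through its finiteness, the
  convergence of the averages almost everywhere, from which linearity follows.
\<close>

theorem pullback_bounded_linear:
  assumes p: "1 \<le> p" and \<theta>X: "0 < \<theta>X" and \<theta>Y: "0 < \<theta>Y"
    and nonneg: "ln (real KY) / \<epsilon>Y \<le> \<theta>Y * p \<Longrightarrow>
      \<theta>X * p \<le> ln (real KX) / \<epsilon>X + \<alpha>\<^sub>1 * (\<theta>Y * p - ln (real KY) / \<epsilon>Y)"
    and nonpos: "\<theta>Y * p \<le> ln (real KY) / \<epsilon>Y \<Longrightarrow>
      \<theta>X * p \<le> ln (real KX) / \<epsilon>X + \<alpha>\<^sub>2 * (\<theta>Y * p - ln (real KY) / \<epsilon>Y)"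
  shows "bounded_linear_besov (boundary_dist \<epsilon>Y) \<nu> \<theta>Y (boundary_dist \<epsilon>X) \<mu> \<theta>X p pullback"
proof -
  let ?BY = "besov_space (boundary_dist \<epsilon>Y) \<nu> \<theta>Y p" and ?BX = "besov_space (boundary_dist \<epsilon>X) \<mu> \<theta>X p"
  let ?\<beta> = "\<epsilon>X * \<theta>X"
  let ?SY = "\<lambda>u. enn_powr (besov_seminorm (boundary_dist \<epsilon>Y) \<nu> \<theta>Y p u) p"
  let ?SX = "\<lambda>g. enn_powr (besov_seminorm (boundary_dist \<epsilon>X) \<mu> \<theta>X p g) p"
  let ?IY = "\<lambda>u. enn_powr (lp_norm \<nu> p u) p" and ?IX = "\<lambda>g. enn_powr (lp_norm \<mu> p g) p"
  have p0: "0 < p" using p by simp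
  have \<beta>: "0 < ?\<beta>" using X.\<epsilon>_pos \<theta>X by simp
  have IY: "?IY u = (\<integral>\<^sup>+\<xi>. ennreal (\<bar>u \<xi>\<bar> powr p) \<partial>\<nu>)" for u
    unfolding lp_norm_def by (rule enn_powr_enn_powr_inverse[OF p0])
  have IX: "?IX g = (\<integral>\<^sup>+x. ennreal (\<bar>g x\<bar> powr p) \<partial>\<mu>)" for g
    unfolding lp_norm_def by (rule enn_powr_enn_powr_inverse[OF p0])
  have BY: "u \<in> borel_measurable \<nu>" "integrable \<nu> u" "?SY u < \<infinity>" "?IY u < \<infinity>" if "u \<in> ?BY" for u
  proof -
    have u: "u \<in> borel_measurable \<nu>" "lp_norm \<nu> p u < \<infinity>"
      "besov_seminorm (boundary_dist \<epsilon>Y) \<nu> \<theta>Y p u < \<infinity>"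
      using that unfolding besov_space_def by auto
    show "u \<in> borel_measurable \<nu>" by (rule u(1))
    show "integrable \<nu> u" by (rule Y.lp_integrable[OF p u(1,2)])
    show "?SY u < \<infinity>" "?IY u < \<infinity>" using u(2,3) by (simp_all only: enn_powr_less_top)
  qed
  obtain W where W: "0 \<le> W"
    and dev: "\<And>u n x. x \<in> MX \<Longrightarrow> ennreal (\<bar>pullback u x - Y.average u (first_exit n x) (f x)\<bar> powr p) \<le> ennreal W * tail ?\<beta> p u n x"
    and conv: "\<And>u n x. x \<in> MX \<Longrightarrow> tail ?\<beta> p u n x < \<infinity> \<Longrightarrow> convergent (\<lambda>m. Y.average u m (f x))"
    using pullback_deviation[OF \<beta> p] by blast
  obtain C where C: "0 \<le> C" and weight: "\<And>m \<xi>. \<xi> \<in> MY \<Longrightarrow>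
      (\<integral>\<^sup>+x\<in>f -` cell MY (Suc m) \<xi> \<inter> MX. ennreal (exp (\<epsilon>X * (\<theta>X * p) * real (entry (Suc m) x))) \<partial>\<mu>)
      \<le> ennreal (C * exp (\<epsilon>Y * (\<theta>Y * p) * real m)) * emeasure \<nu> (cell MY (Suc m) \<xi>)"
    using entry_weight_bound[of "\<theta>X * p" "\<theta>Y * p"] nonneg nonpos \<theta>X p0 by (auto simp: less_imp_le)
  obtain CX where CX: "0 \<le> CX" "\<And>g. ?SX g \<le> ennreal CX * X.discrete_energy \<theta>X p g"
    using X.besov_seminorm_le_discrete[OF p0 \<theta>X] by blast
  obtain CY where CY: "0 \<le> CY" "\<And>u. Y.discrete_energy \<theta>Y p u \<le> ennreal CY * ?SY u"
    using Y.discrete_le_besov_seminorm[OF p0 \<theta>Y] by blast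
  have total: "(\<integral>\<^sup>+x. total ?\<beta> p u x \<partial>\<mu>) \<le> ennreal (C * CY) * ?SY u" if u: "u \<in> ?BY" for u
  proof -
    have "(\<integral>\<^sup>+x. total ?\<beta> p u x \<partial>\<mu>) \<le> ennreal C * Y.discrete_energy \<theta>Y p u"
      by (rule integral_total_le[OF p BY(2)[OF u] C weight])
    also have "\<dots> \<le> ennreal C * (ennreal CY * ?SY u)" by (intro mult_left_mono CY(2)) simp
    also have "\<dots> = ennreal (C * CY) * ?SY u" using C CY(1) by (simp add: ennreal_mult mult.assoc)
    finally show ?thesis .
  qed
  define D where "D = CX * (2 * 2 powr p * W * (1 / (1 - exp (- ?\<beta>))))"
  have D: "0 \<le> D" using CX(1) W \<beta> by (simp add: D_def)
  have semi: "?SX (pullback u) \<le> ennreal (D * (C * CY)) * ?SY u" if u: "u \<in> ?BY" for u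
  proof -
    have "?SX (pullback u) \<le> ennreal CX * X.discrete_energy \<theta>X p (pullback u)" by (rule CX(2))
    also have "\<dots> \<le> ennreal CX * (ennreal (2 * 2 powr p * W * (1 / (1 - exp (- ?\<beta>)))) * (\<integral>\<^sup>+x. total ?\<beta> p u x \<partial>\<mu>))"
      by (intro mult_left_mono pullback_discrete_energy[OF p \<theta>X W dev]) auto
    also have "\<dots> = ennreal D * (\<integral>\<^sup>+x. total ?\<beta> p u x \<partial>\<mu>)"
      unfolding D_def using CX(1) W \<beta> by (subst ennreal_mult) (auto simp: mult.assoc)
    also have "\<dots> \<le> ennreal D * (ennreal (C * CY) * ?SY u)" by (intro mult_left_mono total[OF u]) simp
    also have "\<dots> = ennreal (D * (C * CY)) * ?SY u"
      using D C CY(1) by (subst ennreal_mult) (auto simp: mult.assoc)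
    finally show ?thesis .
  qed
  have lp: "?IX (pullback u) \<le> ennreal (2 powr p) * (?IY u + ennreal (W * (C * CY)) * ?SY u)" if u: "u \<in> ?BY" for u
  proof -
    have "?IX (pullback u) \<le> ennreal (2 powr p) * (?IY u + ennreal W * (\<integral>\<^sup>+x. total ?\<beta> p u x \<partial>\<mu>))"
      unfolding IX IY by (rule integral_pullback_powr_le[OF p BY(2)[OF u] \<beta> W dev])
    also have "\<dots> \<le> ennreal (2 powr p) * (?IY u + ennreal W * (ennreal (C * CY) * ?SY u))"
      by (intro mult_left_mono add_left_mono total[OF u]) auto
    also have "ennreal W * (ennreal (C * CY) * ?SY u) = ennreal (W * (C * CY)) * ?SY u"
      using W C CY(1) by (subst ennreal_mult) (auto simp: mult.assoc)
    finally show ?thesis .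
  qed
  have in_BX: "pullback u \<in> ?BX" if u: "u \<in> ?BY" for u
  proof -
    have "?SX (pullback u) < \<infinity>"
      using semi[OF u] BY(3)[OF u] by (auto intro!: le_less_trans[OF semi[OF u]] simp: ennreal_mult_less_top)
    moreover have "?IX (pullback u) < \<infinity>"
      using BY(3,4)[OF u] by (intro le_less_trans[OF lp[OF u]]) (simp add: ennreal_mult_less_top)
    ultimately show ?thesis
      unfolding besov_space_def enn_powr_less_top using pullback_measurable by simp
  qed
  have conv_AE: "AE x in \<mu>. convergent (\<lambda>m. Y.average u m (f x))" if u: "u \<in> ?BY" for u
  proof -
    have "(\<integral>\<^sup>+x. total ?\<beta> p u x \<partial>\<mu>) < \<infinity>"
      using BY(3)[OF u] by (intro le_less_trans[OF total[OF u]]) (simp add: ennreal_mult_less_top)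
    then have "AE x in \<mu>. total ?\<beta> p u x \<noteq> \<infinity>"
      using nn_integral_PInf_AE[OF total_measurable] by auto
    then show ?thesis
    proof (rule AE_mp, intro AE_I2 impI)
      fix x assume "x \<in> space \<mu>" "total ?\<beta> p u x \<noteq> \<infinity>"
      then have x: "x \<in> MX" and "total ?\<beta> p u x < \<infinity>" by (auto simp: X.space_\<mu> top.not_eq_extremum)
      then have "tail ?\<beta> p u 0 x < \<infinity>" using tail_zero_le_total[OF \<beta>] by (rule_tac le_less_trans)
      then show "convergent (\<lambda>m. Y.average u m (f x))" by (rule conv[OF x])
    qed
  qed
  have add: "AE x in \<mu>. pullback (\<lambda>\<xi>. u \<xi> + v \<xi>) x = pullback u x + pullback v x"
    if u: "u \<in> ?BY" and v: "v \<in> ?BY" for u v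
    using conv_AE[OF u] conv_AE[OF v] AE_space
  proof eventually_elim
    case (elim x)
    have "(\<lambda>m. Y.average u m (f x) + Y.average v m (f x)) \<longlonglongrightarrow> pullback u x + pullback v x"
      using elim unfolding pullback_def by (intro tendsto_add) (simp_all add: convergent_LIMSEQ_iff)
    then have "lim (\<lambda>m. Y.average u m (f x) + Y.average v m (f x)) = pullback u x + pullback v x" by (rule limI)
    moreover have "x \<in> MX" using elim by (simp add: X.space_\<mu>)
    then have "Y.average (\<lambda>\<xi>. u \<xi> + v \<xi>) m (f x) = Y.average u m (f x) + Y.average v m (f x)" for m
      by (rule Y.average_add[OF f_in BY(2)[OF u] BY(2)[OF v]])
    ultimately show ?case by (simp add: pullback_def)
  qed
  have cmult: "AE x in \<mu>. pullback (\<lambda>\<xi>. c * u \<xi>) x = c * pullback u x" if u: "u \<in> ?BY" for u c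
    using conv_AE[OF u]
  proof eventually_elim
    case (elim x)
    have "(\<lambda>m. c * Y.average u m (f x)) \<longlonglongrightarrow> c * pullback u x"
      using elim unfolding pullback_def by (intro tendsto_mult_left) (simp add: convergent_LIMSEQ_iff)
    then have "lim (\<lambda>m. c * Y.average u m (f x)) = c * pullback u x" by (rule limI)
    then show ?case by (simp add: pullback_def Y.average_cmult)
  qed
  define a where "a = 2 powr p * (1 + W * (C * CY))"
  define b where "b = D * (C * CY) + 1"
  have "0 \<le> W * (C * CY)" "0 \<le> D * (C * CY)" using W C CY(1) D by auto
  then have ab: "0 < a" "0 < b" unfolding a_def b_def by (auto intro!: mult_pos_pos)
  have norm: "besov_norm (boundary_dist \<epsilon>X) \<mu> \<theta>X p (pullback u)
      \<le> ennreal ((2 * a) powr (1 / p) + (2 * b) powr (1 / p)) * besov_norm (boundary_dist \<epsilon>Y) \<nu> \<theta>Y p u"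
    if u: "u \<in> ?BY" for u
  proof -
    have "?IX (pullback u) \<le> ennreal (2 powr p) * (?IY u + ennreal (W * (C * CY)) * ?SY u)" by (rule lp[OF u])
    also have "\<dots> \<le> ennreal (2 powr p) * (ennreal (1 + W * (C * CY)) * (?IY u + ?SY u))"
    proof (intro mult_left_mono)
      have "ennreal 1 * ?IY u + ennreal (W * (C * CY)) * ?SY u
          \<le> ennreal (1 + W * (C * CY)) * ?IY u + ennreal (1 + W * (C * CY)) * ?SY u"
        using W C CY(1) by (intro add_mono mult_right_mono ennreal_leI) auto
      then show "?IY u + ennreal (W * (C * CY)) * ?SY u \<le> ennreal (1 + W * (C * CY)) * (?IY u + ?SY u)"
        by (simp add: distrib_left)
    qed simp
    also have "\<dots> = ennreal a * (?IY u + ?SY u)"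
      unfolding a_def using W C CY(1) by (subst ennreal_mult[of "2 powr p"]) (auto simp: mult.assoc)
    finally have 1: "lp_norm \<mu> p (pullback u) \<le> ennreal ((2 * a) powr (1 / p)) *
        (lp_norm \<nu> p u + besov_seminorm (boundary_dist \<epsilon>Y) \<nu> \<theta>Y p u)"
      by (rule enn_powr_sum_bound[OF p ab(1)])
    have "?SX (pullback u) \<le> ennreal (D * (C * CY)) * ?SY u" by (rule semi[OF u])
    also have "\<dots> \<le> ennreal b * (?IY u + ?SY u)"
      by (intro mult_mono ennreal_leI) (auto simp: b_def)
    finally have 2: "besov_seminorm (boundary_dist \<epsilon>X) \<mu> \<theta>X p (pullback u) \<le> ennreal ((2 * b) powr (1 / p)) *
        (lp_norm \<nu> p u + besov_seminorm (boundary_dist \<epsilon>Y) \<nu> \<theta>Y p u)"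
      by (rule enn_powr_sum_bound[OF p ab(2)])
    show ?thesis
      unfolding besov_norm_def using add_mono[OF 1 2] by (simp add: ennreal_plus distrib_right)
  qed
  show ?thesis
    unfolding bounded_linear_besov_def
  proof (intro conjI ballI impI allI)
    show "AE x in \<mu>. pullback u x = pullback v x"
      if "u \<in> ?BY" "v \<in> ?BY" "AE \<xi> in \<nu>. u \<xi> = v \<xi>" for u v
      using pullback_cong_AE[OF that(3) BY(1)[OF that(1)] BY(1)[OF that(2)]] by (intro AE_I2) (simp add: X.space_\<mu>)
    show "\<exists>C. \<forall>u\<in>?BY. besov_norm (boundary_dist \<epsilon>X) \<mu> \<theta>X p (pullback u)
        \<le> ennreal C * besov_norm (boundary_dist \<epsilon>Y) \<nu> \<theta>Y p u"
      using norm by blast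
  qed (use in_BX add cmult in auto)
qed

lemma pullback_continuous:
  assumes u: "integrable \<nu> u" and cont: "continuous_map Y.mtopology euclideanreal u" and x: "x \<in> MX"
  shows "pullback u x = u (f x)"
  unfolding pullback_def by (rule limI) (rule Y.average_tendsto_continuous[OF u cont f_in[OF x]])

end


section \<open>The embedding theorem\<close>

text \<open>
  Distances are exponentials of levels, so a distortion function of power type becomes affine in
  the levels after taking logarithms. Below \<open>1\<close> its exponent is \<open>\<alpha>\<^sub>1\<close>, above \<open>1\<close> it is \<open>\<alpha>\<^sub>2\<close>.
\<close>

lemma quasisymmetric_distortion:
  fixes \<eta> :: "real \<Rightarrow> real" and A \<alpha>\<^sub>1 \<alpha>\<^sub>2 :: real
  assumes X: "ray_metric MX KX \<epsilon>X" and Y: "ray_metric MY KY \<epsilon>Y"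
    and A: "0 < A" and \<alpha>: "0 < \<alpha>\<^sub>1" "0 < \<alpha>\<^sub>2"
    and \<eta>1: "\<And>t. 0 \<le> t \<Longrightarrow> t \<le> 1 \<Longrightarrow> \<eta> t = A * t powr \<alpha>\<^sub>1"
    and \<eta>2: "\<And>t. 1 \<le> t \<Longrightarrow> \<eta> t = A * t powr \<alpha>\<^sub>2"
    and f_in: "\<And>x. x \<in> MX \<Longrightarrow> f x \<in> MY" and inj: "inj_on f MX"
    and qs: "\<And>x y z. x \<in> MX \<Longrightarrow> y \<in> MX \<Longrightarrow> z \<in> MX \<Longrightarrow> x \<noteq> z \<Longrightarrow>
      boundary_dist \<epsilon>Y (f x) (f y) / boundary_dist \<epsilon>Y (f x) (f z)
        \<le> \<eta> (boundary_dist \<epsilon>X x y / boundary_dist \<epsilon>X x z)"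
    and xyz: "x \<in> MX" "y \<in> MX" "z \<in> MX" "x n = y n" "x (Suc k) \<noteq> z (Suc k)"
      "f x (Suc i) \<noteq> f y (Suc i)" "f x j = f z j"
  shows "k \<le> n \<Longrightarrow> \<epsilon>Y * (real j - real i) \<le> ln A + \<alpha>\<^sub>1 * \<epsilon>X * (real k - real n)"
    and "n \<le> k \<Longrightarrow> \<epsilon>Y * (real j - real i) \<le> ln A + \<alpha>\<^sub>2 * \<epsilon>X * (real k - real n)"
proof -
  interpret X: ray_metric MX KX \<epsilon>X by (rule X)
  interpret Y: ray_metric MY KY \<epsilon>Y by (rule Y)
  define t where "t = boundary_dist \<epsilon>X x y / boundary_dist \<epsilon>X x z"
  \<comment> \<open>the bound for the distance ratio \<open>t\<close> that depends on the levels only\<close>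
  define \<tau> where "\<tau> = exp (\<epsilon>X * (real k - real n))"
  have xz: "x \<noteq> z" using xyz(5) by auto
  then have fxz: "f x \<noteq> f z" using inj xyz unfolding inj_on_def by blast
  have rX: "X.radius n / X.radius k = \<tau>"
    using X.\<epsilon>_pos by (simp add: X.radius_def \<tau>_def exp_diff[symmetric] algebra_simps)
  have rY: "Y.radius i / Y.radius j = exp (\<epsilon>Y * (real j - real i))"
    using Y.\<epsilon>_pos by (simp add: Y.radius_def exp_diff[symmetric] algebra_simps)
  have t0: "0 \<le> t" unfolding t_def by simp
  have t\<tau>: "t \<le> \<tau>"
    unfolding t_def rX[symmetric]
    using X.dist_le_radius[OF xyz(1,2,4)] X.radius_le_dist[of x k z, OF xyz(5)] X.radius_pos
    by (intro frac_le) (auto intro: less_imp_le)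
  have "exp (\<epsilon>Y * (real j - real i)) \<le> boundary_dist \<epsilon>Y (f x) (f y) / boundary_dist \<epsilon>Y (f x) (f z)"
    unfolding rY[symmetric]
  proof (rule frac_le)
    show "Y.radius i \<le> boundary_dist \<epsilon>Y (f x) (f y)" by (rule Y.radius_le_dist[of "f x" i "f y", OF xyz(6)])
    show "boundary_dist \<epsilon>Y (f x) (f z) \<le> Y.radius j"
      by (rule Y.dist_le_radius[OF f_in[OF xyz(1)] f_in[OF xyz(3)] xyz(7)])
    show "0 < boundary_dist \<epsilon>Y (f x) (f z)" using fxz Y.\<epsilon>_pos by (simp add: boundary_dist_def)
    show "0 \<le> boundary_dist \<epsilon>Y (f x) (f y)" by simp
  qed
  also have "\<dots> \<le> \<eta> t" unfolding t_def by (rule qs[OF xyz(1-3) xz])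
  finally have le: "exp (\<epsilon>Y * (real j - real i)) \<le> \<eta> t" .
  have log: "\<epsilon>Y * (real j - real i) \<le> ln A + \<alpha> * \<epsilon>X * (real k - real n)"
    if "\<eta> t \<le> A * \<tau> powr \<alpha>" for \<alpha>
  proof -
    have "A * \<tau> powr \<alpha> = exp (ln A + \<alpha> * \<epsilon>X * (real k - real n))"
      using A by (simp add: \<tau>_def powr_def exp_add mult.assoc)
    then have "exp (\<epsilon>Y * (real j - real i)) \<le> exp (ln A + \<alpha> * \<epsilon>X * (real k - real n))"
      using order_trans[OF le that] by (simp only:)
    then show ?thesis by (simp only: exp_le_cancel_iff)
  qed
  show "\<epsilon>Y * (real j - real i) \<le> ln A + \<alpha>\<^sub>1 * \<epsilon>X * (real k - real n)" if "k \<le> n"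
  proof (rule log)
    have "\<tau> \<le> 1" using that X.\<epsilon>_pos by (simp add: \<tau>_def mult_le_0_iff)
    then show "\<eta> t \<le> A * \<tau> powr \<alpha>\<^sub>1"
      using \<eta>1[OF t0] t0 t\<tau> A \<alpha>(1) by (auto intro!: powr_mono2)
  qed
  show "\<epsilon>Y * (real j - real i) \<le> ln A + \<alpha>\<^sub>2 * \<epsilon>X * (real k - real n)" if "n \<le> k"
  proof (rule log)
    have \<tau>1: "1 \<le> \<tau>" using that X.\<epsilon>_pos by (simp add: \<tau>_def)
    show "\<eta> t \<le> A * \<tau> powr \<alpha>\<^sub>2"
    proof (cases "t \<le> 1")
      case True
      have "t powr \<alpha>\<^sub>1 \<le> 1" using True t0 \<alpha>(1) powr_mono2[of \<alpha>\<^sub>1 t 1] by simp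
      also have "1 \<le> \<tau> powr \<alpha>\<^sub>2" using \<tau>1 \<alpha>(2) by (simp add: ge_one_powr_ge_zero)
      finally show ?thesis using \<eta>1[OF t0 True] A by simp
    next
      case False
      then show ?thesis using \<eta>2[of t] t\<tau> A \<alpha>(2) by (auto intro!: powr_mono2)
    qed
  qed
qed



theorem theorem8p3:
  fixes X :: "'v rooted_graph" and Y :: "'w rooted_graph"
    and K_X K_Y :: nat
    and \<epsilon>_X \<epsilon>_Y Q_X Q_Y :: real
    and d_X :: "(nat \<Rightarrow> 'v) \<Rightarrow> (nat \<Rightarrow> 'v) \<Rightarrow> real"
    and d_Y :: "(nat \<Rightarrow> 'w) \<Rightarrow> (nat \<Rightarrow> 'w) \<Rightarrow> real"
    and \<nu>_X :: "(nat \<Rightarrow> 'v) measure" and \<nu>_Y :: "(nat \<Rightarrow> 'w) measure"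
    and f :: "(nat \<Rightarrow> 'v) \<Rightarrow> (nat \<Rightarrow> 'w)"
    and \<eta> :: "real \<Rightarrow> real"
    and A \<alpha>\<^sub>1 \<alpha>\<^sub>2 p \<theta>_X \<theta>_Y :: real
  assumes "K_X \<ge> 2" and "K_Y \<ge> 2"
    and "regular_tree K_X X" and "regular_tree K_Y Y"
    and "\<epsilon>_X > 0" and "\<epsilon>_Y > 0"
    and "d_X = boundary_dist \<epsilon>_X" and "d_Y = boundary_dist \<epsilon>_Y"
    and "Q_X = ln (real K_X) / \<epsilon>_X" and "Q_Y = ln (real K_Y) / \<epsilon>_Y"
    and "\<nu>_X = normalized_hausdorff_measure (boundary X) d_X Q_X"
    and "\<nu>_Y = normalized_hausdorff_measure (boundary Y) d_Y Q_Y"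
    and "A > 0" and "\<alpha>\<^sub>1 > 0" and "\<alpha>\<^sub>2 > 0"
    and "\<And>t. 0 \<le> t \<Longrightarrow> t \<le> 1 \<Longrightarrow> \<eta> t = A * t powr \<alpha>\<^sub>1"
    and "\<And>t. 1 \<le> t \<Longrightarrow> \<eta> t = A * t powr \<alpha>\<^sub>2"
    and "quasisymmetric (boundary X) d_X (boundary Y) d_Y \<eta> f"
    and "1 \<le> p"
    and "0 < \<theta>_X" and "\<theta>_X < 1" and "0 < \<theta>_Y" and "\<theta>_Y < 1"
    and "\<theta>_Y \<ge> Q_Y / p \<Longrightarrow> \<theta>_X \<le> Q_X / p + \<alpha>\<^sub>1 * (\<theta>_Y - Q_Y / p)"
    and "\<theta>_Y \<le> Q_Y / p \<Longrightarrow> \<theta>_X \<le> Q_X / p + \<alpha>\<^sub>2 * (\<theta>_Y - Q_Y / p)"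
  shows "\<exists>f_sharp :: ((nat \<Rightarrow> 'w) \<Rightarrow> real) \<Rightarrow> ((nat \<Rightarrow> 'v) \<Rightarrow> real).
           bounded_linear_besov d_Y \<nu>_Y \<theta>_Y d_X \<nu>_X \<theta>_X p f_sharp \<and>
           (\<forall>u\<in>besov_space d_Y \<nu>_Y \<theta>_Y p.
              continuous_map (Metric_space.mtopology (boundary Y) d_Y) euclideanreal u \<longrightarrow>
              (AE \<zeta> in \<nu>_X. f_sharp u \<zeta> = (u \<circ> f) \<zeta>))"
proof -
  let ?MX = "boundary X" and ?MY = "boundary Y"
  have X: "ray_metric ?MX K_X \<epsilon>_X" and Y: "ray_metric ?MY K_Y \<epsilon>_Y"
    using assms(1-6) by (auto intro!: ray_metric.intro regular_rays_boundary simp: ray_metric_axioms_def)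
  interpret X: ray_metric ?MX K_X \<epsilon>_X by (rule X)
  interpret Y: ray_metric ?MY K_Y \<epsilon>_Y by (rule Y)
  have \<nu>: "\<nu>_X = X.\<nu>" "\<nu>_Y = Y.\<nu>" using assms(7-12) by (auto simp: X.\<nu>_def Y.\<nu>_def)
  interpret X: uniform_rays ?MX K_X \<epsilon>_X \<nu>_X unfolding \<nu> by (rule X.uniform_rays_hausdorff)
  interpret Y: uniform_rays ?MY K_Y \<epsilon>_Y \<nu>_Y unfolding \<nu> by (rule Y.uniform_rays_hausdorff)
  have hom: "homeomorphic_map X.mtopology Y.mtopology f"
    and qs: "\<And>x y z. x \<in> ?MX \<Longrightarrow> y \<in> ?MX \<Longrightarrow> z \<in> ?MX \<Longrightarrow> x \<noteq> z \<Longrightarrow>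
      boundary_dist \<epsilon>_Y (f x) (f y) / boundary_dist \<epsilon>_Y (f x) (f z)
        \<le> \<eta> (boundary_dist \<epsilon>_X x y / boundary_dist \<epsilon>_X x z)"
    using assms(18) unfolding quasisymmetric_def assms(7,8) by auto
  have image: "f ` ?MX = ?MY" and inj: "inj_on f ?MX" and cont: "continuous_map X.mtopology Y.mtopology f"
    using hom by (auto simp: homeomorphic_eq_everything_map)
  have f_in: "f x \<in> ?MY" if "x \<in> ?MX" for x using image that by blast
  note distortion = quasisymmetric_distortion[OF X Y assms(13-17) f_in inj qs]
  interpret quasisymmetric_rays ?MX K_X \<epsilon>_X \<nu>_X ?MY K_Y \<epsilon>_Y \<nu>_Y f "ln A" \<alpha>\<^sub>1 \<alpha>\<^sub>2
  proof unfold_locales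
    fix x m assume x: "x \<in> ?MX"
    have "openin Y.mtopology (cell ?MY m (f x))"
      unfolding Y.openin_iff_cells using Y.cell_eq Y.cell_subset by blast
    then have "openin X.mtopology {z \<in> topspace X.mtopology. f z \<in> cell ?MY m (f x)}"
      by (rule openin_continuous_map_preimage[OF cont])
    then have "\<exists>n. cell ?MX n x \<subseteq> {z \<in> ?MX. f z \<in> cell ?MY m (f x)}"
      using x Y.mem_cell_self[OF f_in[OF x]] unfolding X.openin_iff_cells by simp
    then show "\<exists>n. f ` cell ?MX n x \<subseteq> cell ?MY m (f x)" by blast
  next
    fix x y z n k i j
    assume *: "x \<in> ?MX" "y \<in> ?MX" "z \<in> ?MX" "x n = y n" "x (Suc k) \<noteq> z (Suc k)"
      "f x (Suc i) \<noteq> f y (Suc i)" "f x j = f z j"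
    show "k \<le> n \<Longrightarrow> \<epsilon>_Y * (real j - real i) \<le> ln A + \<alpha>\<^sub>1 * \<epsilon>_X * (real k - real n)"
      by (rule distortion(1)[OF _ _ _ _ _ _ _ _ *])
    show "n \<le> k \<Longrightarrow> \<epsilon>_Y * (real j - real i) \<le> ln A + \<alpha>\<^sub>2 * \<epsilon>_X * (real k - real n)"
      by (rule distortion(2)[OF _ _ _ _ _ _ _ _ *])
  qed (use assms image inj in auto)
  have p: "0 < p" using assms(19) by simp
  have "bounded_linear_besov (boundary_dist \<epsilon>_Y) \<nu>_Y \<theta>_Y (boundary_dist \<epsilon>_X) \<nu>_X \<theta>_X p pullback"
  proof (rule pullback_bounded_linear)
    have scale: "\<theta>_X * p \<le> Q_X + \<alpha> * (\<theta>_Y * p - Q_Y)"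
      if "\<theta>_X \<le> Q_X / p + \<alpha> * (\<theta>_Y - Q_Y / p)" for \<alpha>
    proof -
      have "\<theta>_X * p \<le> (Q_X / p + \<alpha> * (\<theta>_Y - Q_Y / p)) * p"
        using that p by (intro mult_right_mono) auto
      also have "\<dots> = Q_X + \<alpha> * (\<theta>_Y * p - Q_Y)" using p by (simp add: field_simps)
      finally show ?thesis .
    qed
    show "\<theta>_X * p \<le> ln (real K_X) / \<epsilon>_X + \<alpha>\<^sub>1 * (\<theta>_Y * p - ln (real K_Y) / \<epsilon>_Y)"
      if "ln (real K_Y) / \<epsilon>_Y \<le> \<theta>_Y * p"
    proof -
      have "\<theta>_Y \<ge> Q_Y / p" using that p unfolding assms(10) by (simp only: pos_divide_le_eq)
      then show ?thesis using scale[OF assms(24)] assms(9,10) by simp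
    qed
    show "\<theta>_X * p \<le> ln (real K_X) / \<epsilon>_X + \<alpha>\<^sub>2 * (\<theta>_Y * p - ln (real K_Y) / \<epsilon>_Y)"
      if "\<theta>_Y * p \<le> ln (real K_Y) / \<epsilon>_Y"
    proof -
      have "\<theta>_Y \<le> Q_Y / p" using that p unfolding assms(10) by (simp only: pos_le_divide_eq)
      then show ?thesis using scale[OF assms(25)] assms(9,10) by simp
    qed
  qed (use assms in auto)
  moreover have "AE \<zeta> in \<nu>_X. pullback u \<zeta> = (u \<circ> f) \<zeta>"
    if u: "u \<in> besov_space d_Y \<nu>_Y \<theta>_Y p" and "continuous_map Y.mtopology euclideanreal u" for u
  proof -
    have "integrable \<nu>_Y u" using Y.lp_integrable[OF assms(19)] u unfolding besov_space_def by blast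
    then show ?thesis
      using pullback_continuous that(2) by (intro AE_I2) (simp add: X.space_\<mu>)
  qed
  ultimately show ?thesis unfolding assms(7,8) by blast
qed

end
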